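(* Let $\mathsf{H}$ be a quaternionic Hilbert space, let $T\in\mathfrak{B}(\mathsf{H})$ be a normal operator, let $\jmath\in\mathbb{S}$, and let $J\in\mathfrak{B}(\mathsf{H})$ be an anti self-adjoint and unitary operator such that $TJ=JT$, $T^*J=JT^*$ and $T=(T+T^* )\frac12+J|T-T^*|\frac12$. There exists, and is unique, a continuous $^*$-homomorphism $$\Psi_{\mathbb{C}_\jmath,T}:\mathcal{S}_{\mathbb{C}_\jmath}(\sigma_S(T),\mathbb{H})\ni f\mapsto f(T)\in\mathfrak{B}(\mathsf{H})$$ of $\mathbb{C}_\jmath$-Banach unital $C^*$-algebras such that: (i) $\Psi_{\mathbb{C}_\jmath,T}$ is unity-preserving, that is, $\Psi_{\mathbb{C}_\jmath,T}(1_{\sigma_S(T)})=\mathrm{I}$; (ii) $\Psi_{\mathbb{C}_\jmath,T}(\mathrm{id})=T$, where $\mathrm{id}:\sigma_S(T)\hookrightarrow\mathbb{H}$ is the inclusion map. The following further facts hold true. (a) Let $f\in\mathcal{S}_{\mathbb{C}_\jmath}(\sigma_S(T),\mathbb{H})$ and let $f_0,f_1$ be the unique functions in $\mathcal{S}_{\mathbb{R}}(\sigma_S(T),\mathbb{H})$ such that $f=f_0+f_1\jmath$. Then $\Psi_{\mathbb{C}_\jmath,T}(f)=\Psi_{\mathbb{R},T}(f_0)+\Psi_{\mathbb{R},T}(f_1)J$. (b) For every $f\in\mathcal{S}_{\mathbb{C}_\jmath}(\sigma_S(T),\mathbb{H})$, $\Psi_{\mathbb{C}_\jmath,T}(f)$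 is normal and commutes with $J$. (c) For every $f\in\mathcal{S}_{\mathbb{C}_\jmath}(\sigma_S(T),\mathbb{H})$, $\sigma_S(f(T))=\Omega_{f(\sigma_S(T)\cap\mathbb{C}_\jmath^+)}$. (d) $\Psi_{\mathbb{C}_\jmath,T}$ is norm decreasing, that is, $\|f(T)\|\le\|f\|_\infty$ for $f\in\mathcal{S}_{\mathbb{C}_\jmath}(\sigma_S(T),\mathbb{H})$. More precisely, $\|f(T)\|=\|f|_{\sigma_S(T)\cap\mathbb{C}_\jmath^+}\|_\infty$ for every such $f$. (e) The kernel of $\Psi_{\mathbb{C}_\jmath,T}$ consists of all functions in $\mathcal{S}_{\mathbb{C}_\jmath}(\sigma_S(T),\mathbb{H})$ vanishing on $\sigma_S(T)\cap\mathbb{C}_\jmath^+$. More precisely, $f\in\mathrm{Ker}(\Psi_{\mathbb{C}_\jmath,T})$ if and only if there exists a continuous function $g:\sigma_S(T)\cap\mathbb{C}_\jmath^-\to\mathbb{C}_\jmath$ with $g|_{\sigma_S(T)\cap\mathbb{R}}=0$ such that $f(\alpha+\imath\beta)=\frac12(1+\imath\jmath)\,g(\alpha-\jmath\beta)$ for every $\alpha\in\mathbb{R}$, $\beta\in[0,+\infty)$ and $\imath\in\mathbb{S}$ with $\alpha+\imath\beta\in\sigma_S(T)$.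
   Context: $\mathbb{H}$ denotes the quaternions, with conjugation $q\mapsto\overline q$ and norm $|q|=\sqrt{q\overline q}$; $\mathbb{S}=\{q\in\mathbb{H}:q^2=-1\}$; for $\jmath\in\mathbb{S}$, $\mathbb{C}_\jmath=\{\alpha+\jmath\beta:\alpha,\beta\in\mathbb{R}\}$, $\mathbb{C}_\jmath^{+}$ (resp. $\mathbb{C}_\jmath^-$) is the subset where $\beta\ge0$ (resp. $\beta\le0$). A quaternionic Hilbert space $\mathsf{H}$ is a nonzero right $\mathbb{H}$-module with a scalar product $\langle\cdot|\cdot\rangle$ valued in $\mathbb{H}$, right $\mathbb{H}$-linear in the second argument, with $\langle u|v\rangle=\overline{\langle v|u\rangle}$, $\langle u|u\rangle\ge0$ (zero only for $u=0$), complete for $\|u\|=\sqrt{\langle u|u\rangle}$. $\mathfrak{B}(\mathsf{H})$: everywhere defined bounded right $\mathbb{H}$-linear operators, with operator norm; $T^*$ adjoint; $\mathrm{I}$ identity; $(Tr)(u)=T(u)r$ for $r\in\mathbb{R}$. Normal: $TT^*=T^*T$; anti self-adjoint: $J^*=-J$; unitary: $J^*J=JJ^*=\mathrm{I}$; $|S|=\sqrt{S^*S}$ (unique positive square root). Spherical spectrum: $\Delta_q(T):=T^2-T(q+\overline q)+\mathrm{I}|q|^2$ for $q\in\mathbb{H}$; for $T\in\mathfrak{B}(\mathsf{H})$, $\sigma_S(T)$ is the set of $q$ such that $\Delta_q(T)$ is not invertible in $\mathfrak{B}(\mathsf{H})$. It is a non-empty compact set of the form $\Omega_{\mathcal K}$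 with $\mathcal K\subset\mathbb{C}$ compact and conjugation invariant, where for $\mathcal K\subset\mathbb{C}$, $\Omega_{\mathcal K}:=\{\alpha+\imath\beta:\alpha,\beta\in\mathbb{R},\ \alpha+i\beta\in\mathcal K,\ \imath\in\mathbb{S}\}$; for $E\subset\mathbb{C}_\jmath$, $\Omega_E:=\{\alpha+\imath\beta:\alpha,\beta\in\mathbb{R},\ \alpha+\jmath\beta\in E,\ \imath\in\mathbb{S}\}$. Slice functions: a continuous stem function on $\mathcal K$ is $F=F_1+iF_2$ with $F_1,F_2:\mathcal K\to\mathbb{H}$ continuous, $F_1(\overline z)=F_1(z)$, $F_2(\overline z)=-F_2(z)$; it induces the continuous slice function $f=\mathcal I(F):\Omega_{\mathcal K}\to\mathbb{H}$, $f(\alpha+\imath\beta)=F_1(\alpha+i\beta)+\imath F_2(\alpha+i\beta)$ for $\imath\in\mathbb{S}$ ($F$ is uniquely determined by $f$). $\mathcal{S}_{\mathbb{R}}(\Omega_{\mathcal K},\mathbb{H})$ (resp. $\mathcal{S}_{\mathbb{C}_\jmath}(\Omega_{\mathcal K},\mathbb{H})$) is the set of those with $F_1,F_2$ real-valued (resp. $\mathbb{C}_\jmath$-valued). Slice product: $\mathcal I(F)\cdot\mathcal I(G):=\mathcal I\big((F_1G_1-F_2G_2)+i(F_1G_2+F_2G_1)\big)$; involution: $\mathcal I(F)^*:=\mathcal I(\overline{F_1}-i\,\overline{F_2})$ with $\overline{F_h}(z)=\overline{F_h(z)}$; $\|f\|_\infty=\sup|f|$. With pointwise sum, slice product, right scalar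 multiplication $(f,q)\mapsto fq$ (pointwise, $q\in\mathbb{C}_\jmath$), this involution, unity the constant $1_{\Omega_{\mathcal K}}$ and norm $\|\cdot\|_\infty$, $\mathcal{S}_{\mathbb{C}_\jmath}(\Omega_{\mathcal K},\mathbb{H})$ is a commutative $\mathbb{C}_\jmath$-Banach unital $C^*$-algebra. On $\mathcal{S}_{\mathbb{R}}$ the slice product is the pointwise product and $f^*=\overline f$. On $\mathfrak{B}(\mathsf{H})$ one uses composition, adjunction and the scalar multiplication by $\mathbb{C}_\jmath$ given by $(S,\alpha+\jmath\beta)\mapsto S\alpha+(S\beta)J$. A $^*$-homomorphism of $\mathbb{C}_\jmath$-Banach unital $C^*$-algebras is here a map preserving sums, products, these scalar multiplications by $\mathbb{C}_\jmath$, the involutions and the unities. $\Psi_{\mathbb{R},T}:\mathcal{S}_{\mathbb{R}}(\sigma_S(T),\mathbb{H})\to\mathfrak{B}(\mathsf{H})$ denotes the unique continuous $^*$-homomorphism of real Banach unital $C^*$-algebras sending $1_{\sigma_S(T)}$ to $\mathrm{I}$ and the inclusion $\mathrm{id}:\sigma_S(T)\hookrightarrow\mathbb{H}$ to $T$. *)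

theory Defs
  imports "HOL-Analysis.Analysis"
begin

section \<open>Quaternions\<close>

codatatype quat = Quat (qRe: real) (qI: real) (qJ: real) (qK: real)

lemma quat_eq_iff: "p = q \<longleftrightarrow> qRe p = qRe q \<and> qI p = qI q \<and> qJ p = qJ q \<and> qK p = qK q"
  by (auto intro: quat.expand)

instantiation quat :: real_vector
begin

primcorec zero_quat where
  "qRe 0 = 0" | "qI 0 = 0" | "qJ 0 = 0" | "qK 0 = 0"

primcorec plus_quat where
  "qRe (p + q) = qRe p + qRe q"
| "qI (p + q) = qI p + qI q"
| "qJ (p + q) = qJ p + qJ q"
| "qK (p + q) = qK p + qK q"

primcorec uminus_quat where
  "qRe (- q) = - qRe q" | "qI (- q) = - qI q" | "qJ (- q) = - qJ q" | "qK (- q) = - qK q"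

primcorec minus_quat where
  "qRe (p - q) = qRe p - qRe q"
| "qI (p - q) = qI p - qI q"
| "qJ (p - q) = qJ p - qJ q"
| "qK (p - q) = qK p - qK q"

primcorec scaleR_quat where
  "qRe (scaleR r q) = r * qRe q"
| "qI (scaleR r q) = r * qI q"
| "qJ (scaleR r q) = r * qJ q"
| "qK (scaleR r q) = r * qK q"

instance
  by standard (simp_all add: quat_eq_iff algebra_simps)

end

instantiation quat :: real_inner
begin

definition inner_quat_def:
  "inner (p::quat) q = qRe p * qRe q + qI p * qI q + qJ p * qJ q + qK p * qK q"

definition norm_quat_def:
  "norm (q::quat) = sqrt ((qRe q)\<^sup>2 + (qI q)\<^sup>2 + (qJ q)\<^sup>2 + (qK q)\<^sup>2)"

definition sgn_quat_def:
  "sgn (q::quat) = q /\<^sub>R norm q"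

definition dist_quat_def:
  "dist (p::quat) q = norm (p - q)"

definition uniformity_quat_def:
  "(uniformity :: (quat \<times> quat) filter) = (INF e\<in>{0 <..}. principal {(p, q). dist p q < e})"

definition open_quat_def:
  "open (U :: quat set) \<longleftrightarrow> (\<forall>p\<in>U. eventually (\<lambda>(p', q). p' = p \<longrightarrow> q \<in> U) uniformity)"

instance
proof
  fix p q r :: quat and a :: real and U :: "quat set"
  show "inner p q = inner q p"
    by (simp add: inner_quat_def mult.commute)
  show "inner (p + q) r = inner p r + inner q r"
    by (simp add: inner_quat_def algebra_simps)
  show "inner (a *\<^sub>R p) q = a * inner p q"
    by (simp add: inner_quat_def algebra_simps)
  show "0 \<le> inner p p"
    by (simp add: inner_quat_def)
  show "inner p p = 0 \<longleftrightarrow> p = 0"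
    by (auto simp: inner_quat_def quat_eq_iff add_nonneg_eq_0_iff)
  show "norm p = sqrt (inner p p)"
    by (simp add: inner_quat_def norm_quat_def power2_eq_square)
qed (rule sgn_quat_def dist_quat_def open_quat_def uniformity_quat_def)+

end

primcorec qcnj :: "quat \<Rightarrow> quat" where
  "qRe (qcnj q) = qRe q" | "qI (qcnj q) = - qI q" | "qJ (qcnj q) = - qJ q" | "qK (qcnj q) = - qK q"

instantiation quat :: real_normed_div_algebra
begin

primcorec one_quat where
  "qRe 1 = 1" | "qI 1 = 0" | "qJ 1 = 0" | "qK 1 = 0"

primcorec times_quat where
  "qRe (p * q) = qRe p * qRe q - qI p * qI q - qJ p * qJ q - qK p * qK q"
| "qI (p * q) = qRe p * qI q + qI p * qRe q + qJ p * qK q - qK p * qJ q"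
| "qJ (p * q) = qRe p * qJ q - qI p * qK q + qJ p * qRe q + qK p * qI q"
| "qK (p * q) = qRe p * qK q + qI p * qJ q - qJ p * qI q + qK p * qRe q"

definition inverse_quat_def:
  "inverse (q::quat) = qcnj q /\<^sub>R ((qRe q)\<^sup>2 + (qI q)\<^sup>2 + (qJ q)\<^sup>2 + (qK q)\<^sup>2)"

definition divide_quat_def:
  "p div (q::quat) = p * inverse q"

instance
proof
  fix p q r :: quat and a :: real
  show "p * q * r = p * (q * r)" "1 * p = p" "p * 1 = p"
    "(p + q) * r = p * r + q * r" "p * (q + r) = p * q + p * r"
    "(0::quat) \<noteq> 1" "a *\<^sub>R p * q = a *\<^sub>R (p * q)" "p * a *\<^sub>R q = a *\<^sub>R (p * q)"
    by (simp_all add: quat_eq_iff algebra_simps)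
  show "p div q = p * inverse q"
    by (rule divide_quat_def)
  show "inverse 0 = (0::quat)"
    by (simp add: inverse_quat_def quat_eq_iff)
  show "norm (p * q) = norm p * norm q"
    by (simp add: norm_quat_def real_sqrt_mult [symmetric] power2_eq_square algebra_simps)
  assume "p \<noteq> 0"
  then have "inner p p \<noteq> 0"
    by simp
  then have nz: "(qRe p)\<^sup>2 + (qI p)\<^sup>2 + (qJ p)\<^sup>2 + (qK p)\<^sup>2 \<noteq> 0"
    unfolding inner_quat_def power2_eq_square .
  define n where "n = (qRe p)\<^sup>2 + (qI p)\<^sup>2 + (qJ p)\<^sup>2 + (qK p)\<^sup>2"
  have "qcnj p * p = n *\<^sub>R 1" "p * qcnj p = n *\<^sub>R 1"
    by (simp_all add: quat_eq_iff n_def power2_eq_square algebra_simps)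
  moreover have "a *\<^sub>R p * q = a *\<^sub>R (p * q)" "p * a *\<^sub>R q = a *\<^sub>R (p * q)" for a and p q :: quat
    by (simp_all add: quat_eq_iff algebra_simps)
  ultimately show "inverse p * p = 1" "p * inverse p = 1"
    using nz by (simp_all add: inverse_quat_def n_def [symmetric])
qed

end

lemma quat_of_real_sel [simp]:
  "qRe (of_real r) = r" "qI (of_real r) = 0" "qJ (of_real r) = 0" "qK (of_real r) = 0"
  by (simp_all add: of_real_def)

lemma quat_mult_qcnj: "q * qcnj q = of_real ((norm q)\<^sup>2)"
  by (simp add: quat_eq_iff norm_quat_def power2_eq_square algebra_simps)

lemma quat_of_real_commute: "of_real r * q = q * of_real (r::real)" for q :: quat
  by (simp add: quat_eq_iff)

definition imag_units :: "quat set" where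
  "imag_units = {q. q\<^sup>2 = - 1}"

definition slice_plane :: "quat \<Rightarrow> quat set" where
  "slice_plane j = {of_real \<alpha> + j * of_real \<beta> | \<alpha> \<beta>. True}"

definition upper_half_slice :: "quat \<Rightarrow> quat set" where
  "upper_half_slice j = {of_real \<alpha> + j * of_real \<beta> | \<alpha> \<beta>. 0 \<le> \<beta>}"

definition lower_half_slice :: "quat \<Rightarrow> quat set" where
  "lower_half_slice j = {of_real \<alpha> + j * of_real \<beta> | \<alpha> \<beta>. \<beta> \<le> 0}"

text \<open>The circular sets \<open>\<Omega>\<^sub>K\<close> for \<open>K \<subseteq> \<complex>\<close> and \<open>\<Omega>\<^sub>E\<close> for \<open>E \<subseteq> \<complex>\<^sub>j\<close>.\<close>

definition circ :: "complex set \<Rightarrow> quat set" where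
  "circ K = {of_real \<alpha> + \<iota> * of_real \<beta> | \<alpha> \<beta> \<iota>. Complex \<alpha> \<beta> \<in> K \<and> \<iota> \<in> imag_units}"

definition circ_slice :: "quat \<Rightarrow> quat set \<Rightarrow> quat set" where
  "circ_slice j E =
     {of_real \<alpha> + \<iota> * of_real \<beta> | \<alpha> \<beta> \<iota>. of_real \<alpha> + j * of_real \<beta> \<in> E \<and> \<iota> \<in> imag_units}"

lemma imag_units_iff: "\<iota> \<in> imag_units \<longleftrightarrow> qRe \<iota> = 0 \<and> (qI \<iota>)\<^sup>2 + (qJ \<iota>)\<^sup>2 + (qK \<iota>)\<^sup>2 = 1"
proof
  assume "\<iota> \<in> imag_units"
  then have *: "qRe \<iota> * qRe \<iota> - qI \<iota> * qI \<iota> - qJ \<iota> * qJ \<iota> - qK \<iota> * qK \<iota> = -1"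
      "qRe \<iota> * qI \<iota> = 0" "qRe \<iota> * qJ \<iota> = 0" "qRe \<iota> * qK \<iota> = 0"
    by (auto simp: imag_units_def power2_eq_square quat_eq_iff)
  have "qRe \<iota> = 0"
  proof (rule ccontr)
    assume "qRe \<iota> \<noteq> 0"
    with * have "qRe \<iota> * qRe \<iota> = -1"
      by simp
    moreover have "0 \<le> qRe \<iota> * qRe \<iota>"
      by simp
    ultimately show False
      by linarith
  qed
  with * show "qRe \<iota> = 0 \<and> (qI \<iota>)\<^sup>2 + (qJ \<iota>)\<^sup>2 + (qK \<iota>)\<^sup>2 = 1"
    by (simp add: power2_eq_square)
next
  assume "qRe \<iota> = 0 \<and> (qI \<iota>)\<^sup>2 + (qJ \<iota>)\<^sup>2 + (qK \<iota>)\<^sup>2 = 1"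
  then show "\<iota> \<in> imag_units"
    by (auto simp: imag_units_def power2_eq_square quat_eq_iff)
qed

lemma imag_unit_square: "\<iota> \<in> imag_units \<Longrightarrow> \<iota> * \<iota> = - 1"
  by (simp add: imag_units_def power2_eq_square)

lemma imag_unit_uminus: "\<iota> \<in> imag_units \<Longrightarrow> - \<iota> \<in> imag_units"
  by (simp add: imag_units_def)

lemma imag_units_nonempty: "imag_units \<noteq> {}"
proof -
  have "Quat 0 1 0 0 \<in> imag_units"
    by (simp add: imag_units_iff)
  then show ?thesis
    by blast
qed

lemma slice_form_eqD:
  assumes "of_real \<alpha> + \<iota> * of_real \<beta> = of_real \<alpha>' + \<iota>' * of_real \<beta>'"
    and "\<iota> \<in> imag_units" "\<iota>' \<in> imag_units"
  shows "\<alpha> = \<alpha>'" "\<iota> * of_real \<beta> = \<iota>' * of_real \<beta>'"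
    "\<beta> = \<beta>' \<and> (\<iota> = \<iota>' \<or> \<beta> = 0) \<or> \<beta> = - \<beta>' \<and> (\<iota> = - \<iota>' \<or> \<beta> = 0)"
proof -
  note iu = assms(2,3)[unfolded imag_units_iff]
  from assms(1) iu show a: "\<alpha> = \<alpha>'"
    by (simp add: quat_eq_iff)
  with assms(1) show b: "\<iota> * of_real \<beta> = \<iota>' * of_real \<beta>'"
    by simp
  have "(\<iota> * of_real \<beta>) * (\<iota> * of_real \<beta>) = (\<iota> * \<iota>) * of_real (\<beta> * \<beta>)"
    by (simp add: quat_eq_iff algebra_simps)
  moreover have "(\<iota>' * of_real \<beta>') * (\<iota>' * of_real \<beta>') = (\<iota>' * \<iota>') * of_real (\<beta>' * \<beta>')"
    by (simp add: quat_eq_iff algebra_simps)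
  ultimately have "(of_real (\<beta> * \<beta>) :: quat) = of_real (\<beta>' * \<beta>')"
    using b assms(2,3) by (simp add: imag_unit_square)
  then have "\<beta> * \<beta> = \<beta>' * \<beta>'"
    by (metis of_real_eq_iff)
  then have "\<beta> = \<beta>' \<or> \<beta> = - \<beta>'"
    by (simp add: square_eq_iff)
  then show "\<beta> = \<beta>' \<and> (\<iota> = \<iota>' \<or> \<beta> = 0) \<or> \<beta> = - \<beta>' \<and> (\<iota> = - \<iota>' \<or> \<beta> = 0)"
  proof
    assume e: "\<beta> = \<beta>'"
    with b show ?thesis
      by auto
  next
    assume e: "\<beta> = - \<beta>'"
    with b have "\<iota> * of_real \<beta> = (- \<iota>') * of_real \<beta>"
      by simp
    with e show ?thesis
      by (metis mult_right_cancel of_real_eq_0_iff)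
  qed
qed


section \<open>Quaternionic Hilbert spaces and bounded operators\<close>

text \<open>
  The real inner product inherited from \<^class>\<open>real_inner\<close> carries no extra information:
  it is the real part of the quaternionic scalar product, so that the norm of the
  class is \<open>\<parallel>u\<parallel> = sqrt \<langle>u|u\<rangle>\<close>, see \<open>qinner_self\<close> below.
\<close>

class quat_hilbert = real_inner + complete_space +
  fixes qscale :: "'a \<Rightarrow> quat \<Rightarrow> 'a"
    and qinner :: "'a \<Rightarrow> 'a \<Rightarrow> quat"
  assumes qscale_add_left: "qscale (u + v) q = qscale u q + qscale v q"
    and qscale_add_right: "qscale u (p + q) = qscale u p + qscale u q"
    and qscale_mult: "qscale u (p * q) = qscale (qscale u p) q"
    and qscale_of_real: "qscale u (of_real r) = r *\<^sub>R u"
    and qinner_add_right: "qinner u (v + w) = qinner u v + qinner u w"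
    and qinner_qscale_right: "qinner u (qscale v q) = qinner u v * q"
    and qinner_commute: "qinner u v = qcnj (qinner v u)"
    and qinner_nonneg: "0 \<le> qRe (qinner u u)"
    and qinner_definite: "qinner u u = 0 \<Longrightarrow> u = 0"
    and inner_eq_qRe_qinner: "inner u v = qRe (qinner u v)"
    and nonzero_space: "\<exists>u. u \<noteq> 0"

lemma qscale_one: "qscale u 1 = (u :: 'a::quat_hilbert)"
  using qscale_of_real [of u 1] by simp

lemma qinner_self: "qinner u u = of_real ((norm u)\<^sup>2)" for u :: "'a::quat_hilbert"
proof -
  have "qinner u u = qcnj (qinner u u)"
    by (rule qinner_commute)
  then show ?thesis
    by (simp add: quat_eq_iff power2_norm_eq_inner inner_eq_qRe_qinner)
qed

definition nonneg_quat :: "quat \<Rightarrow> bool" where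
  "nonneg_quat q \<longleftrightarrow> q \<in> \<real> \<and> 0 \<le> qRe q"

text \<open>
  \<open>\<BB>(H)\<close> consists of the bounded real-linear maps that are right quaternionic linear; the
  norm inherited from \<^typ>\<open>'a \<Rightarrow>\<^sub>L 'a\<close> is the operator norm.
\<close>

definition bounded_ops :: "('a::quat_hilbert \<Rightarrow>\<^sub>L 'a) set" where
  "bounded_ops = {T. \<forall>u q. blinfun_apply T (qscale u q) = qscale (blinfun_apply T u) q}"

definition adj :: "('a::quat_hilbert \<Rightarrow>\<^sub>L 'a) \<Rightarrow> ('a \<Rightarrow>\<^sub>L 'a)" where
  "adj T = (THE S. S \<in> bounded_ops \<and>
     (\<forall>u v. qinner (blinfun_apply S u) v = qinner u (blinfun_apply T v)))"

definition normal_op :: "('a::quat_hilbert \<Rightarrow>\<^sub>L 'a) \<Rightarrow> bool" where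
  "normal_op T \<longleftrightarrow> T o\<^sub>L adj T = adj T o\<^sub>L T"

definition anti_self_adjoint :: "('a::quat_hilbert \<Rightarrow>\<^sub>L 'a) \<Rightarrow> bool" where
  "anti_self_adjoint T \<longleftrightarrow> adj T = - T"

definition unitary_op :: "('a::quat_hilbert \<Rightarrow>\<^sub>L 'a) \<Rightarrow> bool" where
  "unitary_op T \<longleftrightarrow> adj T o\<^sub>L T = id_blinfun \<and> T o\<^sub>L adj T = id_blinfun"

definition positive_op :: "('a::quat_hilbert \<Rightarrow>\<^sub>L 'a) \<Rightarrow> bool" where
  "positive_op T \<longleftrightarrow> (\<forall>u. nonneg_quat (qinner u (blinfun_apply T u)))"

definition sqrt_op :: "('a::quat_hilbert \<Rightarrow>\<^sub>L 'a) \<Rightarrow> ('a \<Rightarrow>\<^sub>L 'a)" where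
  "sqrt_op A = (THE B. B \<in> bounded_ops \<and> positive_op B \<and> B o\<^sub>L B = A)"

definition abs_op :: "('a::quat_hilbert \<Rightarrow>\<^sub>L 'a) \<Rightarrow> ('a \<Rightarrow>\<^sub>L 'a)" where
  "abs_op S = sqrt_op (adj S o\<^sub>L S)"

definition invertible_op :: "('a::quat_hilbert \<Rightarrow>\<^sub>L 'a) \<Rightarrow> bool" where
  "invertible_op T \<longleftrightarrow> (\<exists>S\<in>bounded_ops. S o\<^sub>L T = id_blinfun \<and> T o\<^sub>L S = id_blinfun)"

text \<open>\<open>q + qcnj q\<close> is real, hence \<^const>\<open>qRe\<close> loses nothing.\<close>

definition Delta_op :: "quat \<Rightarrow> ('a::quat_hilbert \<Rightarrow>\<^sub>L 'a) \<Rightarrow> ('a \<Rightarrow>\<^sub>L 'a)" where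
  "Delta_op q T = (T o\<^sub>L T) - qRe (q + qcnj q) *\<^sub>R T + (norm q)\<^sup>2 *\<^sub>R id_blinfun"

definition spherical_spectrum :: "('a::quat_hilbert \<Rightarrow>\<^sub>L 'a) \<Rightarrow> quat set" where
  "spherical_spectrum T = {q. \<not> invertible_op (Delta_op q T)}"

text \<open>
  The conjugation invariant \<open>K \<subseteq> \<complex>\<close> with \<open>\<sigma>\<^sub>S(T) = \<Omega>\<^sub>K\<close>, see \<open>circ_spectrum_base\<close> and
  \<open>spectrum_base_unique\<close> below.
\<close>

definition spectrum_base :: "('a::quat_hilbert \<Rightarrow>\<^sub>L 'a) \<Rightarrow> complex set" where
  "spectrum_base T = {z. \<exists>\<iota>\<in>imag_units. of_real (Re z) + \<iota> * of_real (Im z) \<in> spherical_spectrum T}"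

lemma Delta_op_slice:
  assumes "\<iota> \<in> imag_units" "\<iota>' \<in> imag_units"
  shows "Delta_op (of_real \<alpha> + \<iota> * of_real \<beta>) T = Delta_op (of_real \<alpha> + \<iota>' * of_real \<beta>) T"
proof -
  have "(norm (of_real \<alpha> + \<kappa> * of_real \<beta>))\<^sup>2 = \<alpha>\<^sup>2 + \<beta>\<^sup>2" if "\<kappa> \<in> imag_units" for \<kappa> :: quat
  proof -
    have "qRe \<kappa> = 0"
      using that by (simp add: imag_units_iff)
    then have "(norm (of_real \<alpha> + \<kappa> * of_real \<beta>))\<^sup>2
        = \<alpha>\<^sup>2 + ((qI \<kappa>)\<^sup>2 + (qJ \<kappa>)\<^sup>2 + (qK \<kappa>)\<^sup>2) * \<beta>\<^sup>2"
      by (simp add: norm_quat_def power_mult_distrib distrib_right)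
    then show ?thesis
      using that by (simp add: imag_units_iff)
  qed
  then show ?thesis
    using assms by (simp add: Delta_op_def imag_units_iff)
qed

lemma quat_slice_form: "\<exists>\<alpha> \<beta>. \<exists>\<iota>\<in>imag_units. q = of_real \<alpha> + \<iota> * of_real \<beta>"
proof -
  define b where "b = sqrt ((qI q)\<^sup>2 + (qJ q)\<^sup>2 + (qK q)\<^sup>2)"
  have b2: "b\<^sup>2 = (qI q)\<^sup>2 + (qJ q)\<^sup>2 + (qK q)\<^sup>2"
    by (simp add: b_def)
  show ?thesis
  proof (cases "b = 0")
    case True
    with b2 have "qI q = 0" "qJ q = 0" "qK q = 0"
      by (simp_all add: add_nonneg_eq_0_iff)
    then have "q = of_real (qRe q) + \<iota> * of_real 0" for \<iota>
      by (simp add: quat_eq_iff)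
    then show ?thesis
      using imag_units_nonempty by blast
  next
    case False
    have "q = of_real (qRe q) + Quat 0 (qI q / b) (qJ q / b) (qK q / b) * of_real b"
      using False by (simp add: quat_eq_iff)
    moreover have "Quat 0 (qI q / b) (qJ q / b) (qK q / b) \<in> imag_units"
      using False by (simp add: imag_units_iff power_divide flip: add_divide_distrib b2)
    ultimately show ?thesis
      by blast
  qed
qed

lemma circ_spectrum_base: "circ (spectrum_base T) = spherical_spectrum T"
proof -
  have *: "of_real \<alpha> + \<iota> * of_real \<beta> \<in> spherical_spectrum T \<longleftrightarrow> Complex \<alpha> \<beta> \<in> spectrum_base T"
    if "\<iota> \<in> imag_units" for \<alpha> \<beta> \<iota>
    using that by (simp add: spectrum_base_def spherical_spectrum_def) (metis Delta_op_slice)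
  show ?thesis
  proof (intro equalityI subsetI)
    fix q assume "q \<in> circ (spectrum_base T)"
    with * show "q \<in> spherical_spectrum T"
      by (auto simp: circ_def)
  next
    fix q assume "q \<in> spherical_spectrum T"
    moreover obtain \<alpha> \<beta> \<iota> where "\<iota> \<in> imag_units" "q = of_real \<alpha> + \<iota> * of_real \<beta>"
      using quat_slice_form by metis
    ultimately show "q \<in> circ (spectrum_base T)"
      using * by (auto simp: circ_def)
  qed
qed

lemma cnj_spectrum_base: "z \<in> spectrum_base T \<Longrightarrow> cnj z \<in> spectrum_base T"
proof -
  assume "z \<in> spectrum_base T"
  then obtain \<iota> where "\<iota> \<in> imag_units" "of_real (Re z) + \<iota> * of_real (Im z) \<in> spherical_spectrum T"
    by (auto simp: spectrum_base_def)
  then have "- \<iota> \<in> imag_units" "of_real (Re (cnj z)) + (- \<iota>) * of_real (Im (cnj z)) \<in> spherical_spectrum T"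
    by (simp_all add: imag_unit_uminus)
  then show ?thesis
    unfolding spectrum_base_def by blast
qed

lemma spectrum_base_unique:
  assumes "circ K = spherical_spectrum T" "\<And>z. z \<in> K \<Longrightarrow> cnj z \<in> K"
  shows "K = spectrum_base T"
proof -
  have *: "Complex \<alpha> \<beta> \<in> L" if L: "\<And>z. z \<in> L \<Longrightarrow> cnj z \<in> L"
    and q: "of_real \<alpha> + \<iota> * of_real \<beta> \<in> circ L" and i: "\<iota> \<in> imag_units" for L \<alpha> \<beta> \<iota>
  proof -
    from q obtain \<alpha>' \<beta>' \<iota>' where "of_real \<alpha> + \<iota> * of_real \<beta> = of_real \<alpha>' + \<iota>' * of_real \<beta>'"
      "Complex \<alpha>' \<beta>' \<in> L" "\<iota>' \<in> imag_units"
      by (auto simp: circ_def)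
    with slice_form_eqD [OF this(1) i this(3)] L [of "Complex \<alpha>' \<beta>'"] show ?thesis
      by (auto simp: complex_cnj)
  qed
  have "K1 \<subseteq> K2" if "circ K1 = circ K2" "\<And>z. z \<in> K2 \<Longrightarrow> cnj z \<in> K2" for K1 K2
  proof
    fix z assume "z \<in> K1"
    moreover obtain \<iota> where i: "\<iota> \<in> imag_units"
      using imag_units_nonempty by blast
    ultimately have "of_real (Re z) + \<iota> * of_real (Im z) \<in> circ K1"
      unfolding circ_def by (metis (mono_tags, lifting) complex_surj mem_Collect_eq)
    with *[OF that(2) _ i, of "Re z" "Im z"] that(1) show "z \<in> K2"
      by auto
  qed
  from this [of K "spectrum_base T"] this [of "spectrum_base T" K] assms show ?thesis
    by (auto simp: circ_spectrum_base intro: cnj_spectrum_base)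
qed

text \<open>The quaternions are a quaternionic Hilbert space over themselves.\<close>

instance quat :: complete_space
proof
  fix X :: "nat \<Rightarrow> quat" assume X: "Cauchy X"
  have bl: "bounded_linear qRe" "bounded_linear qI" "bounded_linear qJ" "bounded_linear qK"
    by (intro bounded_linear_intro [where K = 1];
        simp add: norm_quat_def; intro real_le_rsqrt; simp)+
  let ?L = "\<lambda>h. lim (\<lambda>n. h (X n)) :: real"
  have lim: "(\<lambda>n. h (X n)) \<longlonglongrightarrow> ?L h" if "bounded_linear h" for h
    using bounded_linear.Cauchy [OF that X] by (simp add: Cauchy_convergent_iff convergent_LIMSEQ_iff)
  have "(\<lambda>n. norm (X n - Quat (?L qRe) (?L qI) (?L qJ) (?L qK))) \<longlonglongrightarrow>
      sqrt (0\<^sup>2 + 0\<^sup>2 + 0\<^sup>2 + 0\<^sup>2)"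
    unfolding norm_quat_def minus_quat.sel quat.sel
    by (intro tendsto_intros) (use lim bl in \<open>auto simp: LIM_zero\<close>)
  then have "X \<longlonglongrightarrow> Quat (?L qRe) (?L qI) (?L qJ) (?L qK)"
    by (simp add: LIM_zero_iff tendsto_norm_zero_iff)
  then show "convergent X"
    by (rule convergentI)
qed

instantiation quat :: quat_hilbert
begin

definition qscale_quat_def: "qscale (p::quat) q = p * q"

definition qinner_quat_def: "qinner p q = qcnj p * q"

instance
proof
  fix p q r s :: quat and a :: real
  show "qscale (p + q) r = qscale p r + qscale q r" "qscale p (q + r) = qscale p q + qscale p r"
    "qscale p (q * r) = qscale (qscale p q) r" "qscale p (of_real a) = a *\<^sub>R p"
    "qinner p (q + r) = qinner p q + qinner p r" "qinner p (qscale q r) = qinner p q * r"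
    by (simp_all add: qscale_quat_def qinner_quat_def quat_eq_iff algebra_simps)
  show "qinner p q = qcnj (qinner q p)" "0 \<le> qRe (qinner p p)" "inner p q = qRe (qinner p q)"
    by (simp_all add: qinner_quat_def inner_quat_def quat_eq_iff)
  show "p = 0" if "qinner p p = 0"
  proof -
    from that have "norm (qcnj p) * norm p = 0"
      by (simp only: qinner_quat_def norm_mult [symmetric] norm_zero)
    moreover have "norm (qcnj p) = norm p"
      by (simp add: norm_quat_def)
    ultimately show ?thesis
      by simp
  qed
  show "\<exists>u::quat. u \<noteq> 0"
    by (rule exI [of _ 1]) simp
qed

end


section \<open>Slice functions\<close>

text \<open>
  A function with domain \<open>\<Omega>\<close> is represented by its representative in \<open>extensional \<Omega>\<close>.
  A stem function \<open>F\<^sub>1 + iF\<^sub>2\<close> is given by the pair of its components.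
\<close>

definition stem_function :: "complex set \<Rightarrow> quat set \<Rightarrow> (complex \<Rightarrow> quat) \<Rightarrow> (complex \<Rightarrow> quat) \<Rightarrow> bool" where
  "stem_function K V F1 F2 \<longleftrightarrow>
     continuous_on K F1 \<and> continuous_on K F2 \<and> F1 \<in> K \<rightarrow> V \<and> F2 \<in> K \<rightarrow> V \<and>
     (\<forall>z\<in>K. F1 (cnj z) = F1 z \<and> F2 (cnj z) = - F2 z)"

definition slice_induced :: "complex set \<Rightarrow> (complex \<Rightarrow> quat) \<Rightarrow> (complex \<Rightarrow> quat) \<Rightarrow> quat \<Rightarrow> quat" where
  "slice_induced K F1 F2 =
     (\<lambda>q\<in>circ K. THE w. \<forall>\<alpha> \<beta> \<iota>. \<iota> \<in> imag_units \<and> Complex \<alpha> \<beta> \<in> K \<and> q = of_real \<alpha> + \<iota> * of_real \<beta> \<longrightarrow>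
        w = F1 (Complex \<alpha> \<beta>) + \<iota> * F2 (Complex \<alpha> \<beta>))"

definition slice_functions :: "complex set \<Rightarrow> quat set \<Rightarrow> (quat \<Rightarrow> quat) set" where
  "slice_functions K V = {slice_induced K F1 F2 | F1 F2. stem_function K V F1 F2}"

definition slice_mult :: "complex set \<Rightarrow> (quat \<Rightarrow> quat) \<Rightarrow> (quat \<Rightarrow> quat) \<Rightarrow> quat \<Rightarrow> quat" where
  "slice_mult K f g = (THE h. \<exists>F1 F2 G1 G2.
     stem_function K UNIV F1 F2 \<and> f = slice_induced K F1 F2 \<and>
     stem_function K UNIV G1 G2 \<and> g = slice_induced K G1 G2 \<and>
     h = slice_induced K (\<lambda>z. F1 z * G1 z - F2 z * G2 z) (\<lambda>z. F1 z * G2 z + F2 z * G1 z))"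

definition slice_star :: "complex set \<Rightarrow> (quat \<Rightarrow> quat) \<Rightarrow> quat \<Rightarrow> quat" where
  "slice_star K f = (THE h. \<exists>F1 F2.
     stem_function K UNIV F1 F2 \<and> f = slice_induced K F1 F2 \<and>
     h = slice_induced K (\<lambda>z. qcnj (F1 z)) (\<lambda>z. - qcnj (F2 z)))"

definition sup_norm_on :: "quat set \<Rightarrow> (quat \<Rightarrow> quat) \<Rightarrow> real" where
  "sup_norm_on D f = (SUP q\<in>D. norm (f q))"

lemma slice_induced_eq:
  assumes "stem_function K V F1 F2" "\<iota> \<in> imag_units" "Complex \<alpha> \<beta> \<in> K"
  shows "slice_induced K F1 F2 (of_real \<alpha> + \<iota> * of_real \<beta>) = F1 (Complex \<alpha> \<beta>) + \<iota> * F2 (Complex \<alpha> \<beta>)"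
proof -
  have eq: "F1 (Complex \<alpha> \<beta>) + \<iota> * F2 (Complex \<alpha> \<beta>) = F1 (Complex \<alpha>' \<beta>') + \<iota>' * F2 (Complex \<alpha>' \<beta>')"
    if "\<iota>' \<in> imag_units" "Complex \<alpha>' \<beta>' \<in> K"
      and e: "of_real \<alpha> + \<iota> * of_real \<beta> = of_real \<alpha>' + \<iota>' * of_real \<beta>'" for \<alpha>' \<beta>' \<iota>'
  proof -
    have sym: "F1 (Complex \<alpha> (- \<beta>)) = F1 (Complex \<alpha> \<beta>)" "F2 (Complex \<alpha> (- \<beta>)) = - F2 (Complex \<alpha> \<beta>)"
      using assms(1,3) by (auto simp: stem_function_def complex_cnj dest: bspec [of K _ "Complex \<alpha> \<beta>"])
    have z: "F2 (Complex \<alpha> \<beta>) = 0" if "\<beta> = 0"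
    proof -
      have "F2 (Complex \<alpha> \<beta>) = - F2 (Complex \<alpha> \<beta>)"
        using sym(2) that by simp
      then show ?thesis
        by (simp add: quat_eq_iff)
    qed
    from slice_form_eqD [OF e assms(2) that(1)] show ?thesis
      using sym z by auto
  qed
  have "(THE w. \<forall>\<alpha>' \<beta>' \<iota>'. \<iota>' \<in> imag_units \<and> Complex \<alpha>' \<beta>' \<in> K \<and>
          of_real \<alpha> + \<iota> * of_real \<beta> = of_real \<alpha>' + \<iota>' * of_real \<beta>' \<longrightarrow>
          w = F1 (Complex \<alpha>' \<beta>') + \<iota>' * F2 (Complex \<alpha>' \<beta>')) = F1 (Complex \<alpha> \<beta>) + \<iota> * F2 (Complex \<alpha> \<beta>)"
    using assms(2,3) eq by (intro the_equality) blast+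
  moreover have "of_real \<alpha> + \<iota> * of_real \<beta> \<in> circ K"
    using assms(2,3) by (auto simp: circ_def)
  ultimately show ?thesis
    by (simp add: slice_induced_def)
qed

lemma slice_induced_cong:
  assumes "\<And>z. z \<in> K \<Longrightarrow> F1 z = G1 z" "\<And>z. z \<in> K \<Longrightarrow> F2 z = G2 z"
  shows "slice_induced K F1 F2 = slice_induced K G1 G2"
proof -
  have *: "(\<iota> \<in> imag_units \<and> Complex \<alpha> \<beta> \<in> K \<and> q = of_real \<alpha> + \<iota> * of_real \<beta> \<longrightarrow>
      w = F1 (Complex \<alpha> \<beta>) + \<iota> * F2 (Complex \<alpha> \<beta>)) \<longleftrightarrow>
    (\<iota> \<in> imag_units \<and> Complex \<alpha> \<beta> \<in> K \<and> q = of_real \<alpha> + \<iota> * of_real \<beta> \<longrightarrow>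
      w = G1 (Complex \<alpha> \<beta>) + \<iota> * G2 (Complex \<alpha> \<beta>))" for \<alpha> \<beta> \<iota> q w
    using assms by auto
  show ?thesis
    unfolding slice_induced_def by (simp only: *)
qed

lemma stem_function_unique:
  assumes "stem_function K V F1 F2" "stem_function K W G1 G2"
    and "slice_induced K F1 F2 = slice_induced K G1 G2" "z \<in> K"
  shows "F1 z = G1 z" "F2 z = G2 z"
proof -
  obtain \<iota> where i: "\<iota> \<in> imag_units"
    using imag_units_nonempty by blast
  have zK: "Complex (Re z) (Im z) \<in> K"
    using assms(4) by simp
  have "F1 z + \<kappa> * F2 z = G1 z + \<kappa> * G2 z" if "\<kappa> \<in> imag_units" for \<kappa>
    using slice_induced_eq [OF assms(1) that zK] slice_induced_eq [OF assms(2) that zK] assms(3)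
    by simp
  from this [OF i] this [OF imag_unit_uminus [OF i]]
  have e: "F1 z + \<iota> * F2 z = G1 z + \<iota> * G2 z" "F1 z - \<iota> * F2 z = G1 z - \<iota> * G2 z"
    by simp_all
  then have "(F1 z + \<iota> * F2 z) + (F1 z - \<iota> * F2 z) = (G1 z + \<iota> * G2 z) + (G1 z - \<iota> * G2 z)"
    by simp
  then show 1: "F1 z = G1 z"
    by (simp add: quat_eq_iff)
  have "\<iota> \<noteq> 0"
    using i by (auto simp: imag_units_iff)
  with e(1) 1 show "F2 z = G2 z"
    by simp
qed

lemma slice_mult_induced:
  assumes "stem_function K UNIV F1 F2" "stem_function K UNIV G1 G2"
  shows "slice_mult K (slice_induced K F1 F2) (slice_induced K G1 G2) =
    slice_induced K (\<lambda>z. F1 z * G1 z - F2 z * G2 z) (\<lambda>z. F1 z * G2 z + F2 z * G1 z)"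
  unfolding slice_mult_def
proof (rule the_equality)
  fix h assume "\<exists>F1' F2' G1' G2'.
     stem_function K UNIV F1' F2' \<and> slice_induced K F1 F2 = slice_induced K F1' F2' \<and>
     stem_function K UNIV G1' G2' \<and> slice_induced K G1 G2 = slice_induced K G1' G2' \<and>
     h = slice_induced K (\<lambda>z. F1' z * G1' z - F2' z * G2' z) (\<lambda>z. F1' z * G2' z + F2' z * G1' z)"
  then obtain F1' F2' G1' G2' where
    h: "stem_function K UNIV F1' F2'" "slice_induced K F1 F2 = slice_induced K F1' F2'"
     "stem_function K UNIV G1' G2'" "slice_induced K G1 G2 = slice_induced K G1' G2'"
     "h = slice_induced K (\<lambda>z. F1' z * G1' z - F2' z * G2' z) (\<lambda>z. F1' z * G2' z + F2' z * G1' z)"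
    by blast
  show "h = slice_induced K (\<lambda>z. F1 z * G1 z - F2 z * G2 z) (\<lambda>z. F1 z * G2 z + F2 z * G1 z)"
    unfolding h(5)
    using stem_function_unique [OF assms(1) h(1,2)] stem_function_unique [OF assms(2) h(3,4)]
    by (intro slice_induced_cong) simp_all
qed (use assms in blast)

lemma slice_star_induced:
  assumes "stem_function K UNIV F1 F2"
  shows "slice_star K (slice_induced K F1 F2) = slice_induced K (\<lambda>z. qcnj (F1 z)) (\<lambda>z. - qcnj (F2 z))"
  unfolding slice_star_def
proof (rule the_equality)
  fix h assume "\<exists>F1' F2'. stem_function K UNIV F1' F2' \<and>
     slice_induced K F1 F2 = slice_induced K F1' F2' \<and>
     h = slice_induced K (\<lambda>z. qcnj (F1' z)) (\<lambda>z. - qcnj (F2' z))"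
  then obtain F1' F2' where
    h: "stem_function K UNIV F1' F2'" "slice_induced K F1 F2 = slice_induced K F1' F2'"
     "h = slice_induced K (\<lambda>z. qcnj (F1' z)) (\<lambda>z. - qcnj (F2' z))"
    by blast
  show "h = slice_induced K (\<lambda>z. qcnj (F1 z)) (\<lambda>z. - qcnj (F2 z))"
    unfolding h(3) using stem_function_unique [OF assms h(1,2)]
    by (intro slice_induced_cong) simp_all
qed (use assms in blast)


section \<open>Continuous star-homomorphisms\<close>

text \<open>
  \<open>V\<close> is both the set of values of the stem functions and the set of scalars
  (\<open>\<real>\<close> or \<open>\<complex>\<^sub>j\<close>), and \<open>act S q\<close> is the scalar multiplication on operators.
  Asking \<open>\<Psi>\<close> to be extensional makes it a function with domain exactly
  \<^term>\<open>slice_functions K V\<close>, so that uniqueness can be stated as equality.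
\<close>

definition slice_star_hom :: "complex set \<Rightarrow> quat set \<Rightarrow>
    (('a::quat_hilbert \<Rightarrow>\<^sub>L 'a) \<Rightarrow> quat \<Rightarrow> ('a \<Rightarrow>\<^sub>L 'a)) \<Rightarrow> ((quat \<Rightarrow> quat) \<Rightarrow> ('a \<Rightarrow>\<^sub>L 'a)) \<Rightarrow> bool" where
  "slice_star_hom K V act \<Psi> \<longleftrightarrow>
     \<Psi> \<in> slice_functions K V \<rightarrow>\<^sub>E bounded_ops \<and>
     (\<forall>f\<in>slice_functions K V. \<forall>g\<in>slice_functions K V.
        \<Psi> (\<lambda>q\<in>circ K. f q + g q) = \<Psi> f + \<Psi> g) \<and>
     (\<forall>f\<in>slice_functions K V. \<forall>g\<in>slice_functions K V.
        \<Psi> (slice_mult K f g) = \<Psi> f o\<^sub>L \<Psi> g) \<and>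
     (\<forall>f\<in>slice_functions K V. \<forall>p\<in>V. \<Psi> (\<lambda>q\<in>circ K. f q * p) = act (\<Psi> f) p) \<and>
     (\<forall>f\<in>slice_functions K V. \<Psi> (slice_star K f) = adj (\<Psi> f)) \<and>
     \<Psi> (\<lambda>q\<in>circ K. 1) = id_blinfun"

definition sup_norm_continuous :: "complex set \<Rightarrow> quat set \<Rightarrow>
    ((quat \<Rightarrow> quat) \<Rightarrow> ('a::quat_hilbert \<Rightarrow>\<^sub>L 'a)) \<Rightarrow> bool" where
  "sup_norm_continuous K V \<Psi> \<longleftrightarrow>
     (\<forall>f\<in>slice_functions K V. \<forall>\<epsilon>>0. \<exists>\<delta>>0. \<forall>g\<in>slice_functions K V.
        sup_norm_on (circ K) (\<lambda>q. g q - f q) < \<delta> \<longrightarrow> norm (\<Psi> g - \<Psi> f) < \<epsilon>)"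

definition real_act :: "('a::quat_hilbert \<Rightarrow>\<^sub>L 'a) \<Rightarrow> quat \<Rightarrow> ('a \<Rightarrow>\<^sub>L 'a)" where
  "real_act S q = (THE R. \<exists>\<alpha>. q = of_real \<alpha> \<and> R = \<alpha> *\<^sub>R S)"

definition slice_act :: "quat \<Rightarrow> ('a::quat_hilbert \<Rightarrow>\<^sub>L 'a) \<Rightarrow> ('a \<Rightarrow>\<^sub>L 'a) \<Rightarrow> quat \<Rightarrow> ('a \<Rightarrow>\<^sub>L 'a)" where
  "slice_act j J S q =
     (THE R. \<exists>\<alpha> \<beta>. q = of_real \<alpha> + j * of_real \<beta> \<and> R = \<alpha> *\<^sub>R S + ((\<beta> *\<^sub>R S) o\<^sub>L J))"

lemma real_act_of_real: "real_act S (of_real \<alpha>) = \<alpha> *\<^sub>R S"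
proof -
  have "\<alpha>' = \<alpha>" if "(of_real \<alpha> :: quat) = of_real \<alpha>'" for \<alpha>'
    using that by (metis of_real_eq_iff)
  then show ?thesis
    unfolding real_act_def by (intro the_equality) auto
qed

lemma slice_act_eq:
  assumes "j \<in> imag_units"
  shows "slice_act j J S (of_real \<alpha> + j * of_real \<beta>) = \<alpha> *\<^sub>R S + ((\<beta> *\<^sub>R S) o\<^sub>L J)"
proof -
  have "\<alpha>' = \<alpha> \<and> \<beta>' = \<beta>" if "of_real \<alpha> + j * of_real \<beta> = of_real \<alpha>' + j * of_real \<beta>'" for \<alpha>' \<beta>'
  proof -
    have "j \<noteq> 0"
      using assms by (auto simp: imag_units_iff)
    with slice_form_eqD(1,2) [OF that assms assms] show ?thesis
      by simp
  qed
  then show ?thesis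
    unfolding slice_act_def by (intro the_equality) auto
qed

definition Psi_R :: "('a::quat_hilbert \<Rightarrow>\<^sub>L 'a) \<Rightarrow> (quat \<Rightarrow> quat) \<Rightarrow> ('a \<Rightarrow>\<^sub>L 'a)" where
  "Psi_R T = (THE \<Psi>.
     slice_star_hom (spectrum_base T) \<real> real_act \<Psi> \<and>
     sup_norm_continuous (spectrum_base T) \<real> \<Psi> \<and>
     \<Psi> (\<lambda>q\<in>spherical_spectrum T. 1) = id_blinfun \<and>
     \<Psi> (\<lambda>q\<in>spherical_spectrum T. q) = T)"

end

(*
  The operator J turns H, viewed as a real Hilbert space, into a complex Hilbert space on which
  T = A + J B is a complex linear normal operator with commuting self-adjoint A and B >= 0. Hence
  the complex spectrum of T lies in the closed upper half plane, and the factorisation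
  Delta_q(T) = (T - w) (T - conj w), q = a + i b, w = a + J b, shows that the spherical spectrum is
  its circularization. A slice function f with values of its stem in C_j corresponds to the
  function f(a + j b) on this complex spectrum, so the slice calculus is the complex continuous
  functional calculus of T. An operator commuting with T, T* and J is phi(T) iff every approximate
  eigenvector of T at z is one of the operator at phi(z) (and of its adjoint at the conjugate).
  Such a phi(T) has norm max |phi|, because approximate null vectors of an operator commuting with
  A and B can be refined to joint approximate eigenvectors of A and B; existence then follows from
  the Stone-Weierstrass theorem. Uniqueness reduces to real slice functions through f = f0 + f1 j,
  where polynomials with real coefficients in z and conj z are dense.
*)
theory Submission
  imports Defs
begin

section \<open>Real Hilbert spaces\<close>

text \<open>Two facts carry the spectral side. A normal operator that is bounded below is onto, so
  approximate null vectors alone decide invertibility. And \<open>(norm P)^2\<close> is an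
  approximate eigenvalue of \<open>adj P o\<^sub>L P\<close> for every \<open>P\<close> in
  \<open>bounded_ops\<close>, so spectral mapping already yields the norm. Describing \<phi>(T) by
  approximate eigenvectors also replaces a construction by a relation,
  \<open>calculus \<phi> P\<close>, that is stable under sums, products, adjoints and uniform
  limits. The obstacle is that the spectrum of \<open>T\<close> over \<open>J\<close> is only half
  of the domain of a stem function. In the symbol \<open>F1 + i F2\<close> the unit of the stem and
  \<open>j\<close> are identified; this respects products and stars, but one half plane does not
  determine both components when they take values in the plane of \<open>j\<close>. This is why the
  norm and the kernel refer to one half plane. Real stem components are determined by their symbol
  there, so \<open>Psi\<close> is injective on real slice functions.\<close>

instance quat_hilbert \<subseteq> banach
  by standard

text \<open>Projection theorem: a sequence in \<open>M\<close> that minimises the distance to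
  \<open>x\<close> is Cauchy by the parallelogram law, and \<open>x\<close> minus its limit is the
  required vector.\<close>

lemma exists_orthogonal_to_closed_subspace:
  fixes M :: "'a::{real_inner, complete_space} set"
  assumes "subspace M" "closed M" "x \<notin> M"
  shows "\<exists>v. v \<noteq> 0 \<and> (\<forall>m\<in>M. inner m v = 0)"
proof -
  have "0 \<in> M"
    using assms(1) by (simp add: subspace_def)
  then have ne: "M \<noteq> {}"
    by blast
  define d where "d = infdist x M"
  have d0: "0 \<le> d"
    by (simp add: d_def infdist_nonneg)
  have le: "d \<le> norm (x - m)" if "m \<in> M" for m
    using infdist_le [OF that, of x] by (simp add: d_def dist_norm)
  have "\<exists>m\<in>M. norm (x - m) < d + inverse (real (Suc n))" for n
    using cInf_lessD [of "(\<lambda>m. norm (x - m)) ` M" "d + inverse (real (Suc n))"] ne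
    by (auto simp: d_def infdist_def dist_norm)
  then obtain m where mM: "\<And>n. m n \<in> M" and m: "\<And>n. norm (x - m n) < d + inverse (real (Suc n))"
    by metis
  \<comment> \<open>Parallelogram law for \<open>x - m k\<close> and \<open>x - m l\<close>: the
    midpoint of \<open>m k\<close> and \<open>m l\<close> is again in \<open>M\<close>, hence at
    distance at least \<open>d\<close> from \<open>x\<close>.\<close>
  have par: "(norm (m k - m l))\<^sup>2 \<le> 2 * (norm (x - m k))\<^sup>2 + 2 * (norm (x - m l))\<^sup>2 - 4 * d\<^sup>2" for k l
  proof -
    have "(1/2) *\<^sub>R (m k + m l) \<in> M"
      using assms(1) mM by (simp add: subspace_def)
    from le [OF this] have "d\<^sup>2 \<le> (norm (x - (1/2) *\<^sub>R (m k + m l)))\<^sup>2"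
      using d0 by (intro power_mono)
    moreover have "(norm (m k - m l))\<^sup>2 + 4 * (norm (x - (1/2) *\<^sub>R (m k + m l)))\<^sup>2
        = 2 * (norm (x - m k))\<^sup>2 + 2 * (norm (x - m l))\<^sup>2"
      unfolding power2_norm_eq_inner by (simp add: algebra_simps inner_commute)
    ultimately show ?thesis
      by linarith
  qed
  have lim: "(\<lambda>n. norm (x - m n)) \<longlonglongrightarrow> d"
  proof (rule tendsto_sandwich [OF _ _ tendsto_const])
    show "(\<lambda>n. d + inverse (real (Suc n))) \<longlonglongrightarrow> d"
      using tendsto_add [OF tendsto_const LIMSEQ_inverse_real_of_nat, of d] by simp
    show "\<forall>\<^sub>F n in sequentially. d \<le> norm (x - m n)"
      using le mM by simp
    show "\<forall>\<^sub>F n in sequentially. norm (x - m n) \<le> d + inverse (real (Suc n))"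
      using m by (intro always_eventually allI less_imp_le)
  qed
  have "Cauchy m"
  proof (rule metric_CauchyI)
    fix e :: real assume e: "0 < e"
    have "(\<lambda>n. (norm (x - m n))\<^sup>2) \<longlonglongrightarrow> d\<^sup>2"
      by (intro tendsto_intros lim)
    from order_tendstoD(2) [OF this, of "d\<^sup>2 + e\<^sup>2 / 4"] e
    obtain N where N: "\<And>n. n \<ge> N \<Longrightarrow> (norm (x - m n))\<^sup>2 < d\<^sup>2 + e\<^sup>2 / 4"
      by (auto simp: eventually_sequentially)
    have "dist (m k) (m l) < e" if "k \<ge> N" "l \<ge> N" for k l
    proof -
      have "(norm (m k - m l))\<^sup>2 < e\<^sup>2"
        using par [of k l] N [OF that(1)] N [OF that(2)] by (simp add: field_simps)
      then show ?thesis
        using e by (simp add: dist_norm power_less_imp_less_base)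
    qed
    then show "\<exists>N. \<forall>k\<ge>N. \<forall>l\<ge>N. dist (m k) (m l) < e"
      by blast
  qed
  then obtain y where y: "m \<longlonglongrightarrow> y"
    using Cauchy_convergent convergent_def by blast
  have yM: "y \<in> M"
    using closed_sequentially [OF assms(2)] mM y by blast
  have nd: "norm (x - y) = d"
    using LIMSEQ_unique [OF tendsto_norm [OF tendsto_diff [OF tendsto_const y]] lim] .
  have "inner k (x - y) = 0" if k: "k \<in> M" for k
  proof (cases "k = 0")
    case False
    \<comment> \<open>Coefficient of the projection of \<open>x - y\<close> onto \<open>k\<close>:
      moving \<open>y\<close> by this multiple of \<open>k\<close> would decrease the distance the
      most.\<close>
    define t where "t = inner k (x - y) / inner k k"
    have "y + t *\<^sub>R k \<in> M"
      using assms(1) yM k by (simp add: subspace_def)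
    from le [OF this] have "(norm (x - y))\<^sup>2 \<le> (norm (x - y - t *\<^sub>R k))\<^sup>2"
      unfolding nd using d0 by (intro power_mono) (simp_all add: algebra_simps)
    also have "\<dots> = (norm (x - y))\<^sup>2 - 2 * t * inner k (x - y) + t * t * inner k k"
      unfolding power2_norm_eq_inner by (simp add: algebra_simps inner_commute)
    also have "t * t * inner k k = t * inner k (x - y)"
      using False by (simp add: t_def)
    finally have "t * inner k (x - y) \<le> 0"
      by simp
    then have "(inner k (x - y))\<^sup>2 / inner k k \<le> 0"
      by (simp add: t_def power2_eq_square)
    moreover have "0 < inner k k"
      using False by simp
    ultimately have "(inner k (x - y))\<^sup>2 \<le> 0"
      by (simp only: divide_le_0_iff) auto
    then show ?thesis
      by simp
  qed simp
  moreover have "x - y \<noteq> 0"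
    using yM assms(3) by auto
  ultimately show ?thesis
    by blast
qed

text \<open>The kernel of a nonzero functional has a nonzero normal vector \<open>v\<close>, and
  \<open>u\<close> minus \<open>f u / f v\<close> times \<open>v\<close> lies in the kernel; its
  orthogonality to \<open>v\<close> is the formula.\<close>

lemma riesz_representation:
  fixes f :: "'a::{real_inner, complete_space} \<Rightarrow> real"
  assumes "bounded_linear f"
  shows "\<exists>w. \<forall>v. f v = inner w v"
proof (cases "\<forall>v. f v = 0")
  case True
  then show ?thesis
    by (intro exI [of _ 0]) simp
next
  case False
  interpret f: bounded_linear f by fact
  from False obtain x where "f x \<noteq> 0"
    by blast
  moreover have "subspace {v. f v = 0}"
    by (auto simp: subspace_def f.add f.scaleR f.zero)
  moreover have "closed {v. f v = 0}"
    by (intro closed_Collect_eq continuous_on_const f.continuous_on continuous_on_id)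
  ultimately obtain v where v: "v \<noteq> 0" "\<And>m. f m = 0 \<Longrightarrow> inner m v = 0"
    using exists_orthogonal_to_closed_subspace [of "{v. f v = 0}" x] by auto
  have fv: "f v \<noteq> 0"
    using v(2) [of v] v(1) by auto
  have "f u = inner ((f v / inner v v) *\<^sub>R v) u" for u
  proof -
    have "f (u - (f u / f v) *\<^sub>R v) = 0"
      using fv by (simp add: f.diff f.scaleR)
    from v(2) [OF this] have "inner u v = f u / f v * inner v v"
      by (simp add: inner_diff_left)
    then show ?thesis
      using fv v(1) by (simp add: inner_commute)
  qed
  then show ?thesis
    by blast
qed

text \<open>Riesz representation of the functional \<open>inner u (T v)\<close> in \<open>v\<close>
  for each \<open>u\<close>; testing it at \<open>s u\<close> itself bounds
  \<open>s\<close>.\<close>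

lemma real_adjoint_exists:
  fixes T :: "'a::{real_inner, complete_space} \<Rightarrow>\<^sub>L 'a"
  shows "\<exists>S :: 'a \<Rightarrow>\<^sub>L 'a. \<forall>u v. inner (S u) v = inner u (T v)"
proof -
  have "\<exists>w. \<forall>v. inner u (T v) = inner w v" for u
    by (rule riesz_representation) (intro bounded_linear_inner_right_comp blinfun.bounded_linear_right)
  then obtain s where s: "\<And>u v. inner u (T v) = inner (s u) v"
    by metis
  have "bounded_linear s"
  proof (rule bounded_linear_intro)
    show "s (u + v) = s u + s v" for u v
      by (rule vector_eq_rdot [THEN iffD1]) (simp add: inner_add_left flip: s)
    show "s (r *\<^sub>R u) = r *\<^sub>R s u" for r u
      by (rule vector_eq_rdot [THEN iffD1]) (simp flip: s)
    show "norm (s u) \<le> norm u * norm T" for u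
    proof (cases "s u = 0")
      case False
      have "(norm (s u))\<^sup>2 = inner u (T (s u))"
        by (simp add: power2_norm_eq_inner s)
      also have "\<dots> \<le> norm u * norm (T (s u))"
        by (rule norm_cauchy_schwarz)
      also have "\<dots> \<le> norm u * (norm T * norm (s u))"
        by (intro mult_left_mono norm_blinfun norm_ge_zero)
      finally have "norm (s u) * norm (s u) \<le> norm u * norm T * norm (s u)"
        by (simp add: power2_eq_square mult_ac)
      then show ?thesis
        using False by simp
    qed simp
  qed
  then have "blinfun_apply (Blinfun s) = s"
    by (rule bounded_linear_Blinfun_apply)
  with s show ?thesis
    by metis
qed

section \<open>Approximate eigenvalues of a symmetric operator under a seminorm constraint\<close>

text \<open>
  The supremum of the Rayleigh quotient of \<open>A\<close> over vectors with small \<open>p\<close> is an approximate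
  eigenvalue: otherwise moving from \<open>u\<close> in the direction \<open>A u\<close>, which keeps \<open>p\<close> small,
  would increase the quotient.
\<close>

lemma joint_approximate_eigenvalue:
  fixes A :: "'a::real_inner \<Rightarrow>\<^sub>L 'a" and p :: "'a \<Rightarrow> real"
  assumes sym: "\<And>u v. inner (A u) v = inner u (A v)"
    and p_nonneg: "\<And>u. 0 \<le> p u"
    and p_add: "\<And>u v. p (u + v) \<le> p u + p v"
    and p_scale: "\<And>c u. p (c *\<^sub>R u) = \<bar>c\<bar> * p u"
    and p_A: "\<And>u. p (A u) \<le> C * p u"
    and C: "0 \<le> C"
    and app: "\<And>e. 0 < e \<Longrightarrow> \<exists>u. norm u = 1 \<and> p u < e"
  shows "\<exists>\<alpha>. \<forall>e>0. \<exists>u. norm u = 1 \<and> p u < e \<and> norm (A u - \<alpha> *\<^sub>R u) < e"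
proof -
  define V where "V = (\<lambda>e. {inner (A u) u | u. norm u = 1 \<and> p u < e})"
  define m where "m e = Sup (V e)" for e
  have AL: "\<bar>inner (A u) u\<bar> \<le> norm A * (norm u)\<^sup>2" for u
  proof -
    have "\<bar>inner (A u) u\<bar> \<le> norm (A u) * norm u"
      by (rule Cauchy_Schwarz_ineq2)
    also have "\<dots> \<le> (norm A * norm u) * norm u"
      by (intro mult_right_mono norm_blinfun norm_ge_zero)
    finally show ?thesis
      by (simp add: power2_eq_square mult_ac)
  qed
  have bdd: "bdd_above (V e)" for e
  proof (rule bdd_aboveI)
    fix x assume "x \<in> V e"
    then obtain u where "x = inner (A u) u" "norm u = 1"
      by (auto simp: V_def)
    then show "x \<le> norm A"
      using AL [of u] by simp
  qed
  have ne: "V e \<noteq> {}" if "0 < e" for e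
    using app [OF that] by (auto simp: V_def)
  have up: "inner (A u) u \<le> m e" if "norm u = 1" "p u < e" for u e
    unfolding m_def using that by (intro cSup_upper bdd) (auto simp: V_def)
  have mL: "\<bar>m e\<bar> \<le> norm A" if e: "0 < e" for e
  proof -
    obtain u where u: "norm u = 1" "p u < e"
      using app [OF e] by blast
    have "- norm A \<le> m e"
      using up [OF u] AL [of u] u(1) by auto
    moreover have "m e \<le> norm A"
      unfolding m_def
    proof (rule cSup_least [OF ne [OF e]])
      fix x assume "x \<in> V e"
      then obtain u where "x = inner (A u) u" "norm u = 1"
        by (auto simp: V_def)
      then show "x \<le> norm A"
        using AL [of u] by simp
    qed
    ultimately show ?thesis
      by simp
  qed
  have bb: "bdd_below (m ` {0<..})"
  proof (rule bdd_belowI)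
    fix x assume "x \<in> m ` {0<..}"
    then show "- norm A \<le> x"
      using mL by (auto simp: abs_le_iff minus_le_iff)
  qed
  \<comment> \<open>\<open>m\<close> is monotone on positive arguments, so this infimum is the limit
    of \<open>m e\<close> as \<open>e\<close> tends to 0: the best quotient that survives an
    arbitrarily strict constraint on \<open>p\<close>.\<close>
  define \<mu> where "\<mu> = Inf (m ` {0<..})"
  have mu_le: "\<mu> \<le> m e" if "0 < e" for e
    unfolding \<mu>_def using that bb by (intro cInf_lower) auto
  have mu_L: "\<bar>\<mu>\<bar> \<le> norm A"
  proof -
    have "- norm A \<le> \<mu>"
      unfolding \<mu>_def using mL by (intro cInf_greatest) (auto simp: abs_le_iff minus_le_iff)
    then show ?thesis
      using mu_le [of 1] mL [of 1] by simp
  qed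
  \<comment> \<open>With \<bar>M\<bar> at most \<open>norm A + 1\<close> for the \<open>M\<close>
    below, \<open>D\<close> dominates both \<open>\<bar>M\<bar> + norm A\<close> and
    \<open>\<bar>M\<bar> + C\<close>.\<close>
  define D where "D = 2 * norm A + C + 2"
  have D: "2 \<le> D"
    using C by (simp add: D_def)
  have "\<exists>u. norm u = 1 \<and> p u < \<eta> \<and> norm (A u - \<mu> *\<^sub>R u) < \<eta>" if eta: "0 < \<eta>" for \<eta>
  proof -
    \<comment> \<open>Step length. The first bound keeps \<open>norm v\<close> at least 1/2 and
      \<open>p v\<close> at most \<open>2 * p u\<close>; the second makes the term quadratic in
      \<open>s\<close> at most \<open>s * \<eta>^2 / 4\<close>.\<close>
    define s where "s = min (1 / (2 * D)) (\<eta>\<^sup>2 / (4 * D ^ 3))"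
    have s: "0 < s" "s * D \<le> 1/2" "s * D ^ 3 \<le> \<eta>\<^sup>2 / 4"
    proof -
      show "0 < s"
        using D eta by (simp add: s_def)
      have "s * D \<le> 1 / (2 * D) * D"
        using D by (intro mult_right_mono) (auto simp: s_def)
      then show "s * D \<le> 1/2"
        using D by simp
      have "s * D ^ 3 \<le> \<eta>\<^sup>2 / (4 * D ^ 3) * D ^ 3"
        using D by (intro mult_right_mono) (auto simp: s_def)
      then show "s * D ^ 3 \<le> \<eta>\<^sup>2 / 4"
        using D by simp
    qed
    \<comment> \<open>\<mu> is bracketed by \<open>M\<close> and the quotient of \<open>u\<close> up
      to \<delta>. The three bounds give \<bar>M\<bar> \<le> \<open>norm A + 1\<close>, leave room
      for \<delta> in the final estimate, and make \<open>2 * \<delta>\<close> at most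
      \<open>s * \<eta>^2 / 8\<close>.\<close>
    define \<delta> where "\<delta> = min (min 1 (\<eta> / 4)) (s * \<eta>\<^sup>2 / 16)"
    have \<delta>: "0 < \<delta>" "\<delta> \<le> 1" "\<delta> \<le> \<eta> / 4" "\<delta> \<le> s * \<eta>\<^sup>2 / 16"
      using s eta by (auto simp: \<delta>_def)
    define M where "M = \<mu> + \<delta>"
    have "\<exists>x\<in>m ` {0<..}. x < M"
      using \<delta>(1) cInf_lessD [of "m ` {0<..}" M] by (auto simp: M_def \<mu>_def)
    then obtain \<epsilon>0 where e0: "0 < \<epsilon>0" "m \<epsilon>0 < M"
      by auto
    \<comment> \<open>The factor 4: \<open>p\<close> may double from \<open>u\<close> to
      \<open>v\<close>, and normalising \<open>v\<close> may double it again.\<close>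
    define \<epsilon> where "\<epsilon> = min \<eta> (\<epsilon>0 / 4)"
    have e: "0 < \<epsilon>" "\<epsilon> \<le> \<eta>" "4 * \<epsilon> \<le> \<epsilon>0"
      using e0 eta by (auto simp: \<epsilon>_def)
    have "\<mu> - \<delta> < Sup (V \<epsilon>)"
      using mu_le [OF e(1)] \<delta>(1) by (simp add: m_def)
    then obtain u where u: "norm u = 1" "p u < \<epsilon>" "\<mu> - \<delta> < inner (A u) u"
      using less_cSupE [OF _ ne [OF e(1)]] by (auto simp: V_def)
    define w where "w = M *\<^sub>R u - A u"
    have M: "\<bar>M\<bar> \<le> norm A + 1"
      using mu_L \<delta> by (simp add: M_def)
    have Qn: "norm (M *\<^sub>R x - A x) \<le> D * norm x" for x
    proof -
      have "norm (M *\<^sub>R x - A x) \<le> \<bar>M\<bar> * norm x + norm A * norm x"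
        using norm_triangle_ineq4 [of "M *\<^sub>R x" "A x"] norm_blinfun [of A x] by simp
      also have "\<dots> \<le> D * norm x"
        unfolding distrib_right [symmetric] using M C by (intro mult_right_mono) (auto simp: D_def)
      finally show ?thesis .
    qed
    have wD: "norm w \<le> D"
      using Qn [of u] u(1) by (simp add: w_def)
    \<comment> \<open>Up to a multiple of \<open>u\<close> this is a step in the direction
      \<open>A u\<close>. The quotient of \<open>v\<close> is still at most \<open>M\<close>, and
      expanding that inequality in \<open>s\<close> bounds the residual \<open>w\<close>.\<close>
    define v where "v = u - s *\<^sub>R w"
    have "norm (s *\<^sub>R w) \<le> 1/2"
      using order_trans [OF mult_left_mono [OF wD less_imp_le [OF s(1)]] s(2)] s(1) by simp
    then have nv: "1/2 \<le> norm v"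
      using norm_triangle_ineq2 [of u "s *\<^sub>R w"] u(1) by (simp add: v_def)
    have "v = (1 - s * M) *\<^sub>R u + s *\<^sub>R A u"
      by (simp add: v_def w_def algebra_simps)
    then have "p v \<le> \<bar>1 - s * M\<bar> * p u + s * p (A u)"
      using p_add [of "(1 - s * M) *\<^sub>R u" "s *\<^sub>R A u"] s(1) by (simp add: p_scale)
    also have "\<dots> \<le> (1 + s * \<bar>M\<bar>) * p u + s * (C * p u)"
    proof (intro add_mono mult_mono mult_left_mono p_A)
      show "\<bar>1 - s * M\<bar> \<le> 1 + s * \<bar>M\<bar>"
        using s(1) by (simp add: abs_mult order_trans [OF abs_triangle_ineq4])
    qed (use s(1) p_nonneg in auto)
    also have "\<dots> = (1 + s * (\<bar>M\<bar> + C)) * p u"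
      by (simp add: algebra_simps)
    also have "\<dots> \<le> 2 * p u"
    proof (intro mult_right_mono p_nonneg)
      have "s * (\<bar>M\<bar> + C) \<le> s * D"
        using M s(1) norm_ge_zero [of A] by (intro mult_left_mono) (simp_all add: D_def)
      then show "1 + s * (\<bar>M\<bar> + C) \<le> 2"
        using s(2) by simp
    qed
    finally have pv: "p v \<le> 2 * p u" .
    define v' where "v' = (1 / norm v) *\<^sub>R v"
    have nz: "norm v > 0"
      using nv by linarith
    have v': "norm v' = 1"
      using nz by (simp add: v'_def)
    have "p v' = p v / norm v"
      using nz by (simp add: v'_def p_scale)
    also have "\<dots> \<le> 2 * p v"
      using nv nz p_nonneg [of v] mult_left_mono [of 1 "2 * norm v" "p v"]
      by (simp add: divide_le_eq mult_ac)
    also have "\<dots> < \<epsilon>0"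
      using pv u(2) e(3) by linarith
    finally have "inner (A v') v' \<le> m \<epsilon>0"
      using up v' by blast
    then have "inner (A v') v' \<le> M"
      using e0 by linarith
    moreover have "inner (A v') v' = inner (A v) v / (norm v)\<^sup>2"
      by (simp add: v'_def blinfun.scaleR_right power2_eq_square)
    ultimately have "inner (A v) v \<le> M * (norm v)\<^sup>2"
      using nz by (simp add: divide_le_eq)
    then have "0 \<le> inner (M *\<^sub>R v - A v) v"
      by (simp add: inner_diff_left power2_norm_eq_inner)
    also have "inner (M *\<^sub>R v - A v) v
        = inner w u - 2 * s * (norm w)\<^sup>2 + s\<^sup>2 * inner (M *\<^sub>R w - A w) w"
    proof -
      have "inner (A w) u = inner w (A u)"
        by (rule sym)
      then have "inner (M *\<^sub>R w - A w) u = inner w w"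
        by (simp add: w_def inner_diff_left inner_diff_right)
      moreover have "inner (M *\<^sub>R v - A v) v = inner (w - s *\<^sub>R (M *\<^sub>R w - A w)) v"
        by (simp add: v_def w_def algebra_simps blinfun.bilinear_simps)
      moreover have "inner (w - s *\<^sub>R q) v
          = inner w u - s * inner w w - s * inner q u + s * s * inner q w" for q
        by (simp add: v_def inner_diff_left inner_diff_right algebra_simps)
      ultimately show ?thesis
        by (simp add: power2_norm_eq_inner power2_eq_square [of s])
    qed
    also have "\<dots> \<le> 2 * \<delta> - 2 * s * (norm w)\<^sup>2 + s\<^sup>2 * D ^ 3"
    proof -
      have "inner w u = M - inner (A u) u"
        using u(1) by (simp add: w_def inner_diff_left flip: power2_norm_eq_inner)
      then have "inner w u \<le> 2 * \<delta>"
        using u(3) by (simp add: M_def)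
      moreover have "inner (M *\<^sub>R w - A w) w \<le> D ^ 3"
      proof -
        have "inner (M *\<^sub>R w - A w) w \<le> norm (M *\<^sub>R w - A w) * norm w"
          by (rule norm_cauchy_schwarz)
        also have "\<dots> \<le> D * norm w * norm w"
          by (intro mult_right_mono Qn norm_ge_zero)
        also have "\<dots> \<le> D * D * D"
          using wD D by (intro mult_mono) auto
        finally show ?thesis
          by (simp add: power3_eq_cube)
      qed
      ultimately show ?thesis
        by (intro add_mono diff_mono mult_left_mono) (use s(1) in auto)
    qed
    finally have "2 * s * (norm w)\<^sup>2 \<le> 2 * \<delta> + s\<^sup>2 * D ^ 3"
      by simp
    also have "\<dots> \<le> s * \<eta>\<^sup>2 / 8 + s * (\<eta>\<^sup>2 / 4)"
    proof (rule add_mono)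
      show "2 * \<delta> \<le> s * \<eta>\<^sup>2 / 8"
        using \<delta>(4) by simp
      show "s\<^sup>2 * D ^ 3 \<le> s * (\<eta>\<^sup>2 / 4)"
        using mult_left_mono [OF s(3) less_imp_le [OF s(1)]]
        unfolding power2_eq_square [of s] mult.assoc .
    qed
    finally have "s * (norm w)\<^sup>2 \<le> s * (3 * \<eta>\<^sup>2 / 16)"
      by simp
    then have "(norm w)\<^sup>2 \<le> 3 * \<eta>\<^sup>2 / 16"
      using s(1) by (simp only: mult_le_cancel_left_pos)
    also have "\<dots> < (\<eta> / 2)\<^sup>2"
      using eta by (simp add: power_divide)
    finally have "norm w < \<eta> / 2"
      by (rule power_less_imp_less_base) (use eta in simp)
    moreover have "A u - \<mu> *\<^sub>R u = \<delta> *\<^sub>R u - w"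
      by (simp add: w_def M_def algebra_simps)
    then have "norm (A u - \<mu> *\<^sub>R u) \<le> \<delta> + norm w"
      using norm_triangle_ineq4 [of "\<delta> *\<^sub>R u" w] u(1) \<delta>(1) by simp
    ultimately show ?thesis
      using u e \<delta>(3) eta by (intro exI [of _ u]) auto
  qed
  then show ?thesis
    by blast
qed

section \<open>Bounded operators on quaternionic Hilbert spaces\<close>

lemma qcnj_simps [simp]: "qcnj (qcnj q) = q" "qcnj (p + q) = qcnj p + qcnj q"
  "qcnj (p - q) = qcnj p - qcnj q" "qcnj (- q) = - qcnj q" "qcnj (p * q) = qcnj q * qcnj p"
  "qcnj (of_real r) = of_real r" "qcnj 0 = 0" "qcnj 1 = 1"
  by (simp_all add: quat_eq_iff algebra_simps)

text \<open>Testing with \<open>qcnj (x - y)\<close> gives the squared norm of the difference. This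
  lifts identities of the real inner product to the quaternionic one.\<close>

lemma quat_eqI_mult:
  assumes "\<And>q. qRe (x * q) = qRe (y * q)"
  shows "x = y"
proof -
  have "qRe ((x - y) * qcnj (x - y)) = 0"
    using assms [of "qcnj (x - y)"] by (simp add: left_diff_distrib)
  then show ?thesis
    unfolding quat_mult_qcnj by (simp del: of_real_power)
qed

lemma quat_of_real_left_commute: "p * (of_real r * q) = of_real r * (p * q)" for p q :: quat
  by (simp add: quat_eq_iff algebra_simps)

lemma qinner_qscale_left: "qinner (qscale u q) v = qcnj q * qinner u v"
  by (metis qinner_commute qinner_qscale_right qcnj_simps(1,5))

lemma bounded_ops_apply: "T \<in> bounded_ops \<Longrightarrow> T (qscale u q) = qscale (T u) q"
  by (simp add: bounded_ops_def)

lemma qscale_scaleR: "qscale (r *\<^sub>R u) q = r *\<^sub>R qscale u q" for u :: "'a::quat_hilbert"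
  by (metis qscale_mult qscale_of_real quat_of_real_commute)

lemma qscale_minus: "qscale (- u) q = - qscale u q" for u :: "'a::quat_hilbert"
  using qscale_scaleR [of "-1" u q] by simp

lemma qscale_zero: "qscale 0 q = (0 :: 'a::quat_hilbert)"
  using qscale_scaleR [of 0 "0 :: 'a" q] by simp

lemma qscale_diff: "qscale (u - v) q = qscale u q - qscale v q" for u :: "'a::quat_hilbert"
  using qscale_add_left [of u "- v" q] by (simp add: qscale_minus)

lemma norm_qscale: "norm (qscale u q) = norm u * norm q" for u :: "'a::quat_hilbert"
proof -
  have "qinner (qscale u q) (qscale u q) = qcnj q * (of_real ((norm u)\<^sup>2) * q)"
    unfolding qinner_qscale_left qinner_qscale_right unfolding qinner_self by (rule mult.assoc)
  also have "\<dots> = of_real ((norm u)\<^sup>2) * (qcnj q * q)"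
    by (rule quat_of_real_left_commute)
  also have "qcnj q * q = of_real ((norm q)\<^sup>2)"
    using quat_mult_qcnj [of "qcnj q"] by (simp add: norm_quat_def)
  finally have "(norm (qscale u q))\<^sup>2 = (norm u * norm q)\<^sup>2"
    unfolding qinner_self of_real_mult [symmetric] of_real_eq_iff by (simp only: power_mult_distrib)
  then show ?thesis
    by simp
qed

lemma bounded_ops_add: "S \<in> bounded_ops \<Longrightarrow> T \<in> bounded_ops \<Longrightarrow> S + T \<in> bounded_ops"
  and bounded_ops_diff: "S \<in> bounded_ops \<Longrightarrow> T \<in> bounded_ops \<Longrightarrow> S - T \<in> bounded_ops"
  and bounded_ops_minus: "S \<in> bounded_ops \<Longrightarrow> - S \<in> bounded_ops"
  and bounded_ops_scaleR: "S \<in> bounded_ops \<Longrightarrow> r *\<^sub>R S \<in> bounded_ops"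
  and bounded_ops_compose: "S \<in> bounded_ops \<Longrightarrow> T \<in> bounded_ops \<Longrightarrow> S o\<^sub>L T \<in> bounded_ops"
  and bounded_ops_id: "id_blinfun \<in> bounded_ops"
  and bounded_ops_zero: "0 \<in> bounded_ops"
  unfolding bounded_ops_def mem_Collect_eq
  by (simp_all only: blinfun.bilinear_simps qscale_add_left qscale_diff qscale_minus qscale_scaleR
      qscale_zero blinfun_apply_blinfun_compose blinfun_apply_id_blinfun zero_blinfun.rep_eq simp_thms)

lemmas bounded_ops_intros = bounded_ops_add bounded_ops_diff bounded_ops_minus bounded_ops_scaleR
  bounded_ops_compose bounded_ops_id bounded_ops_zero

text \<open>Right linearity is an intersection of closed pointwise conditions, so norm limits of
  operators stay in \<open>bounded_ops\<close>.\<close>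

lemma closed_bounded_ops: "closed (bounded_ops :: ('a::quat_hilbert \<Rightarrow>\<^sub>L 'a) set)"
proof -
  have cq: "continuous_on UNIV (\<lambda>v::'a. qscale v q)" for q
  proof (rule linear_continuous_on)
    show "bounded_linear (\<lambda>v::'a. qscale v q)"
      by (rule bounded_linear_intro [where K = "norm q"])
         (simp_all add: qscale_add_left qscale_scaleR norm_qscale)
  qed
  have eq: "bounded_ops = (\<Inter>u. \<Inter>q. {T::'a \<Rightarrow>\<^sub>L 'a. T (qscale u q) = qscale (T u) q})"
    by (auto simp: bounded_ops_def)
  have "closed {T::'a \<Rightarrow>\<^sub>L 'a. T (qscale u q) = qscale (T u) q}" for u q
  proof (rule closed_Collect_eq)
    show "continuous_on UNIV (\<lambda>T::'a \<Rightarrow>\<^sub>L 'a. T (qscale u q))"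
      by (rule linear_continuous_on [OF blinfun.bounded_linear_left])
    show "continuous_on UNIV (\<lambda>T::'a \<Rightarrow>\<^sub>L 'a. qscale (T u) q)"
      by (rule continuous_on_compose2 [OF cq linear_continuous_on [OF blinfun.bounded_linear_left]]) simp
  qed
  then show ?thesis
    unfolding eq by (intro closed_INT ballI)
qed

section \<open>Adjoints\<close>

text \<open>Replacing \<open>v\<close> by \<open>qscale v q\<close> in the real identity yields the
  real parts of all right multiples, so the real adjoint is already the quaternionic one.\<close>

lemma real_adjoint_right_linear:
  fixes S T :: "'a::quat_hilbert \<Rightarrow>\<^sub>L 'a"
  assumes "T \<in> bounded_ops" and S: "\<And>u v. inner (S u) v = inner u (T v)"
  shows "S \<in> bounded_ops" "qinner (S u) v = qinner u (T v)"
proof -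
  show *: "qinner (S u) v = qinner u (T v)" for u v
  proof (rule quat_eqI_mult)
    fix q
    show "qRe (qinner (S u) v * q) = qRe (qinner u (T v) * q)"
      using S [of u "qscale v q"] bounded_ops_apply [OF assms(1)]
      by (simp add: inner_eq_qRe_qinner qinner_qscale_right)
  qed
  have "S (qscale u q) = qscale (S u) q" for u q
  proof (rule vector_eq_rdot [THEN iffD1], intro allI)
    fix v
    show "inner (S (qscale u q)) v = inner (qscale (S u) q) v"
      unfolding S by (simp add: inner_eq_qRe_qinner qinner_qscale_left *)
  qed
  then show "S \<in> bounded_ops"
    by (simp add: bounded_ops_def)
qed

text \<open>Evaluates the definite description in \<open>adj\<close>; from here on an adjoint is
  computed with the real inner product only.\<close>

lemma adj_eqI:
  fixes S T :: "'a::quat_hilbert \<Rightarrow>\<^sub>L 'a"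
  assumes "T \<in> bounded_ops" and "\<And>u v. inner (S u) v = inner u (T v)"
  shows "adj T = S"
  unfolding adj_def
proof (rule the_equality)
  show "S \<in> bounded_ops \<and> (\<forall>u v. qinner (S u) v = qinner u (T v))"
    using real_adjoint_right_linear [OF assms] by blast
  fix R :: "'a \<Rightarrow>\<^sub>L 'a"
  assume R: "R \<in> bounded_ops \<and> (\<forall>u v. qinner (R u) v = qinner u (T v))"
  show "R = S"
  proof (rule blinfun_eqI, rule vector_eq_rdot [THEN iffD1], rule allI)
    fix u v show "inner (R u) v = inner (S u) v"
      using R by (simp add: assms(2)) (simp add: inner_eq_qRe_qinner)
  qed
qed

lemma
  fixes T :: "'a::quat_hilbert \<Rightarrow>\<^sub>L 'a"
  assumes "T \<in> bounded_ops"
  shows adj_bounded_ops: "adj T \<in> bounded_ops"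
    and inner_adj_left: "inner (adj T u) v = inner u (T v)"
    and inner_adj_right: "inner u (adj T v) = inner (T u) v"
proof -
  obtain S :: "'a \<Rightarrow>\<^sub>L 'a" where S: "\<And>u v. inner (S u) v = inner u (T v)"
    using real_adjoint_exists [of T] by blast
  then show *: "adj T \<in> bounded_ops" "inner (adj T u) v = inner u (T v)" for u v
    using adj_eqI [OF assms S] real_adjoint_right_linear [OF assms S] by auto
  show "inner u (adj T v) = inner (T u) v"
    by (metis * inner_commute)
qed

lemma adj_adj:
  fixes T :: "'a::quat_hilbert \<Rightarrow>\<^sub>L 'a"
  assumes "T \<in> bounded_ops"
  shows "adj (adj T) = T"
  using assms by (intro adj_eqI adj_bounded_ops) (simp_all add: inner_adj_right)

lemma adj_scaleR:
  fixes T :: "'a::quat_hilbert \<Rightarrow>\<^sub>L 'a"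
  assumes "T \<in> bounded_ops"
  shows "adj (r *\<^sub>R T) = r *\<^sub>R adj T"
  using assms by (intro adj_eqI bounded_ops_scaleR) (simp_all add: blinfun.bilinear_simps inner_adj_left)

lemma
  fixes S T :: "'a::quat_hilbert \<Rightarrow>\<^sub>L 'a"
  assumes S: "S \<in> bounded_ops" and T: "T \<in> bounded_ops"
  shows adj_add: "adj (S + T) = adj S + adj T"
    and adj_diff: "adj (S - T) = adj S - adj T"
    and adj_compose: "adj (S o\<^sub>L T) = adj T o\<^sub>L adj S"
proof -
  show "adj (S + T) = adj S + adj T"
    using S T by (intro adj_eqI bounded_ops_add)
      (simp_all add: blinfun.bilinear_simps inner_add_left inner_add_right inner_adj_left)
  show "adj (S - T) = adj S - adj T"
    using S T by (intro adj_eqI bounded_ops_diff)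
      (simp_all add: blinfun.bilinear_simps inner_diff_left inner_diff_right inner_adj_left)
  show "adj (S o\<^sub>L T) = adj T o\<^sub>L adj S"
    using S T by (intro adj_eqI bounded_ops_compose) (simp_all add: inner_adj_left)
qed

lemma norm_adj_le:
  fixes T :: "'a::quat_hilbert \<Rightarrow>\<^sub>L 'a"
  assumes T: "T \<in> bounded_ops"
  shows "norm (adj T) \<le> norm T"
proof (rule norm_blinfun_bound)
  fix u
  show "norm (adj T u) \<le> norm T * norm u"
  proof (cases "adj T u = 0")
    case False
    have "norm (adj T u) * norm (adj T u) = inner u (T (adj T u))"
      using T by (simp add: dot_square_norm power2_eq_square flip: inner_adj_left)
    also have "\<dots> \<le> norm u * norm (T (adj T u))"
      by (rule norm_cauchy_schwarz)
    also have "\<dots> \<le> norm u * (norm T * norm (adj T u))"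
      by (intro mult_left_mono norm_blinfun norm_ge_zero)
    finally have "norm (adj T u) * norm (adj T u) \<le> (norm T * norm u) * norm (adj T u)"
      by (simp add: mult_ac)
    then show ?thesis
      using False by simp
  qed simp
qed simp

lemma adj_id: "adj (id_blinfun :: 'a::quat_hilbert \<Rightarrow>\<^sub>L 'a) = id_blinfun"
  by (intro adj_eqI bounded_ops_id) simp

lemma normal_op_norm_eq:
  assumes "T \<in> bounded_ops" "normal_op T"
  shows "norm (adj T u) = norm (T u)"
proof -
  have "inner (adj T u) (adj T u) = inner (T u) (T u)"
  proof -
    have "inner (adj T u) (adj T u) = inner u ((T o\<^sub>L adj T) u)"
      using assms(1) by (simp add: inner_adj_left)
    also have "\<dots> = inner u (adj T (T u))"
      using assms(2) by (simp add: normal_op_def)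
    finally show ?thesis
      using assms(1) by (simp add: inner_adj_right)
  qed
  then show ?thesis
    by (simp add: norm_eq_sqrt_inner)
qed

section \<open>Approximate null vectors and invertibility\<close>

text \<open>Negation of being bounded below: 0 belongs to the approximate point spectrum of
  \<open>P\<close>.\<close>

definition approx_null :: "('a::real_normed_vector \<Rightarrow>\<^sub>L 'b::real_normed_vector) \<Rightarrow> bool" where
  "approx_null P \<longleftrightarrow> (\<forall>e>0. \<exists>u. norm u = 1 \<and> norm (P u) < e)"

lemma not_approx_nullE:
  assumes "\<not> approx_null P"
  obtains c where "0 < c" "\<And>u. c * norm u \<le> norm (P u)"
proof -
  obtain c where c: "0 < c" "\<And>u. norm u = 1 \<Longrightarrow> c \<le> norm (P u)"
    using assms by (auto simp: approx_null_def not_less)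
  have "c * norm u \<le> norm (P u)" for u
  proof (cases "u = 0")
    case False
    have "c \<le> norm (P ((1 / norm u) *\<^sub>R u))"
      by (rule c(2)) (simp add: False)
    then show ?thesis
      using False by (simp add: blinfun.scaleR_right pos_le_divide_eq)
  qed simp
  with c(1) that show ?thesis
    by blast
qed

lemma approx_nullD:
  assumes "approx_null P" "0 < c"
  shows "\<exists>u. norm (P u) < c * norm u"
proof -
  obtain u where "norm u = 1" "norm (P u) < c"
    using assms unfolding approx_null_def by blast
  then show ?thesis
    by (intro exI [of _ u]) simp
qed

lemma invertible_op_not_approx_null:
  assumes "invertible_op P"
  shows "\<not> approx_null P"
proof
  assume P: "approx_null P"
  obtain S where S: "S o\<^sub>L P = id_blinfun"
    using assms by (auto simp: invertible_op_def)
  have le: "norm u \<le> (norm S + 1) * norm (P u)" for u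
  proof -
    have "norm u = norm ((S o\<^sub>L P) u)"
      by (simp add: S)
    also have "\<dots> \<le> norm S * norm (P u)"
      by (simp add: norm_blinfun)
    also have "\<dots> \<le> (norm S + 1) * norm (P u)"
      by (intro mult_right_mono) auto
    finally show ?thesis .
  qed
  have pos: "0 < norm S + 1"
    by (simp add: add_nonneg_pos)
  obtain u where "norm (P u) < 1 / (norm S + 1) * norm u"
    using approx_nullD [OF P, of "1 / (norm S + 1)"] pos by auto
  then show False
    using le [of u] pos by (simp add: field_simps)
qed

text \<open>A lower bound gives injectivity and a closed range. A vector orthogonal to the range is
  in the kernel of \<open>adj N\<close>, which for normal \<open>N\<close> is the kernel of
  \<open>N\<close>, hence 0.\<close>

lemma normal_op_invertible:
  fixes N :: "'a::quat_hilbert \<Rightarrow>\<^sub>L 'a"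
  assumes N: "N \<in> bounded_ops" "normal_op N" and "\<not> approx_null N"
  shows "invertible_op N"
proof -
  obtain c where c: "0 < c" "\<And>u. c * norm u \<le> norm (N u)"
    using not_approx_nullE [OF assms(3)] by blast
  have bl: "bounded_linear N"
    by (rule blinfun.bounded_linear_right)
  have "complete (range N)"
    using complete_isometric_image [OF c(1) subspace_UNIV bl] c(2) complete_UNIV by blast
  then have "closed (range N)"
    by (rule complete_imp_closed)
  moreover have "subspace (range N)"
    using linear_subspace_image [OF bounded_linear.linear [OF bl] subspace_UNIV] .
  ultimately have surj: "range N = UNIV"
  proof (rule_tac ccontr)
    assume cl: "closed (range N)" "subspace (range N)" and "range N \<noteq> UNIV"
    then obtain x where "x \<notin> range N"
      by auto
    from exists_orthogonal_to_closed_subspace [OF cl(2,1) this]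
    obtain v where v: "v \<noteq> 0" "\<And>u. inner (N u) v = 0"
      by auto
    have "adj N v = 0"
      using v(2) inner_adj_right [OF N(1), of "adj N v" v] by simp
    then have "N v = 0"
      using normal_op_norm_eq [OF N, of v] by simp
    then show False
      using c(1) c(2) [of v] v(1) by (simp add: mult_le_0_iff)
  qed
  have inj: "inj N"
  proof (rule injI)
    fix x y assume "N x = N y"
    then have "c * norm (x - y) \<le> 0"
      using c(2) [of "x - y"] by (simp add: blinfun.diff_right)
    then show "x = y"
      using c(1) by (simp add: mult_le_0_iff)
  qed
  define s where "s = inv N"
  have Ns: "N (s v) = v" for v
    unfolding s_def using surj by (simp add: f_inv_into_f)
  have sN: "s (N u) = u" for u
    unfolding s_def using inj by simp
  have "bounded_linear s"
  proof (rule bounded_linear_intro [where K = "1 / c"])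
    show "s (u + v) = s u + s v" for u v
      using sN [of "s u + s v"] by (simp add: blinfun.add_right Ns)
    show "s (r *\<^sub>R u) = r *\<^sub>R s u" for r u
      using sN [of "r *\<^sub>R s u"] by (simp add: blinfun.scaleR_right Ns)
    show "norm (s u) \<le> norm u * (1 / c)" for u
      using c(2) [of "s u"] c(1) by (simp add: Ns field_simps)
  qed
  then have S: "blinfun_apply (Blinfun s) = s"
    by (rule bounded_linear_Blinfun_apply)
  moreover have "s (qscale u q) = qscale (s u) q" for u q
    using sN [of "qscale (s u) q"] by (simp add: bounded_ops_apply [OF N(1)] Ns)
  ultimately have "Blinfun s \<in> bounded_ops"
    by (simp add: bounded_ops_def)
  moreover have "Blinfun s o\<^sub>L N = id_blinfun" "N o\<^sub>L Blinfun s = id_blinfun"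
    by (auto intro!: blinfun_eqI simp: S Ns sN)
  ultimately show ?thesis
    unfolding invertible_op_def by blast
qed

lemma normal_op_invertible_iff:
  assumes "N \<in> bounded_ops" "normal_op N"
  shows "invertible_op N \<longleftrightarrow> \<not> approx_null N"
  using normal_op_invertible [OF assms] invertible_op_not_approx_null by blast

section \<open>Positive square roots\<close>

lemma positive_op_inner:
  assumes "positive_op B"
  shows "0 \<le> inner u (B u)"
  using assms by (auto simp: positive_op_def nonneg_quat_def inner_eq_qRe_qinner)

lemma positive_opI:
  assumes B: "B \<in> bounded_ops" "adj B = B" and pos: "\<And>u. 0 \<le> inner u (B u)"
  shows "positive_op B"
  unfolding positive_op_def nonneg_quat_def
proof (intro allI conjI)
  fix u
  have "qinner u (B u) = qcnj (qinner u (B u))"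
    using real_adjoint_right_linear(2) [OF B(1), of "adj B" u u] B inner_adj_left [OF B(1)]
      qinner_commute [of "B u" u] by simp
  then have "qinner u (B u) = of_real (qRe (qinner u (B u)))"
    by (simp add: quat_eq_iff)
  then show "qinner u (B u) \<in> \<real>"
    by (metis Reals_of_real)
  show "0 \<le> qRe (qinner u (B u))"
    using pos by (simp add: inner_eq_qRe_qinner)
qed

text \<open>Quaternionic polarisation: \<open>x q = qcnj q x\<close> for all \<open>q\<close> forces \<open>x = 0\<close>.\<close>

lemma positive_op_self_adjoint:
  fixes B :: "'a::quat_hilbert \<Rightarrow>\<^sub>L 'a"
  assumes B: "B \<in> bounded_ops" and pos: "positive_op B"
  shows "adj B = B"
proof -
  have B': "adj B \<in> bounded_ops"
    by (rule adj_bounded_ops [OF B])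
  have adjq: "qinner (adj B u) v = qinner u (B v)" for u v
    using real_adjoint_right_linear(2) [OF B inner_adj_left [OF B]] .
  define D where "D = B - adj B"
  have D: "D \<in> bounded_ops"
    unfolding D_def by (intro bounded_ops_diff B B')
  have qdiff: "qinner x (y - z) = qinner x y - qinner x z" for x y z :: 'a
    using qinner_add_right [of x "y - z" z] by simp
  have D0: "qinner u (D u) = 0" for u
  proof -
    have "qinner u (B u) \<in> \<real>"
      using pos by (auto simp: positive_op_def nonneg_quat_def)
    then have "qcnj (qinner u (B u)) = qinner u (B u)"
      by (auto simp: Reals_def)
    then have "qinner u (adj B u) = qinner u (B u)"
      using adjq [of u u] qinner_commute [of u "adj B u"] by simp
    then show ?thesis
      by (simp add: D_def blinfun.diff_left qdiff)
  qed
  have qadd: "qinner (x + y) z = qinner x z + qinner y z" for x y z :: 'a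
    by (metis qinner_commute qinner_add_right qcnj_simps(2))
  have skew: "qinner u (D v) + qinner v (D u) = 0" for u v
    using D0 [of "u + v"] D0 [of u] D0 [of v]
    by (simp add: blinfun.add_right qadd qinner_add_right add.commute)
  have "qinner u (D v) = 0" for u v
  proof -
    define x where "x = qinner u (D v)"
    have x: "x * q = qcnj q * x" for q
    proof -
      have "x * q + qcnj q * qinner v (D u) = 0"
        using skew [of u "qscale v q"]
        by (simp add: x_def bounded_ops_apply [OF D] qinner_qscale_left qinner_qscale_right)
      moreover have "qinner v (D u) = - x"
        using skew [of u v] by (simp add: x_def eq_neg_iff_add_eq_0 add.commute)
      ultimately show ?thesis
        by simp
    qed
    show ?thesis
      using x [of "Quat 0 1 0 0"] x [of "Quat 0 0 1 0"] x [of "Quat 0 0 0 1"]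
      unfolding x_def [symmetric] by (simp add: quat_eq_iff)
  qed
  then have "D v = 0" for v
    by (metis qinner_definite)
  then have "D = 0"
    by (intro blinfun_eqI) simp
  then show ?thesis
    by (simp add: D_def)
qed

text \<open>Otherwise the quadratic form of \<open>B\<close> would be negative at
  \<open>u - t *\<^sub>R B u\<close> for small positive \<open>t\<close>.\<close>

lemma positive_op_null:
  assumes B: "B \<in> bounded_ops" "positive_op B" and "inner u (B u) = 0"
  shows "B u = 0"
proof (rule ccontr)
  assume nz: "B u \<noteq> 0"
  define a where "a = inner (B u) (B u)"
  define b where "b = inner (B u) (B (B u))"
  have a: "0 < a"
    using nz by (simp add: a_def)
  have b: "0 \<le> b"
    unfolding b_def by (rule positive_op_inner [OF B(2)])
  have sym: "inner x (B y) = inner (B x) y" for x y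
    by (metis inner_adj_right [OF B(1)] positive_op_self_adjoint [OF B])
  \<comment> \<open>\<open>b + 1\<close> in place of \<open>b\<close> keeps the quotient defined for
    \<open>b = 0\<close> and still gives \<open>t * b < a\<close>.\<close>
  define t where "t = a / (b + 1)"
  have t: "0 < t"
    using a b by (simp add: t_def)
  have "t * (b + 1) = a"
    using b by (simp add: t_def)
  then have tb: "t * b < a"
    using t by (simp add: distrib_left)
  have "0 \<le> inner (u - t *\<^sub>R B u) (B (u - t *\<^sub>R B u))"
    by (rule positive_op_inner [OF B(2)])
  also have "\<dots> = - 2 * t * a + t * t * b"
  proof -
    have *: "inner (u - t *\<^sub>R w) (B (u - t *\<^sub>R w)) = inner u (B u)
        - t * inner u (B w) - t * inner w (B u) + t * t * inner w (B w)" for w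
      by (simp add: blinfun.bilinear_simps inner_diff_left inner_diff_right algebra_simps)
    show ?thesis
      unfolding * unfolding assms(3) sym [of u "B u"] a_def b_def by simp
  qed
  also have "\<dots> = t * (t * b - 2 * a)"
    by (simp add: algebra_simps)
  also have "\<dots> < 0"
    using t tb a by (intro mult_pos_neg) auto
  finally show False
    by simp
qed

section \<open>Square root by a dominated iteration\<close>

text \<open>
  For \<open>\<parallel>X\<parallel> \<le> 1\<close> the iteration \<open>Y \<mapsto> (X + Y\<^sup>2) / 2\<close> from \<open>0\<close> converges, since its increments
  are dominated by those of the scalar iteration \<open>y \<mapsto> (1 + y\<^sup>2) / 2\<close>; the limit satisfies
  \<open>(1 - Y)\<^sup>2 = 1 - X\<close>.
\<close>

primrec sqrt_iter :: "('a::real_normed_vector \<Rightarrow>\<^sub>L 'a) \<Rightarrow> nat \<Rightarrow> ('a \<Rightarrow>\<^sub>L 'a)" where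
  "sqrt_iter X 0 = 0"
| "sqrt_iter X (Suc n) = (1/2) *\<^sub>R (X + (sqrt_iter X n o\<^sub>L sqrt_iter X n))"

primrec sqrt_iter_real :: "nat \<Rightarrow> real" where
  "sqrt_iter_real 0 = 0"
| "sqrt_iter_real (Suc n) = (1 + (sqrt_iter_real n)\<^sup>2) / 2"

lemma sqrt_iter_real_bounds: "0 \<le> sqrt_iter_real n" "sqrt_iter_real n \<le> 1"
proof -
  have "0 \<le> sqrt_iter_real n \<and> sqrt_iter_real n \<le> 1"
    by (induction n) (auto simp: power_le_one)
  then show "0 \<le> sqrt_iter_real n" "sqrt_iter_real n \<le> 1"
    by auto
qed

context
  fixes X :: "'a::banach \<Rightarrow>\<^sub>L 'a"
  assumes X: "norm X \<le> 1"
begin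

lemma norm_sqrt_iter: "norm (sqrt_iter X n) \<le> sqrt_iter_real n"
proof (induction n)
  case (Suc n)
  have "norm (X + (sqrt_iter X n o\<^sub>L sqrt_iter X n)) \<le> 1 + (sqrt_iter_real n)\<^sup>2"
  proof (rule norm_triangle_mono [OF X])
    show "norm (sqrt_iter X n o\<^sub>L sqrt_iter X n) \<le> (sqrt_iter_real n)\<^sup>2"
      unfolding power2_eq_square
      by (rule order_trans [OF norm_blinfun_compose])
        (intro mult_mono Suc norm_ge_zero sqrt_iter_real_bounds)
  qed
  then show ?case
    by simp
qed simp

text \<open>The difference of the squares of \<open>b\<close> and \<open>a\<close> is
  \<open>b (b - a) + (b - a) a\<close>, valid without commutativity; its scalar analogue
  \<open>s (s - r) + (s - r) r\<close> is exactly the increment of the majorant.\<close>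

lemma norm_sqrt_iter_diff:
  "norm (sqrt_iter X (Suc n) - sqrt_iter X n) \<le> sqrt_iter_real (Suc n) - sqrt_iter_real n"
proof (induction n)
  case 0
  then show ?case
    using X by simp
next
  case (Suc n)
  define a where "a = sqrt_iter X n"
  define b where "b = sqrt_iter X (Suc n)"
  define r where "r = sqrt_iter_real n"
  define s where "s = sqrt_iter_real (Suc n)"
  have IH: "norm (b - a) \<le> s - r"
    using Suc by (simp only: a_def b_def r_def s_def)
  then have rs: "0 \<le> s - r"
    by (rule order_trans [OF norm_ge_zero])
  have na: "norm a \<le> r" and nb: "norm b \<le> s"
    unfolding a_def b_def r_def s_def by (rule norm_sqrt_iter)+
  have b: "b = (1/2) *\<^sub>R (X + (a o\<^sub>L a))"
    by (simp add: a_def b_def)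
  have bb: "sqrt_iter X (Suc (Suc n)) = (1/2) *\<^sub>R (X + (b o\<^sub>L b))"
    by (simp add: b_def)
  have s: "s = (1 + r\<^sup>2) / 2" and ss: "sqrt_iter_real (Suc (Suc n)) = (1 + s\<^sup>2) / 2"
    by (simp_all add: r_def s_def)
  have "sqrt_iter X (Suc (Suc n)) - b = (1/2) *\<^sub>R (X + (b o\<^sub>L b)) - (1/2) *\<^sub>R (X + (a o\<^sub>L a))"
    by (simp only: bb b [symmetric])
  also have "\<dots> = (1/2) *\<^sub>R ((b o\<^sub>L (b - a)) + ((b - a) o\<^sub>L a))"
    by (rule blinfun_eqI) (simp add: blinfun.bilinear_simps algebra_simps)
  also have "norm \<dots> = (1/2) * norm ((b o\<^sub>L (b - a)) + ((b - a) o\<^sub>L a))"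
    by simp
  also have "\<dots> \<le> (1/2) * (s * (s - r) + (s - r) * r)"
  proof (intro mult_left_mono norm_triangle_mono)
    show "norm (b o\<^sub>L (b - a)) \<le> s * (s - r)"
      by (rule order_trans [OF norm_blinfun_compose]) (intro mult_mono nb IH order_trans [OF norm_ge_zero nb] norm_ge_zero)
    show "norm ((b - a) o\<^sub>L a) \<le> (s - r) * r"
      by (rule order_trans [OF norm_blinfun_compose]) (intro mult_mono na IH rs norm_ge_zero)
  qed simp
  also have "\<dots> = (1 + s\<^sup>2) / 2 - (1 + r\<^sup>2) / 2"
    by (simp add: power2_eq_square field_simps)
  also have "\<dots> = sqrt_iter_real (Suc (Suc n)) - s"
    by (simp only: ss s [symmetric])
  finally show ?case
    by (simp only: b_def s_def)
qed

text \<open>The increments telescope against an increasing bounded real sequence, which makes the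
  operators Cauchy; the equation is the fixed point equation of the iteration.\<close>

lemma sqrt_iter_limit:
  obtains Y where "sqrt_iter X \<longlonglongrightarrow> Y" "norm Y \<le> 1" "Y + Y = X + (Y o\<^sub>L Y)"
proof -
  have step: "norm (sqrt_iter X (n + k) - sqrt_iter X n) \<le> sqrt_iter_real (n + k) - sqrt_iter_real n"
    for n k
  proof (induction k)
    case (Suc k)
    show ?case
      using norm_triangle_mono [OF norm_sqrt_iter_diff [of "n + k"] Suc] by simp
  qed simp
  have "incseq sqrt_iter_real"
  proof (rule incseq_SucI)
    fix n
    show "sqrt_iter_real n \<le> sqrt_iter_real (Suc n)"
      using order_trans [OF norm_ge_zero step [of n 1]] by simp
  qed
  then have "convergent sqrt_iter_real"
    using sqrt_iter_real_bounds(2) by (metis incseq_convergent convergent_def)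
  then have cy: "Cauchy sqrt_iter_real"
    by (rule convergent_Cauchy)
  have "Cauchy (sqrt_iter X)"
  proof (rule CauchyI')
    fix e :: real assume "0 < e"
    then obtain M where M: "\<And>m n. M \<le> m \<Longrightarrow> m < n \<Longrightarrow> norm (sqrt_iter_real m - sqrt_iter_real n) < e"
      using CauchyD [OF cy] by (metis less_imp_le order_trans)
    have "dist (sqrt_iter X m) (sqrt_iter X n) < e" if "M \<le> m" "m < n" for m n
    proof -
      have "norm (sqrt_iter X m - sqrt_iter X n) \<le> sqrt_iter_real n - sqrt_iter_real m"
        using step [of m "n - m"] that(2) by (simp add: norm_minus_commute)
      also have "\<dots> < e"
        using M [OF that] by simp
      finally show ?thesis
        by (simp add: dist_norm)
    qed
    then show "\<exists>M. \<forall>m\<ge>M. \<forall>n>m. dist (sqrt_iter X m) (sqrt_iter X n) < e"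
      by blast
  qed
  then obtain Y where Y: "sqrt_iter X \<longlonglongrightarrow> Y"
    using Cauchy_convergent convergent_def by blast
  have "norm Y \<le> 1"
    by (rule LIMSEQ_le_const2 [OF tendsto_norm [OF Y]])
      (meson norm_sqrt_iter sqrt_iter_real_bounds(2) order_trans)
  moreover have "(\<lambda>n. sqrt_iter X (Suc n)) \<longlonglongrightarrow> (1/2) *\<^sub>R (X + (Y o\<^sub>L Y))"
    unfolding sqrt_iter.simps
    by (intro tendsto_scaleR tendsto_add tendsto_const
        bounded_bilinear.tendsto [OF bounded_bilinear_blinfun_compose] Y)
  then have "(1/2) *\<^sub>R (X + (Y o\<^sub>L Y)) = Y"
    using LIMSEQ_unique LIMSEQ_Suc [OF Y] by blast
  then have "2 *\<^sub>R ((1/2) *\<^sub>R (X + (Y o\<^sub>L Y))) = Y + Y"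
    by (simp only: scaleR_2)
  then have "Y + Y = X + (Y o\<^sub>L Y)"
    by simp
  ultimately show thesis
    using that Y by blast
qed

end

text \<open>With \<open>S = adj C o\<^sub>L C\<close> and small \<open>t\<close>, the operator
  \<open>1 - t S\<close> is a contraction, and \<open>1 - Y\<close> for the limit \<open>Y\<close>
  is a square root of \<open>t S\<close>, positive since \<open>norm Y \<le> 1\<close>. Symmetry and
  commutation hold for each iterate and pass to the limit.\<close>

lemma positive_sqrt_exists:
  fixes C :: "'a::quat_hilbert \<Rightarrow>\<^sub>L 'a"
  assumes C: "C \<in> bounded_ops"
  shows "\<exists>R\<in>bounded_ops. positive_op R \<and> R o\<^sub>L R = adj C o\<^sub>L C \<and>
    (\<forall>W. W o\<^sub>L (adj C o\<^sub>L C) = (adj C o\<^sub>L C) o\<^sub>L W \<longrightarrow> W o\<^sub>L R = R o\<^sub>L W)"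
proof -
  define S where "S = adj C o\<^sub>L C"
  have S: "S \<in> bounded_ops"
    unfolding S_def by (intro bounded_ops_compose adj_bounded_ops C)
  have uS: "inner u (S v) = inner (C u) (C v)" and Su: "inner (S u) v = inner (C u) (C v)" for u v
    by (simp_all add: S_def inner_adj_right [OF C] inner_adj_left [OF C])
  define t where "t = 1 / ((norm C)\<^sup>2 + 1)"
  have pos: "0 < (norm C)\<^sup>2 + 1"
    by (simp add: add_nonneg_pos)
  then have t: "0 < t"
    by (simp add: t_def)
  have tC: "t * (norm C)\<^sup>2 \<le> 1"
    using pos by (simp add: t_def)
  define X where "X = id_blinfun - t *\<^sub>R S"
  have "norm X \<le> 1"
  proof (rule norm_blinfun_bound)
    fix u
    have "norm (S u) \<le> norm C * norm (C u)"
      using norm_blinfun [of "adj C" "C u"] mult_right_mono [OF norm_adj_le [OF C] norm_ge_zero [of "C u"]]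
      by (simp add: S_def)
    then have "(norm (S u))\<^sup>2 \<le> (norm C * norm (C u))\<^sup>2"
      by (rule power_mono) simp
    then have "t * (norm (S u))\<^sup>2 \<le> (t * (norm C)\<^sup>2) * (norm (C u))\<^sup>2"
      using t by (simp add: power_mult_distrib)
    also have "\<dots> \<le> 1 * (norm (C u))\<^sup>2"
      using tC by (intro mult_right_mono) auto
    finally have le: "t * (norm (S u))\<^sup>2 \<le> (norm (C u))\<^sup>2"
      by simp
    have "(norm (X u))\<^sup>2 = (norm u)\<^sup>2 - 2 * t * inner u (S u) + t * (t * (norm (S u))\<^sup>2)"
      by (simp add: X_def power2_norm_eq_inner blinfun.bilinear_simps inner_diff_left inner_diff_right
          inner_commute [of "S u" u] right_diff_distrib)
    also have "\<dots> = (norm u)\<^sup>2 - t * (2 * (norm (C u))\<^sup>2 - t * (norm (S u))\<^sup>2)"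
      by (simp add: uS dot_square_norm algebra_simps)
    also have "\<dots> \<le> (norm u)\<^sup>2 - t * 0"
    proof (intro diff_left_mono mult_left_mono)
      show "0 \<le> 2 * (norm (C u))\<^sup>2 - t * (norm (S u))\<^sup>2"
        using le zero_le_power2 [of "norm (C u)"] by linarith
    qed (use t in simp)
    finally show "norm (X u) \<le> 1 * norm u"
      by simp
  qed simp
  then obtain Y where Y: "sqrt_iter X \<longlonglongrightarrow> Y" "norm Y \<le> 1" "Y + Y = X + (Y o\<^sub>L Y)"
    by (rule sqrt_iter_limit)
  have apply_lim: "(\<lambda>n. sqrt_iter X n u) \<longlonglongrightarrow> Y u" for u
    by (rule bounded_linear.tendsto [OF blinfun.bounded_linear_left Y(1)])
  have "sqrt_iter X n \<in> bounded_ops" for n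
    by (induction n) (auto simp: X_def intro!: bounded_ops_intros S)
  then have YB: "Y \<in> bounded_ops"
    using closed_sequentially [OF closed_bounded_ops] Y(1) by blast
  have "inner (sqrt_iter X n u) v = inner u (sqrt_iter X n v)" for n u v
    by (induction n arbitrary: u v)
      (simp_all add: X_def blinfun.bilinear_simps inner_add_left inner_add_right inner_diff_left
        inner_diff_right Su uS)
  then have Ysym: "inner (Y u) v = inner u (Y v)" for u v
    using LIMSEQ_unique [OF tendsto_inner [OF apply_lim tendsto_const, of u v]]
      tendsto_inner [OF tendsto_const apply_lim, of u v] by simp
  define R where "R = (1 / sqrt t) *\<^sub>R (id_blinfun - Y)"
  have RB: "R \<in> bounded_ops"
    unfolding R_def by (intro bounded_ops_intros YB)
  moreover have "positive_op R"
  proof (rule positive_opI [OF RB])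
    show "adj R = R"
      by (rule adj_eqI [OF RB])
        (simp add: R_def blinfun.bilinear_simps inner_diff_left inner_diff_right Ysym)
    fix u
    have "inner u (Y u) \<le> norm u * (norm Y * norm u)"
      by (rule order_trans [OF norm_cauchy_schwarz]) (intro mult_left_mono norm_blinfun norm_ge_zero)
    also have "\<dots> \<le> norm u * (1 * norm u)"
      by (intro mult_left_mono mult_right_mono Y(2) norm_ge_zero)
    finally have "0 \<le> inner u u - inner u (Y u)"
      by (simp add: dot_square_norm power2_eq_square)
    then show "0 \<le> inner u (R u)"
      using t by (simp add: R_def blinfun.bilinear_simps inner_diff_right)
  qed
  moreover have "R o\<^sub>L R = S"
  proof -
    have "R o\<^sub>L R = (1 / t) *\<^sub>R (id_blinfun - (Y + Y) + (Y o\<^sub>L Y))"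
      using t by (intro blinfun_eqI)
        (simp add: R_def blinfun.bilinear_simps algebra_simps flip: real_sqrt_mult)
    also have "\<dots> = (1 / t) *\<^sub>R (t *\<^sub>R S)"
      unfolding Y(3) by (simp add: X_def)
    finally show ?thesis
      using t by simp
  qed
  moreover have "W o\<^sub>L R = R o\<^sub>L W" if W: "W o\<^sub>L S = S o\<^sub>L W" for W
  proof -
    have WS: "W (S u) = S (W u)" for u
      using arg_cong [OF W, of "\<lambda>B. B u"] by simp
    have "W (sqrt_iter X n u) = sqrt_iter X n (W u)" for n u
      by (induction n arbitrary: u) (simp_all add: X_def blinfun.bilinear_simps WS)
    then have "W (Y u) = Y (W u)" for u
      using LIMSEQ_unique [OF bounded_linear.tendsto [OF blinfun.bounded_linear_right apply_lim, of W u]]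
        apply_lim [of "W u"] by simp
    then show ?thesis
      by (intro blinfun_eqI) (simp add: R_def blinfun.bilinear_simps)
  qed
  ultimately show ?thesis
    unfolding S_def by blast
qed

text \<open>The definite description in \<open>sqrt_op\<close> needs uniqueness. A second root
  \<open>B\<close> commutes with its own square, hence with \<open>R\<close>; then
  \<open>B + R\<close> annihilates \<open>v = B u - R u\<close>, by positivity so do
  \<open>B\<close> and \<open>R\<close> separately, and \<open>v\<close> is orthogonal to
  itself.\<close>

lemma positive_abs_op:
  fixes C :: "'a::quat_hilbert \<Rightarrow>\<^sub>L 'a"
  assumes C: "C \<in> bounded_ops"
  shows "positive_op (abs_op C)"
proof -
  obtain R where R: "R \<in> bounded_ops" "positive_op R" "R o\<^sub>L R = adj C o\<^sub>L C"
    and comm: "\<And>W. W o\<^sub>L (adj C o\<^sub>L C) = (adj C o\<^sub>L C) o\<^sub>L W \<Longrightarrow> W o\<^sub>L R = R o\<^sub>L W"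
    using positive_sqrt_exists [OF C] by blast
  have unique: "B = R" if B: "B \<in> bounded_ops" "positive_op B" "B o\<^sub>L B = adj C o\<^sub>L C" for B
  proof (rule blinfun_eqI)
    fix u
    have "B o\<^sub>L R = R o\<^sub>L B"
      by (rule comm) (auto intro: blinfun_eqI simp: B(3) [symmetric])
    then have BR: "B (R x) = R (B x)" for x
      by (metis blinfun_apply_blinfun_compose)
    have sq: "B (B x) = R (R x)" for x
      using B(3) R(3) by (metis blinfun_apply_blinfun_compose)
    define v where "v = B u - R u"
    have "B v + R v = 0"
      by (simp add: v_def blinfun.bilinear_simps BR sq)
    then have "inner v (B v) + inner v (R v) = 0"
      by (simp flip: inner_add_right)
    then have "inner v (B v) = 0" "inner v (R v) = 0"
      using positive_op_inner [OF B(2), of v] positive_op_inner [OF R(2), of v] by linarith+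
    then have "B v = 0" "R v = 0"
      using positive_op_null B R by blast+
    moreover have "inner v v = inner u (B v) - inner u (R v)"
      using inner_adj_right [OF B(1), of u v] inner_adj_right [OF R(1), of u v]
      by (simp add: positive_op_self_adjoint [OF B(1,2)] positive_op_self_adjoint [OF R(1,2)]
          v_def inner_diff_left inner_commute)
    ultimately show "B u = R u"
      by (simp add: v_def)
  qed
  have "abs_op C = R"
    unfolding abs_op_def sqrt_op_def using R unique by (intro the_equality) blast+
  then show ?thesis
    using R by simp
qed

section \<open>Functional calculus of a normal operator commuting with a complex structure\<close>

locale complex_normal =
  fixes T J :: "'a::quat_hilbert \<Rightarrow>\<^sub>L 'a"
  assumes T: "T \<in> bounded_ops" and normal_T: "normal_op T"
    and J: "J \<in> bounded_ops" and adj_J: "adj J = - J" and J_square: "J o\<^sub>L J = - id_blinfun"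
    and T_J: "T o\<^sub>L J = J o\<^sub>L T" and adj_T_J: "adj T o\<^sub>L J = J o\<^sub>L adj T"
begin

lemma J_J [simp]: "J (J u) = - u"
  using arg_cong [OF J_square, of "\<lambda>B. B u"] by (simp add: blinfun.minus_left)

lemma T_J_apply: "T (J u) = J (T u)"
  using arg_cong [OF T_J, of "\<lambda>B. B u"] by simp

lemma adj_T_J_apply: "adj T (J u) = J (adj T u)"
  using arg_cong [OF adj_T_J, of "\<lambda>B. B u"] by simp

lemma adj_T_T: "adj T (T u) = T (adj T u)"
  using arg_cong [OF normal_T [unfolded normal_op_def], of "\<lambda>B. B u"] by simp

lemma inner_J_left: "inner (J u) v = - inner u (J v)"
  using inner_adj_right [OF J, of u v] by (simp add: adj_J blinfun.minus_left)

lemma inner_J_self: "inner u (J u) = 0"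
  using inner_J_left [of u u] by (simp add: inner_commute)

lemma norm_J: "norm (J u) = norm u"
  by (simp add: norm_eq_sqrt_inner inner_J_left)

text \<open>Multiplication by the complex scalar \<open>z\<close> for the complex structure
  \<open>J\<close>, kept as an operator because \<open>z\<close> acts inside
  \<open>bounded_ops\<close>.\<close>

definition cop :: "complex \<Rightarrow> 'a \<Rightarrow>\<^sub>L 'a" where
  "cop z = Re z *\<^sub>R id_blinfun + Im z *\<^sub>R J"

lemma cop_apply: "cop z u = Re z *\<^sub>R u + Im z *\<^sub>R J u"
  by (simp add: cop_def blinfun.bilinear_simps)

lemma cop_bounded_ops: "cop z \<in> bounded_ops"
  unfolding cop_def by (intro bounded_ops_intros J)

lemma cop_add: "cop (z + w) = cop z + cop w"
  by (rule blinfun_eqI) (simp add: cop_apply blinfun.bilinear_simps algebra_simps)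

lemma cop_diff: "cop (z - w) = cop z - cop w"
  by (rule blinfun_eqI) (simp add: cop_apply blinfun.bilinear_simps algebra_simps)

lemma cop_mult: "cop (z * w) u = cop z (cop w u)"
  by (simp add: cop_apply blinfun.bilinear_simps algebra_simps)

lemma cop_of_real: "cop (of_real r) = r *\<^sub>R id_blinfun"
  by (simp add: cop_def)

lemma cop_0: "cop 0 = 0" and cop_1: "cop 1 = id_blinfun"
  by (simp_all add: cop_def)

lemma norm_cop_apply: "norm (cop z u) = cmod z * norm u"
proof -
  have "(norm (cop z u))\<^sup>2 = (cmod z * norm u)\<^sup>2"
    unfolding power_mult_distrib cmod_power2 power2_norm_eq_inner
    by (simp add: cop_apply inner_add_left inner_add_right inner_J_left inner_J_self power2_eq_square
        algebra_simps)
  then show ?thesis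
    by simp
qed

lemma adj_cop: "adj (cop z) = cop (cnj z)"
  by (rule adj_eqI [OF cop_bounded_ops])
    (simp add: cop_apply inner_add_left inner_add_right inner_diff_left inner_J_left)

definition commutant :: "('a \<Rightarrow>\<^sub>L 'a) \<Rightarrow> bool" where
  "commutant P \<longleftrightarrow> P \<in> bounded_ops \<and>
     P o\<^sub>L T = T o\<^sub>L P \<and> P o\<^sub>L adj T = adj T o\<^sub>L P \<and> P o\<^sub>L J = J o\<^sub>L P"

lemma commutantD:
  assumes "commutant P"
  shows "P \<in> bounded_ops" "P (T u) = T (P u)" "P (adj T u) = adj T (P u)" "P (J u) = J (P u)"
    "P (cop z u) = cop z (P u)"
proof -
  show "P \<in> bounded_ops" "P (T u) = T (P u)" "P (adj T u) = adj T (P u)"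
    using assms unfolding commutant_def by (metis blinfun_apply_blinfun_compose)+
  show *: "P (J u) = J (P u)" for u
    using assms unfolding commutant_def by (metis blinfun_apply_blinfun_compose)
  show "P (cop z u) = cop z (P u)"
    by (simp add: cop_apply blinfun.bilinear_simps *)
qed

lemma commutantI:
  assumes "P \<in> bounded_ops" "\<And>u. P (T u) = T (P u)" "\<And>u. P (adj T u) = adj T (P u)"
    "\<And>u. P (J u) = J (P u)"
  shows "commutant P"
  unfolding commutant_def using assms by (auto intro!: blinfun_eqI)

lemma commutant_cop: "commutant (cop z)"
  by (rule commutantI)
    (simp_all add: cop_bounded_ops cop_apply blinfun.bilinear_simps T_J_apply adj_T_J_apply)

lemma commutant_T: "commutant T"
  by (rule commutantI) (simp_all add: T T_J_apply adj_T_T)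

lemma commutant_adj:
  assumes "commutant P"
  shows "commutant (adj P)"
proof -
  note PB = commutantD(1) [OF assms]
  have comm: "P o\<^sub>L T = T o\<^sub>L P" "P o\<^sub>L adj T = adj T o\<^sub>L P" "P o\<^sub>L J = J o\<^sub>L P"
    using assms by (auto simp: commutant_def)
  have "adj (P o\<^sub>L T) = adj (T o\<^sub>L P)" "adj (P o\<^sub>L adj T) = adj (adj T o\<^sub>L P)"
    "adj (P o\<^sub>L J) = adj (J o\<^sub>L P)"
    by (simp_all only: comm)
  then have "adj T o\<^sub>L adj P = adj P o\<^sub>L adj T" "T o\<^sub>L adj P = adj P o\<^sub>L T"
    "- J o\<^sub>L adj P = adj P o\<^sub>L - J"
    by (simp_all add: adj_compose PB T J adj_bounded_ops [OF T] adj_adj [OF T] adj_J)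
  then show ?thesis
    unfolding commutant_def using adj_bounded_ops [OF PB]
    by (simp add: bounded_bilinear.minus_left [OF bounded_bilinear_blinfun_compose]
        bounded_bilinear.minus_right [OF bounded_bilinear_blinfun_compose])
qed

lemma commutant_add: "commutant P \<Longrightarrow> commutant Q \<Longrightarrow> commutant (P + Q)"
  and commutant_diff: "commutant P \<Longrightarrow> commutant Q \<Longrightarrow> commutant (P - Q)"
  and commutant_compose: "commutant P \<Longrightarrow> commutant Q \<Longrightarrow> commutant (P o\<^sub>L Q)"
  by (rule commutantI; simp add: commutantD bounded_ops_intros blinfun.bilinear_simps)+

lemma commutant_limit:
  assumes P: "\<And>n. commutant (P n)" and lim: "P \<longlonglongrightarrow> Q"
  shows "commutant Q"
proof (rule commutantI)
  show "Q \<in> bounded_ops"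
    using closed_sequentially [OF closed_bounded_ops _ lim] commutantD(1) [OF P] by blast
  have pw: "(\<lambda>n. P n u) \<longlonglongrightarrow> Q u" for u
    by (rule bounded_linear.tendsto [OF blinfun.bounded_linear_left lim])
  have "Q (A u) = A (Q u)" if "\<And>n u. P n (A u) = A (P n u)" for A :: "'a \<Rightarrow>\<^sub>L 'a" and u
    using LIMSEQ_unique [OF bounded_linear.tendsto [OF blinfun.bounded_linear_right pw, of A u]]
      pw [of "A u"] by (simp add: that)
  then show "Q (T u) = T (Q u)" "Q (adj T u) = adj T (Q u)" "Q (J u) = J (Q u)" for u
    using commutantD [OF P] by blast+
qed

lemma normal_op_shift:
  assumes "commutant P" "normal_op P"
  shows "normal_op (P - cop z)"
proof -
  have N: "P (adj P u) = adj P (P u)" for u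
    using assms(2) unfolding normal_op_def by (metis blinfun_apply_blinfun_compose)
  have "cop z (cop (cnj z) u) = cop (cnj z) (cop z u)" for u
    by (simp flip: cop_mult add: mult.commute)
  then show ?thesis
    using assms(1)
    by (auto intro!: blinfun_eqI simp: normal_op_def adj_diff adj_cop cop_bounded_ops commutantD
        commutantD [OF commutant_adj] blinfun.bilinear_simps N algebra_simps)
qed

text \<open>\<open>P - cop z\<close> is normal, so it and its adjoint have equal norms at every
  vector: approximate eigenvectors of \<open>P\<close> at \<open>z\<close> are those of
  \<open>adj P\<close> at \<open>cnj z\<close>.\<close>

lemma norm_adj_shift:
  assumes "commutant P" "normal_op P"
  shows "norm (adj P u - cop (cnj z) u) = norm (P u - cop z u)"
proof -
  have B: "P \<in> bounded_ops" "cop z \<in> bounded_ops"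
    using assms commutantD(1) cop_bounded_ops by blast+
  have "norm (adj (P - cop z) u) = norm ((P - cop z) u)"
    using B by (intro normal_op_norm_eq bounded_ops_diff normal_op_shift assms)
  then show ?thesis
    using B by (simp add: adj_diff adj_cop blinfun.diff_left)
qed

subsection \<open>The approximate point spectrum\<close>

text \<open>For the normal operator \<open>T\<close> this is the whole spectrum on the complex
  Hilbert space given by \<open>J\<close>.\<close>

definition apsp :: "complex set" where
  "apsp = {z. approx_null (T - cop z)}"

lemma apspD:
  assumes "z \<in> apsp" "0 < e"
  obtains u where "norm u = 1" "norm (T u - cop z u) < e"
  using assms unfolding apsp_def approx_null_def by (auto simp: blinfun.diff_left)

text \<open>
  With \<open>T = A + J B\<close> for the commuting self-adjoint operators \<open>A = (T + T\<^sup>*) / 2\<close> and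
  \<open>B = - J (T - T\<^sup>*) / 2\<close>, approximate eigenvectors of \<open>A\<close> and then of \<open>B\<close> can be found
  among the approximate null vectors of \<open>P\<close>.
\<close>

lemma joint_approximate_spectrum:
  assumes P: "commutant P" and null: "approx_null P"
  obtains z where "z \<in> apsp"
    "\<And>e. 0 < e \<Longrightarrow> \<exists>u. norm u = 1 \<and> norm (P u) < e \<and> norm (T u - cop z u) < e"
proof -
  define A where "A = (1/2) *\<^sub>R (T + adj T)"
  \<comment> \<open>The sign comes from the square of \<open>J\<close> being -1: \<open>J\<close>
    composed with \<open>B\<close> is half of \<open>T - adj T\<close>.\<close>
  define B where "B = (-1/2) *\<^sub>R (J o\<^sub>L (T - adj T))"
  have A_apply: "A u = (1/2) *\<^sub>R (T u + adj T u)" for u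
    by (simp add: A_def blinfun.bilinear_simps)
  have B_apply: "B u = (-1/2) *\<^sub>R J (T u - adj T u)" for u
    by (simp add: B_def blinfun.bilinear_simps)
  have TAB: "T u = A u + J (B u)" for u
    by (simp add: A_apply B_apply blinfun.bilinear_simps flip: scaleR_add_left scaleR_add_right)
      (simp add: algebra_simps flip: scaleR_add_left)
  have symA: "inner (A u) v = inner u (A v)" for u v
    by (simp add: A_apply inner_add_left inner_add_right inner_adj_left [OF T] inner_adj_right [OF T])
  have symB: "inner (B u) v = inner u (B v)" for u v
    by (simp add: B_apply inner_J_left inner_diff_left inner_diff_right blinfun.bilinear_simps
        inner_adj_left [OF T] inner_adj_right [OF T] T_J_apply adj_T_J_apply [symmetric])
  have AP: "P (A u) = A (P u)" and BP: "P (B u) = B (P u)" for u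
    by (simp_all add: A_apply B_apply blinfun.bilinear_simps commutantD [OF P])
  have AB: "A (B u) = B (A u)" for u
    by (simp add: A_apply B_apply blinfun.bilinear_simps T_J_apply adj_T_J_apply adj_T_T
        algebra_simps)
  obtain \<alpha> where \<alpha>: "\<forall>e>0. \<exists>u. norm u = 1 \<and> norm (P u) < e \<and> norm (A u - \<alpha> *\<^sub>R u) < e"
  proof -
    have "\<exists>\<alpha>. \<forall>e>0. \<exists>u. norm u = 1 \<and> norm (P u) < e \<and> norm (A u - \<alpha> *\<^sub>R u) < e"
    proof (rule joint_approximate_eigenvalue [OF symA, where C = "norm A"])
      show "norm (P (A u)) \<le> norm A * norm (P u)" for u
        unfolding AP by (rule norm_blinfun)
      show "\<exists>u. norm u = 1 \<and> norm (P u) < e" if "0 < e" for e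
        using null that by (auto simp: approx_null_def)
    qed (simp_all add: blinfun.bilinear_simps norm_triangle_ineq)
    then show thesis
      using that by blast
  qed
  \<comment> \<open>Smallness of \<open>p\<close> keeps both the null condition on \<open>P\<close>
    and the eigenvalue condition on \<open>A\<close>. As \<open>B\<close> commutes with
    \<open>P\<close> and \<open>A\<close>, it enlarges \<open>p\<close> by at most the factor
    \<open>norm B\<close>.\<close>
  define p where "p u = norm (P u) + norm (A u - \<alpha> *\<^sub>R u)" for u
  obtain \<beta> where \<beta>: "\<forall>e>0. \<exists>u. norm u = 1 \<and> p u < e \<and> norm (B u - \<beta> *\<^sub>R u) < e"
  proof -
    have "\<exists>\<beta>. \<forall>e>0. \<exists>u. norm u = 1 \<and> p u < e \<and> norm (B u - \<beta> *\<^sub>R u) < e"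
    proof (rule joint_approximate_eigenvalue [OF symB, where C = "norm B"])
      show "p (B u) \<le> norm B * p u" for u
      proof -
        have "A (B u) - \<alpha> *\<^sub>R B u = B (A u - \<alpha> *\<^sub>R u)"
          by (simp add: AB blinfun.bilinear_simps)
        then show ?thesis
          using norm_blinfun [of B "P u"] norm_blinfun [of B "A u - \<alpha> *\<^sub>R u"]
          by (simp add: p_def BP distrib_left)
      qed
      show "p (u + v) \<le> p u + p v" for u v
      proof -
        have *: "A (u + v) - \<alpha> *\<^sub>R (u + v) = (A u - \<alpha> *\<^sub>R u) + (A v - \<alpha> *\<^sub>R v)"
          by (simp add: blinfun.bilinear_simps algebra_simps)
        show ?thesis
          using norm_triangle_ineq [of "P u" "P v"]
            norm_triangle_ineq [of "A u - \<alpha> *\<^sub>R u" "A v - \<alpha> *\<^sub>R v"]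
          unfolding p_def * blinfun.add_right [of P] by linarith
      qed
      show "p (c *\<^sub>R u) = \<bar>c\<bar> * p u" for c u
      proof -
        have "A (c *\<^sub>R u) - \<alpha> *\<^sub>R (c *\<^sub>R u) = c *\<^sub>R (A u - \<alpha> *\<^sub>R u)"
          by (simp add: blinfun.bilinear_simps algebra_simps)
        then show ?thesis
          by (simp add: p_def blinfun.scaleR_right distrib_left)
      qed
      show "\<exists>u. norm u = 1 \<and> p u < e" if "0 < e" for e
      proof -
        from \<alpha> that obtain u where "norm u = 1" "norm (P u) < e / 2" "norm (A u - \<alpha> *\<^sub>R u) < e / 2"
          by (meson half_gt_zero)
        then show ?thesis
          by (intro exI [of _ u]) (simp add: p_def)
      qed
    qed (simp_all add: p_def)
    then show thesis
      using that by blast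
  qed
  define z where "z = Complex \<alpha> \<beta>"
  have z: "\<exists>u. norm u = 1 \<and> norm (P u) < e \<and> norm (T u - cop z u) < e" if "0 < e" for e
  proof -
    from \<beta> that obtain u where u: "norm u = 1" "p u < e / 2" "norm (B u - \<beta> *\<^sub>R u) < e / 2"
      by (meson half_gt_zero)
    have "T u - cop z u = (A u - \<alpha> *\<^sub>R u) + J (B u - \<beta> *\<^sub>R u)"
      by (simp add: TAB [of u] cop_apply z_def blinfun.bilinear_simps)
    then have "norm (T u - cop z u) \<le> norm (A u - \<alpha> *\<^sub>R u) + norm (B u - \<beta> *\<^sub>R u)"
      using norm_triangle_ineq [of "A u - \<alpha> *\<^sub>R u" "J (B u - \<beta> *\<^sub>R u)"] by (simp add: norm_J)
    moreover have "norm (A u - \<alpha> *\<^sub>R u) \<le> p u" "norm (P u) \<le> p u"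
      by (simp_all add: p_def)
    ultimately show ?thesis
      using u \<open>0 < e\<close> by (intro exI [of _ u]) auto
  qed
  then have "z \<in> apsp"
    unfolding apsp_def approx_null_def by (auto simp: blinfun.diff_left)
  with z that show thesis
    by blast
qed

text \<open>Every unit vector is a null vector of the operator 0, so refining these vectors produces
  a spectral value.\<close>

lemma apsp_nonempty: "apsp \<noteq> {}"
proof -
  obtain u :: 'a where "u \<noteq> 0"
    using nonzero_space by blast
  then have "norm ((1 / norm u) *\<^sub>R u) = 1"
    by simp
  then have "approx_null (0 :: 'a \<Rightarrow>\<^sub>L 'a)"
    unfolding approx_null_def by (metis norm_zero zero_blinfun.rep_eq)
  moreover have "commutant 0"
    using commutant_cop [of 0] by (simp add: cop_0)
  ultimately show ?thesis
    using joint_approximate_spectrum [of 0] by blast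
qed

lemma norm_apsp_le:
  assumes "z \<in> apsp"
  shows "cmod z \<le> norm T"
proof (rule field_le_epsilon)
  fix e :: real assume "0 < e"
  then obtain u where u: "norm u = 1" "norm (T u - cop z u) < e"
    using apspD [OF assms] by blast
  have "cmod z = norm (cop z u)"
    by (simp add: norm_cop_apply u)
  also have "\<dots> \<le> norm (T u) + norm (T u - cop z u)"
    using norm_triangle_ineq4 [of "T u" "T u - cop z u"] by simp
  also have "\<dots> \<le> norm T + e"
    using norm_blinfun [of T u] u by simp
  finally show "cmod z \<le> norm T + e" .
qed

lemma compact_apsp: "compact apsp"
proof -
  have "closed apsp"
    unfolding closed_sequential_limits
  proof (intro allI impI, elim conjE)
    fix x l assume x: "\<forall>n. x n \<in> apsp" and lim: "x \<longlonglongrightarrow> l"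
    show "l \<in> apsp"
      unfolding apsp_def approx_null_def mem_Collect_eq
    proof (intro allI impI)
      fix e :: real assume e: "0 < e"
      then obtain n where n: "cmod (x n - l) < e / 2"
        using LIMSEQ_D [OF lim, of "e / 2"] by (metis half_gt_zero order_refl)
      from x e obtain u where u: "norm u = 1" "norm (T u - cop (x n) u) < e / 2"
        using apspD [of "x n" "e / 2"] by auto
      have "(T - cop l) u = (T u - cop (x n) u) + cop (x n - l) u"
        by (simp add: cop_diff blinfun.diff_left)
      then have "norm ((T - cop l) u) \<le> norm (T u - cop (x n) u) + cmod (x n - l)"
        using norm_triangle_ineq [of "T u - cop (x n) u" "cop (x n - l) u"]
        by (simp add: norm_cop_apply u)
      then show "\<exists>u. norm u = 1 \<and> norm ((T - cop l) u) < e"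
        using u n by (intro exI [of _ u]) auto
    qed
  qed
  moreover have "bounded apsp"
    using norm_apsp_le by (auto simp: bounded_iff)
  ultimately show ?thesis
    by (simp add: compact_eq_bounded_closed)
qed

subsection \<open>The calculus\<close>

text \<open>Uniform form of: approximate eigenvectors of \<open>T\<close> at \<open>z\<close> are
  approximate eigenvectors of \<open>P\<close> at \<open>w\<close>. It determines \<open>w\<close>
  for \<open>z\<close> in \<open>apsp\<close> and is vacuous elsewhere.\<close>

definition local_value :: "complex \<Rightarrow> complex \<Rightarrow> ('a \<Rightarrow>\<^sub>L 'a) \<Rightarrow> bool" where
  "local_value z w P \<longleftrightarrow> (\<forall>e>0. \<exists>d>0. \<forall>u. norm u = 1 \<longrightarrow> norm (T u - cop z u) < d \<longrightarrow>
     norm (P u - cop w u) < e)"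

lemma local_valueE:
  assumes "local_value z w P" "0 < e"
  obtains d where "0 < d"
    "\<And>u. norm u = 1 \<Longrightarrow> norm (T u - cop z u) < d \<Longrightarrow> norm (P u - cop w u) < e"
  using assms unfolding local_value_def by blast

lemma local_value_le:
  assumes "local_value z w P" "z \<in> apsp"
  shows "cmod w \<le> norm P"
proof (rule field_le_epsilon)
  fix e :: real assume "0 < e"
  then obtain d where "0 < d" and d: "\<And>u. norm u = 1 \<Longrightarrow> norm (T u - cop z u) < d \<Longrightarrow> norm (P u - cop w u) < e"
    using assms(1) unfolding local_value_def by blast
  then obtain u where u: "norm u = 1" "norm (P u - cop w u) < e"
    using apspD [OF assms(2) \<open>0 < d\<close>] d by blast
  have "cmod w = norm (cop w u)"
    by (simp add: norm_cop_apply u)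
  also have "\<dots> \<le> norm (P u) + norm (P u - cop w u)"
    using norm_triangle_ineq4 [of "P u" "P u - cop w u"] by simp
  also have "\<dots> \<le> norm P + e"
    using norm_blinfun [of P u] u by simp
  finally show "cmod w \<le> norm P + e" .
qed

lemma local_value_cop: "local_value z w (cop w)"
  unfolding local_value_def by (auto intro: exI [of _ 1])

lemma local_value_T: "local_value z z T"
  unfolding local_value_def by blast

lemma local_value_adj_T: "local_value z (cnj z) (adj T)"
  unfolding local_value_def norm_adj_shift [OF commutant_T normal_T] by blast

lemma local_value_add:
  assumes "local_value z v P" "local_value z w Q"
  shows "local_value z (v + w) (P + Q)"
  unfolding local_value_def
proof (intro allI impI)
  fix e :: real assume "0 < e"
  then have e2: "0 < e / 2"
    by simp
  obtain d1 where d1: "0 < d1"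
    "\<And>u. norm u = 1 \<Longrightarrow> norm (T u - cop z u) < d1 \<Longrightarrow> norm (P u - cop v u) < e / 2"
    using local_valueE [OF assms(1) e2] by blast
  obtain d2 where d2: "0 < d2"
    "\<And>u. norm u = 1 \<Longrightarrow> norm (T u - cop z u) < d2 \<Longrightarrow> norm (Q u - cop w u) < e / 2"
    using local_valueE [OF assms(2) e2] by blast
  have "norm ((P + Q) u - cop (v + w) u) < e" if "norm u = 1" "norm (T u - cop z u) < min d1 d2" for u
  proof -
    have "(P + Q) u - cop (v + w) u = (P u - cop v u) + (Q u - cop w u)"
      by (simp add: cop_add blinfun.add_left)
    then show ?thesis
      using norm_triangle_lt [of "P u - cop v u" "Q u - cop w u" e] d1(2) [of u] d2(2) [of u] that
      by simp
  qed
  with d1(1) d2(1) show "\<exists>d>0. \<forall>u. norm u = 1 \<longrightarrow> norm (T u - cop z u) < d \<longrightarrow> norm ((P + Q) u - cop (v + w) u) < e"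
    by (intro exI [of _ "min d1 d2"]) auto
qed

lemma local_value_compose:
  assumes "local_value z v P" "local_value z w Q" and P: "commutant P"
  shows "local_value z (v * w) (P o\<^sub>L Q)"
  unfolding local_value_def
proof (intro allI impI)
  fix e :: real assume e: "0 < e"
  define M where "M = norm P + cmod w + 1"
  have M: "0 < M"
    by (simp add: M_def add_nonneg_pos)
  with e have eM: "0 < e / M"
    by simp
  obtain d1 where d1: "0 < d1"
    "\<And>u. norm u = 1 \<Longrightarrow> norm (T u - cop z u) < d1 \<Longrightarrow> norm (P u - cop v u) < e / M"
    using local_valueE [OF assms(1) eM] by blast
  obtain d2 where d2: "0 < d2"
    "\<And>u. norm u = 1 \<Longrightarrow> norm (T u - cop z u) < d2 \<Longrightarrow> norm (Q u - cop w u) < e / M"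
    using local_valueE [OF assms(2) eM] by blast
  have "norm ((P o\<^sub>L Q) u - cop (v * w) u) < e" if u: "norm u = 1" "norm (T u - cop z u) < min d1 d2" for u
  proof -
    \<comment> \<open>\<open>P\<close> commutes with complex scalars, so the error splits into
      \<open>P\<close> applied to the error of \<open>Q\<close> and \<open>w\<close> times the error
      of \<open>P\<close>.\<close>
    have "(P o\<^sub>L Q) u - cop (v * w) u = P (Q u - cop w u) + cop w (P u - cop v u)"
      by (simp add: blinfun.diff_right commutantD [OF P] mult.commute [of v w] flip: cop_mult)
    then have "norm ((P o\<^sub>L Q) u - cop (v * w) u)
        \<le> norm P * norm (Q u - cop w u) + cmod w * norm (P u - cop v u)"
      by (simp only:) (intro norm_triangle_mono norm_blinfun order_eq_refl norm_cop_apply)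
    also have "\<dots> \<le> norm P * (e / M) + cmod w * (e / M)"
      using d1(2) [of u] d2(2) [of u] u by (intro add_mono mult_left_mono) auto
    also have "\<dots> < M * (e / M)"
      unfolding distrib_right [symmetric] using M e by (intro mult_strict_right_mono) (auto simp: M_def)
    finally show ?thesis
      using M by simp
  qed
  with d1(1) d2(1) show "\<exists>d>0. \<forall>u. norm u = 1 \<longrightarrow> norm (T u - cop z u) < d \<longrightarrow> norm ((P o\<^sub>L Q) u - cop (v * w) u) < e"
    by (intro exI [of _ "min d1 d2"]) auto
qed

text \<open>\<open>calculus \<phi> P\<close> expresses that \<open>P\<close> is \<open>\<phi>(T)\<close>; only the values of \<open>\<phi>\<close> on \<^const>\<open>apsp\<close> matter.\<close>

definition calculus :: "(complex \<Rightarrow> complex) \<Rightarrow> ('a \<Rightarrow>\<^sub>L 'a) \<Rightarrow> bool" where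
  "calculus \<phi> P \<longleftrightarrow> commutant P \<and>
     (\<forall>z\<in>apsp. local_value z (\<phi> z) P \<and> local_value z (cnj (\<phi> z)) (adj P))"

lemma calculus_commutant: "calculus \<phi> P \<Longrightarrow> commutant P"
  by (simp add: calculus_def)

lemma calculus_bounded_ops: "calculus \<phi> P \<Longrightarrow> P \<in> bounded_ops"
  by (simp add: calculus_def commutantD)

lemma calculus_cong: "calculus \<phi> P \<Longrightarrow> (\<And>z. z \<in> apsp \<Longrightarrow> \<phi> z = \<psi> z) \<Longrightarrow> calculus \<psi> P"
  by (simp add: calculus_def)

lemma calculus_const: "calculus (\<lambda>_. c) (cop c)"
  by (simp add: calculus_def commutant_cop local_value_cop adj_cop)

lemma calculus_id: "calculus (\<lambda>z. z) T"
  by (simp add: calculus_def commutant_T local_value_T local_value_adj_T)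

text \<open>Immediate because \<open>calculus\<close> records the values of the adjoint too.
  Normality of \<open>P\<close> could not be used here: \<open>calculus_normal\<close> derives it
  from uniqueness.\<close>

lemma calculus_adj: "calculus \<phi> P \<Longrightarrow> calculus (\<lambda>z. cnj (\<phi> z)) (adj P)"
  by (simp add: calculus_def commutant_adj adj_adj commutantD(1))

lemma calculus_add: "calculus \<phi> P \<Longrightarrow> calculus \<psi> Q \<Longrightarrow> calculus (\<lambda>z. \<phi> z + \<psi> z) (P + Q)"
  by (simp add: calculus_def commutant_add adj_add commutantD(1) local_value_add)

lemma calculus_compose:
  assumes "calculus \<phi> P" "calculus \<psi> Q"
  shows "calculus (\<lambda>z. \<phi> z * \<psi> z) (P o\<^sub>L Q)"
proof -
  have B: "P \<in> bounded_ops" "Q \<in> bounded_ops"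
    using assms by (auto dest: calculus_bounded_ops)
  have "local_value z (cnj (\<psi> z) * cnj (\<phi> z)) (adj Q o\<^sub>L adj P)" if "z \<in> apsp" for z
    using assms that by (intro local_value_compose commutant_adj) (auto simp: calculus_def)
  then show ?thesis
    using assms B
    by (simp add: calculus_def commutant_compose local_value_compose adj_compose mult.commute)
qed

lemma calculus_mult_const: "calculus \<phi> P \<Longrightarrow> calculus (\<lambda>z. c * \<phi> z) (cop c o\<^sub>L P)"
  by (rule calculus_compose [OF calculus_const])

lemma calculus_diff:
  assumes "calculus \<phi> P" "calculus \<psi> Q"
  shows "calculus (\<lambda>z. \<phi> z - \<psi> z) (P - Q)"
proof -
  have "calculus (\<lambda>z. \<phi> z + (-1) * \<psi> z) (P + (cop (-1) o\<^sub>L Q))"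
    by (intro calculus_add calculus_mult_const assms)
  moreover have "P + (cop (-1) o\<^sub>L Q) = P - Q"
    by (rule blinfun_eqI) (simp add: cop_apply blinfun.bilinear_simps)
  ultimately show ?thesis
    by simp
qed

section \<open>Spectral mapping and norm\<close>

text \<open>Let \<open>l\<close> be the square of \<open>norm P\<close>. If
  \<open>adj P o\<^sub>L P\<close> minus \<open>l\<close> were bounded below by \<open>c\<close>,
  expanding the square of its norm would give \<open>(norm (P u))^2\<close> \<le>
  \<open>(l - c^2 / l) * (norm u)^2\<close>, so \<open>P\<close> would have norm below
  \<open>norm P\<close>.\<close>

lemma approx_null_adj_compose:
  fixes P :: "'a \<Rightarrow>\<^sub>L 'a"
  assumes P: "P \<in> bounded_ops"
  shows "approx_null ((adj P o\<^sub>L P) - (norm P)\<^sup>2 *\<^sub>R id_blinfun)"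
proof (rule ccontr)
  define l where "l = (norm P)\<^sup>2"
  assume "\<not> ?thesis"
  then obtain c where c: "0 < c" "\<And>u. c * norm u \<le> norm (((adj P o\<^sub>L P) - l *\<^sub>R id_blinfun) u)"
    unfolding l_def using not_approx_nullE by blast
  have le: "c\<^sup>2 * (norm u)\<^sup>2 + l * (norm (P u))\<^sup>2 \<le> l\<^sup>2 * (norm u)\<^sup>2" for u
  proof -
    have "norm (adj P (P u)) \<le> norm P * norm (P u)"
      using order_trans [OF norm_blinfun [of "adj P" "P u"]]
        mult_right_mono [OF norm_adj_le [OF P] norm_ge_zero] by blast
    then have "(norm (adj P (P u)))\<^sup>2 \<le> (norm P * norm (P u))\<^sup>2"
      by (rule power_mono) simp
    then have 1: "(norm (adj P (P u)))\<^sup>2 \<le> l * (norm (P u))\<^sup>2"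
      by (simp add: l_def power_mult_distrib)
    have "(c * norm u)\<^sup>2 \<le> (norm (adj P (P u) - l *\<^sub>R u))\<^sup>2"
      using c(2) [of u] c(1) by (intro power_mono) (simp_all add: blinfun.bilinear_simps)
    also have "\<dots> = (norm (adj P (P u)))\<^sup>2 - 2 * l * inner (adj P (P u)) u + l\<^sup>2 * (norm u)\<^sup>2"
    proof -
      have "(norm (w - l *\<^sub>R u))\<^sup>2 = (norm w)\<^sup>2 - 2 * l * inner w u + l\<^sup>2 * (norm u)\<^sup>2" for w
        unfolding power2_norm_eq_inner
        by (simp add: inner_diff_left inner_diff_right inner_commute [of u w] power2_eq_square algebra_simps)
      then show ?thesis .
    qed
    also have "inner (adj P (P u)) u = (norm (P u))\<^sup>2"
      by (simp add: inner_adj_left [OF P] dot_square_norm)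
    finally show ?thesis
      using 1 by (simp add: power_mult_distrib)
  qed
  show False
  proof (cases "P = 0")
    \<comment> \<open>The bound divides by \<open>l\<close>, so \<open>P = 0\<close> is separate:
      there the inequality itself fails at any nonzero vector.\<close>
    case True
    then have l0: "l = 0"
      by (simp add: l_def)
    obtain u :: 'a where "u \<noteq> 0"
      using nonzero_space by blast
    then show False
      using le [of u] c(1) unfolding l0 by (simp add: mult_le_0_iff)
  next
    case False
    then have l: "0 < l"
      by (simp add: l_def)
    define b where "b = l - c\<^sup>2 / l"
    have Pb: "(norm (P u))\<^sup>2 \<le> b * (norm u)\<^sup>2" for u
    proof -
      have "l * b = l\<^sup>2 - c\<^sup>2"
        using l by (simp add: b_def right_diff_distrib power2_eq_square)
      then have "l * (b * (norm u)\<^sup>2) = l\<^sup>2 * (norm u)\<^sup>2 - c\<^sup>2 * (norm u)\<^sup>2"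
        unfolding mult.assoc [symmetric] by (simp only: left_diff_distrib)
      then have "l * (norm (P u))\<^sup>2 \<le> l * (b * (norm u)\<^sup>2)"
        using le [of u] by linarith
      then show ?thesis
        using l by simp
    qed
    obtain u :: 'a where "u \<noteq> 0"
      using nonzero_space by blast
    then have "0 \<le> b"
      using order_trans [OF zero_le_power2 Pb [of u]] by (simp add: zero_le_mult_iff)
    have "norm P \<le> sqrt b"
    proof (rule norm_blinfun_bound)
      fix u
      have "sqrt ((norm (P u))\<^sup>2) \<le> sqrt (b * (norm u)\<^sup>2)"
        by (intro real_sqrt_le_mono Pb)
      then show "norm (P u) \<le> sqrt b * norm u"
        by (simp add: real_sqrt_mult)
    qed (simp add: \<open>0 \<le> b\<close>)
    then have "l \<le> (sqrt b)\<^sup>2"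
      unfolding l_def by (rule power_mono) simp
    then have "c\<^sup>2 / l \<le> 0"
      using \<open>0 \<le> b\<close> by (simp add: b_def)
    then show False
      using c(1) l by (simp add: divide_le_0_iff)
  qed
qed

lemma calculus_norm_ge: "calculus \<phi> P \<Longrightarrow> z \<in> apsp \<Longrightarrow> cmod (\<phi> z) \<le> norm P"
  using local_value_le by (auto simp: calculus_def)

text \<open>Spectral mapping. Approximate null vectors of \<open>P - cop w\<close> can be refined to
  approximate eigenvectors of \<open>T\<close> at some \<open>z\<close>; there \<open>P\<close> acts
  almost as \<phi> z, which forces \<open>w\<close> = \<phi> z.\<close>

lemma calculus_spectrum:
  assumes "calculus \<phi> P"
  shows "approx_null (P - cop w) \<longleftrightarrow> w \<in> \<phi> ` apsp"
proof
  assume "approx_null (P - cop w)"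
  moreover have "commutant (P - cop w)"
    using assms by (intro commutant_diff commutant_cop calculus_commutant)
  ultimately obtain z where z: "z \<in> apsp"
    "\<And>e. 0 < e \<Longrightarrow> \<exists>u. norm u = 1 \<and> norm ((P - cop w) u) < e \<and> norm (T u - cop z u) < e"
    using joint_approximate_spectrum by blast
  have "cmod (\<phi> z - w) \<le> 0"
  proof (rule field_le_epsilon)
    fix e :: real assume e: "0 < e"
    obtain d where "0 < d" and
      d: "\<And>u. norm u = 1 \<Longrightarrow> norm (T u - cop z u) < d \<Longrightarrow> norm (P u - cop (\<phi> z) u) < e / 2"
      using assms z(1) half_gt_zero [OF e] unfolding calculus_def local_value_def by blast
    with e have "0 < min d (e / 2)"
      by simp
    from z(2) [OF this] obtain u where
      u: "norm u = 1" "norm (P u - cop w u) < e / 2" "norm (T u - cop z u) < d"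
      by (auto simp: blinfun.diff_left)
    have "cmod (\<phi> z - w) = norm ((P u - cop w u) - (P u - cop (\<phi> z) u))"
      using norm_cop_apply [of "\<phi> z - w" u] u(1) by (simp add: cop_diff blinfun.diff_left)
    also have "\<dots> \<le> norm (P u - cop w u) + norm (P u - cop (\<phi> z) u)"
      by (rule norm_triangle_ineq4)
    also have "\<dots> \<le> 0 + e"
      using u(2) d [OF u(1,3)] by simp
    finally show "cmod (\<phi> z - w) \<le> 0 + e" .
  qed
  then show "w \<in> \<phi> ` apsp"
    using z(1) by auto
next
  assume "w \<in> \<phi> ` apsp"
  then obtain z where z: "z \<in> apsp" "w = \<phi> z"
    by blast
  show "approx_null (P - cop w)"
    unfolding approx_null_def
  proof (intro allI impI)
    fix e :: real assume "0 < e"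
    then obtain d where "0 < d" and
      d: "\<And>u. norm u = 1 \<Longrightarrow> norm (T u - cop z u) < d \<Longrightarrow> norm (P u - cop (\<phi> z) u) < e"
      using assms z(1) unfolding calculus_def local_value_def by blast
    then show "\<exists>u. norm u = 1 \<and> norm ((P - cop w) u) < e"
      using apspD [OF z(1) \<open>0 < d\<close>] z(2) by (metis minus_blinfun.rep_eq)
  qed
qed

text \<open>The square of \<open>norm P\<close> is an approximate eigenvalue of
  \<open>adj P o\<^sub>L P\<close>, whose function is the squared modulus of \<phi>; by spectral
  mapping it is a value of that function on \<open>apsp\<close>.\<close>

lemma calculus_norm_attained:
  assumes "calculus \<phi> P"
  shows "\<exists>z\<in>apsp. norm P = cmod (\<phi> z)"
proof -
  have "calculus (\<lambda>z. cnj (\<phi> z) * \<phi> z) (adj P o\<^sub>L P)"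
    by (intro calculus_compose calculus_adj assms)
  moreover have "approx_null ((adj P o\<^sub>L P) - cop (of_real ((norm P)\<^sup>2)))"
    unfolding cop_of_real by (rule approx_null_adj_compose [OF calculus_bounded_ops [OF assms]])
  ultimately obtain z where z: "z \<in> apsp" "of_real ((norm P)\<^sup>2) = cnj (\<phi> z) * \<phi> z"
    using calculus_spectrum by blast
  then have "complex_of_real ((norm P)\<^sup>2) = of_real ((cmod (\<phi> z))\<^sup>2)"
    by (simp add: complex_norm_square mult.commute del: of_real_power)
  then have "(norm P)\<^sup>2 = (cmod (\<phi> z))\<^sup>2"
    by (simp only: of_real_eq_iff)
  then show ?thesis
    using z(1) by auto
qed

lemma calculus_norm_le:
  assumes "calculus \<phi> P" "\<And>z. z \<in> apsp \<Longrightarrow> cmod (\<phi> z) \<le> c"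
  shows "norm P \<le> c"
  using calculus_norm_attained [OF assms(1)] assms(2) by auto

lemma calculus_eq_0_iff:
  assumes "calculus \<phi> P"
  shows "P = 0 \<longleftrightarrow> (\<forall>z\<in>apsp. \<phi> z = 0)"
  using calculus_norm_attained [OF assms] calculus_norm_ge [OF assms] by force

lemma calculus_unique:
  assumes "calculus \<phi> P" "calculus \<phi> Q"
  shows "P = Q"
  using calculus_eq_0_iff [OF calculus_diff [OF assms]] by simp

lemma calculus_normal:
  assumes "calculus \<phi> P"
  shows "normal_op P"
proof -
  have "calculus (\<lambda>z. \<phi> z * cnj (\<phi> z)) (P o\<^sub>L adj P)"
    by (intro calculus_compose calculus_adj assms)
  moreover have "calculus (\<lambda>z. \<phi> z * cnj (\<phi> z)) (adj P o\<^sub>L P)"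
    by (subst mult.commute) (intro calculus_compose calculus_adj assms)
  ultimately show ?thesis
    unfolding normal_op_def by (rule calculus_unique)
qed

section \<open>Limits and existence of the calculus\<close>

lemma local_value_limit:
  assumes close: "\<And>e. 0 < e \<Longrightarrow> \<exists>v Q. local_value z v Q \<and> norm (P - Q) < e \<and> cmod (w - v) < e"
  shows "local_value z w P"
  unfolding local_value_def
proof (intro allI impI)
  fix e :: real assume e: "0 < e"
  then obtain v Q where v: "local_value z v Q" "norm (P - Q) < e / 3" "cmod (w - v) < e / 3"
    using close [of "e / 3"] by auto
  from v(1) e obtain d where "0 < d" and
    d: "\<And>u. norm u = 1 \<Longrightarrow> norm (T u - cop z u) < d \<Longrightarrow> norm (Q u - cop v u) < e / 3"
    using local_valueE [OF v(1), of "e / 3"] by auto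
  moreover have "norm (P u - cop w u) < e" if u: "norm u = 1" "norm (T u - cop z u) < d" for u
  proof -
    have "P u - cop w u = (P - Q) u + (Q u - cop v u) - cop (w - v) u"
      by (simp add: cop_diff blinfun.diff_left)
    then have "norm (P u - cop w u) \<le> norm ((P - Q) u) + norm (Q u - cop v u) + norm (cop (w - v) u)"
      using norm_triangle_ineq4 [of "(P - Q) u + (Q u - cop v u)" "cop (w - v) u"]
        norm_triangle_ineq [of "(P - Q) u" "Q u - cop v u"] by (simp only:)
    moreover have "norm ((P - Q) u) < e / 3" "norm (cop (w - v) u) < e / 3"
      using norm_blinfun [of "P - Q" u] v u(1) by (simp_all add: norm_cop_apply)
    ultimately show ?thesis
      using d [OF u] by linarith
  qed
  ultimately show "\<exists>d>0. \<forall>u. norm u = 1 \<longrightarrow> norm (T u - cop z u) < d \<longrightarrow> norm (P u - cop w u) < e"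
    by blast
qed

text \<open>Norms in the calculus are suprema over \<open>apsp\<close>, so uniformly close functions
  have close operators and the approximants form a Cauchy sequence. The commutant is closed, and
  local values of the operator and of its adjoint survive the limit.\<close>

lemma calculus_uniform_limit:
  assumes "\<And>e. 0 < e \<Longrightarrow> \<exists>\<psi> Q. calculus \<psi> Q \<and> (\<forall>z\<in>apsp. cmod (\<phi> z - \<psi> z) \<le> e)"
  shows "\<exists>P. calculus \<phi> P"
proof -
  have "\<exists>\<psi> Q. calculus \<psi> Q \<and> (\<forall>z\<in>apsp. cmod (\<phi> z - \<psi> z) \<le> inverse (real (Suc n)))" for n
    by (rule assms) simp
  then obtain \<psi> Q where Q: "\<And>n. calculus (\<psi> n) (Q n)"
    and \<psi>: "\<And>n z. z \<in> apsp \<Longrightarrow> cmod (\<phi> z - \<psi> n z) \<le> inverse (real (Suc n))"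
    by metis
  have QQ: "norm (Q m - Q n) \<le> inverse (real (Suc m)) + inverse (real (Suc n))" for m n
  proof (rule calculus_norm_le [OF calculus_diff [OF Q Q]])
    fix z assume z: "z \<in> apsp"
    show "cmod (\<psi> m z - \<psi> n z) \<le> inverse (real (Suc m)) + inverse (real (Suc n))"
      using norm_triangle_ineq4 [of "\<phi> z - \<psi> n z" "\<phi> z - \<psi> m z"] \<psi> [OF z, of m] \<psi> [OF z, of n]
      by (simp del: of_nat_Suc)
  qed
  have small: "\<exists>N. \<forall>n\<ge>N. inverse (real (Suc n)) < e" if "0 < e" for e :: real
    using order_tendstoD(2) [OF LIMSEQ_inverse_real_of_nat that] by (simp add: eventually_sequentially)
  have "Cauchy Q"
  proof (rule CauchyI)
    fix e :: real assume "0 < e"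
    then obtain N where N: "\<And>n. N \<le> n \<Longrightarrow> inverse (real (Suc n)) < e / 2"
      using small [of "e / 2"] by auto
    have "norm (Q m - Q n) < e" if "N \<le> m" "N \<le> n" for m n
      using QQ [of m n] N [OF that(1)] N [OF that(2)] by linarith
    then show "\<exists>M. \<forall>m\<ge>M. \<forall>n\<ge>M. norm (Q m - Q n) < e"
      by blast
  qed
  then obtain P where P: "Q \<longlonglongrightarrow> P"
    using Cauchy_convergent convergent_def by blast
  have P_comm: "commutant P"
    by (rule commutant_limit [OF calculus_commutant [OF Q] P])
  have close: "\<exists>n. norm (P - Q n) < e \<and> (\<forall>z\<in>apsp. cmod (\<phi> z - \<psi> n z) < e)" if e: "0 < e" for e
  proof -
    obtain N1 where N1: "\<And>n. N1 \<le> n \<Longrightarrow> norm (Q n - P) < e"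
      using LIMSEQ_D [OF P e] by blast
    obtain N2 where N2: "\<And>n. N2 \<le> n \<Longrightarrow> inverse (real (Suc n)) < e"
      using small [OF e] by blast
    show ?thesis
    proof (intro exI [of _ "max N1 N2"] conjI ballI)
      show "norm (P - Q (max N1 N2)) < e"
        using N1 [of "max N1 N2"] by (simp add: norm_minus_commute)
      show "cmod (\<phi> z - \<psi> (max N1 N2) z) < e" if "z \<in> apsp" for z
        by (rule order_le_less_trans [OF \<psi> [OF that] N2]) simp
    qed
  qed
  have "local_value z (\<phi> z) P" "local_value z (cnj (\<phi> z)) (adj P)" if z: "z \<in> apsp" for z
  proof -
    show "local_value z (\<phi> z) P"
    proof (rule local_value_limit)
      fix e :: real assume "0 < e"
      then obtain n where "norm (P - Q n) < e" "cmod (\<phi> z - \<psi> n z) < e"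
        using close z by blast
      then show "\<exists>v Q. local_value z v Q \<and> norm (P - Q) < e \<and> cmod (\<phi> z - v) < e"
        using Q [of n] z unfolding calculus_def by blast
    qed
    show "local_value z (cnj (\<phi> z)) (adj P)"
    proof (rule local_value_limit)
      fix e :: real assume "0 < e"
      then obtain n where n: "norm (P - Q n) < e" "cmod (\<phi> z - \<psi> n z) < e"
        using close z by blast
      have B: "P \<in> bounded_ops" "Q n \<in> bounded_ops"
        using commutantD(1) [OF P_comm] calculus_bounded_ops [OF Q] by auto
      have "norm (adj P - adj (Q n)) \<le> norm (P - Q n)"
        using norm_adj_le [OF bounded_ops_diff [OF B]] by (simp add: adj_diff [OF B])
      moreover have "cmod (cnj (\<phi> z) - cnj (\<psi> n z)) = cmod (\<phi> z - \<psi> n z)"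
        by (metis complex_cnj_diff complex_mod_cnj)
      ultimately show "\<exists>v Q. local_value z v Q \<and> norm (adj P - Q) < e \<and> cmod (cnj (\<phi> z) - v) < e"
        using Q [of n] z n unfolding calculus_def
        by (intro exI [of _ "cnj (\<psi> n z)"] exI [of _ "adj (Q n)"]) auto
    qed
  qed
  with P_comm show ?thesis
    by (auto simp: calculus_def)
qed

lemma calculus_real_polynomial:
  assumes "real_polynomial_function (p :: complex \<Rightarrow> real)"
  shows "\<exists>P. calculus (\<lambda>z. of_real (p z)) P"
  using assms
proof induction
  case (linear f)
  interpret bounded_linear f by fact
  \<comment> \<open>Real and imaginary part of \<open>z\<close>, written through \<open>z\<close>
    and \<open>cnj z\<close>, the functions of \<open>T\<close> and \<open>adj T\<close>.\<close>
  have *: "of_real (f 1) * ((1/2) * (z + cnj z)) + of_real (f \<i>) * ((- \<i> / 2) * (z - cnj z)) = of_real (f z)" for z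
  proof -
    have "f z = Re z * f 1 + Im z * f \<i>"
    proof -
      have "z = Re z *\<^sub>R 1 + Im z *\<^sub>R \<i>"
        by (simp add: complex_eq_iff)
      then have "f z = f (Re z *\<^sub>R 1 + Im z *\<^sub>R \<i>)"
        by (rule arg_cong)
      then show ?thesis
        by (simp add: add scaleR)
    qed
    then show ?thesis
      by (simp add: complex_eq_iff)
  qed
  have "calculus (\<lambda>z. of_real (f 1) * ((1/2) * (z + cnj z)) + of_real (f \<i>) * ((- \<i> / 2) * (z - cnj z)))
      ((cop (of_real (f 1)) o\<^sub>L (cop (1/2) o\<^sub>L (T + adj T))) +
       (cop (of_real (f \<i>)) o\<^sub>L (cop (- \<i> / 2) o\<^sub>L (T - adj T))))"
    by (intro calculus_add calculus_mult_const calculus_diff calculus_id calculus_adj)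
  from calculus_cong [OF this *] show ?case
    by blast
next
  case (const c)
  show ?case
    using calculus_const [of "of_real c"] by (rule exI)
next
  case (add f g)
  then obtain P Q where "calculus (\<lambda>z. of_real (f z)) P" "calculus (\<lambda>z. of_real (g z)) Q"
    by auto
  from calculus_add [OF this] show ?case
    by (intro exI) simp
next
  case (mult f g)
  then obtain P Q where "calculus (\<lambda>z. of_real (f z)) P" "calculus (\<lambda>z. of_real (g z)) Q"
    by auto
  from calculus_compose [OF this] show ?case
    by (intro exI) simp
qed

lemma calculus_exists:
  assumes "continuous_on apsp \<phi>"
  shows "\<exists>P. calculus \<phi> P"
proof (rule calculus_uniform_limit)
  fix e :: real assume e: "0 < e"
  obtain p where p: "real_polynomial_function p" "\<And>z. z \<in> apsp \<Longrightarrow> \<bar>Re (\<phi> z) - p z\<bar> < e / 2"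
    using Stone_Weierstrass_real_polynomial_function [OF compact_apsp continuous_on_Re [OF assms] half_gt_zero [OF e]]
    by metis
  obtain q where q: "real_polynomial_function q" "\<And>z. z \<in> apsp \<Longrightarrow> \<bar>Im (\<phi> z) - q z\<bar> < e / 2"
    using Stone_Weierstrass_real_polynomial_function [OF compact_apsp continuous_on_Im [OF assms] half_gt_zero [OF e]]
    by metis
  obtain P Q where "calculus (\<lambda>z. of_real (p z)) P" "calculus (\<lambda>z. of_real (q z)) Q"
    using calculus_real_polynomial p(1) q(1) by blast
  then have "calculus (\<lambda>z. of_real (p z) + \<i> * of_real (q z)) (P + (cop \<i> o\<^sub>L Q))"
    by (intro calculus_add calculus_mult_const)
  moreover have "cmod (\<phi> z - (of_real (p z) + \<i> * of_real (q z))) \<le> e" if z: "z \<in> apsp" for z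
    using cmod_le [of "\<phi> z - (of_real (p z) + \<i> * of_real (q z))"] p(2) [OF z] q(2) [OF z] by simp
  ultimately show "\<exists>\<psi> Q. calculus \<psi> Q \<and> (\<forall>z\<in>apsp. cmod (\<phi> z - \<psi> z) \<le> e)"
    by blast
qed

subsection \<open>Spherical spectrum\<close>

text \<open>The two complex factors of \<open>Delta_op q P\<close> commute, so it has approximate
  null vectors iff one of them has; being normal itself, it is then non-invertible exactly in that
  case.\<close>

lemma spherical_spectrum_iff:
  assumes P: "commutant P" "normal_op P" and "\<iota> \<in> imag_units"
  shows "of_real \<alpha> + \<iota> * of_real \<beta> \<in> spherical_spectrum P \<longleftrightarrow>
    approx_null (P - cop (Complex \<alpha> \<beta>)) \<or> approx_null (P - cop (Complex \<alpha> (- \<beta>)))"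
proof -
  define w where "w = Complex \<alpha> \<beta>"
  define q :: quat where "q = of_real \<alpha> + \<iota> * of_real \<beta>"
  have i: "qRe \<iota> = 0" "(qI \<iota>)\<^sup>2 + (qJ \<iota>)\<^sup>2 + (qK \<iota>)\<^sup>2 = 1"
    using assms(3) by (simp_all add: imag_units_iff)
  have "(norm q)\<^sup>2 = \<alpha>\<^sup>2 + ((qI \<iota>)\<^sup>2 + (qJ \<iota>)\<^sup>2 + (qK \<iota>)\<^sup>2) * \<beta>\<^sup>2"
    by (simp add: q_def norm_quat_def i(1) power_mult_distrib distrib_right)
  then have nq: "(norm q)\<^sup>2 = \<alpha>\<^sup>2 + \<beta>\<^sup>2"
    by (simp add: i(2))
  have rq: "qRe (q + qcnj q) = \<alpha> + \<alpha>"
    by (simp add: q_def i(1))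
  have two: "(\<alpha> * 2) *\<^sub>R x = \<alpha> *\<^sub>R x + \<alpha> *\<^sub>R x" for x :: 'a
    by (simp flip: scaleR_add_left)
  have D: "Delta_op q P u = (P - cop w) ((P - cop (cnj w)) u)"
    and D': "Delta_op q P u = (P - cop (cnj w)) ((P - cop w) u)" for u
    unfolding Delta_op_def nq rq
    by (simp_all add: cop_apply w_def blinfun.bilinear_simps commutantD [OF P(1)] power2_eq_square
        algebra_simps two)
  have DB: "Delta_op q P \<in> bounded_ops"
    unfolding Delta_op_def by (intro bounded_ops_intros commutantD(1) [OF P(1)])
  have DN: "normal_op (Delta_op q P)"
  proof -
    have N: "P (adj P u) = adj P (P u)" for u
      using P(2) unfolding normal_op_def by (metis blinfun_apply_blinfun_compose)
    have adjD: "adj (Delta_op q P) = Delta_op q (adj P)"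
      unfolding Delta_op_def
      by (simp add: adj_add adj_diff adj_scaleR adj_compose adj_id commutantD(1) [OF P(1)] bounded_ops_intros)
    show ?thesis
      unfolding normal_op_def adjD unfolding Delta_op_def
      by (intro blinfun_eqI) (simp add: blinfun.bilinear_simps N algebra_simps)
  qed
  \<comment> \<open>Stated for a general \<open>v\<close>: the factor with null vectors must act
    first, so \<open>v = w\<close> uses \<open>D'\<close> and \<open>v = cnj w\<close> uses
    \<open>D\<close>.\<close>
  have "approx_null (Delta_op q P)" if v: "approx_null (P - cop v)"
    and D: "\<And>u. Delta_op q P u = (P - cop (cnj v)) ((P - cop v) u)" for v
    unfolding approx_null_def
  proof (intro allI impI)
    fix e :: real assume e: "0 < e"
    define M where "M = norm (P - cop (cnj v)) + 1"
    have M: "0 < M"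
      by (simp add: M_def add_nonneg_pos)
    obtain u where u: "norm u = 1" "norm ((P - cop v) u) < e / M"
      using v e M unfolding approx_null_def by (meson divide_pos_pos)
    have "norm (Delta_op q P u) \<le> M * norm ((P - cop v) u)"
      unfolding D by (rule order_trans [OF norm_blinfun]) (simp add: M_def distrib_right)
    also have "\<dots> < e"
      using u(2) M by (simp add: pos_less_divide_eq mult.commute)
    finally show "\<exists>u. norm u = 1 \<and> norm (Delta_op q P u) < e"
      using u(1) by blast
  qed
  moreover have "\<not> approx_null (Delta_op q P)"
    if w: "\<not> approx_null (P - cop w)" "\<not> approx_null (P - cop (cnj w))"
  proof
    assume null: "approx_null (Delta_op q P)"
    obtain a where a: "0 < a" "\<And>u. a * norm u \<le> norm ((P - cop w) u)"
      using not_approx_nullE [OF w(1)] by blast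
    obtain b where b: "0 < b" "\<And>u. b * norm u \<le> norm ((P - cop (cnj w)) u)"
      using not_approx_nullE [OF w(2)] by blast
    have ge: "a * b * norm u \<le> norm (Delta_op q P u)" for u
      using order_trans [OF mult_left_mono [OF b(2) less_imp_le [OF a(1)]] a(2)]
      unfolding D by (simp add: mult.assoc)
    have "0 < a * b"
      using a(1) b(1) by simp
    from approx_nullD [OF null this] ge show False
      by (meson not_le)
  qed
  ultimately have "approx_null (Delta_op q P) \<longleftrightarrow> approx_null (P - cop w) \<or> approx_null (P - cop (cnj w))"
    using D D' by (metis complex_cnj_cnj)
  moreover have "cnj w = Complex \<alpha> (- \<beta>)"
    by (simp add: w_def complex_eq_iff)
  ultimately show ?thesis
    using normal_op_invertible_iff [OF DB DN] by (simp add: spherical_spectrum_def w_def q_def)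
qed

end

section \<open>Slice planes\<close>

lemma norm_slice_form: "\<iota> \<in> imag_units \<Longrightarrow> norm (of_real a + \<iota> * of_real b) = cmod (Complex a b)"
proof -
  assume "\<iota> \<in> imag_units"
  then have i: "qRe \<iota> = 0" "(qI \<iota>)\<^sup>2 + (qJ \<iota>)\<^sup>2 + (qK \<iota>)\<^sup>2 = 1"
    by (simp_all add: imag_units_iff)
  have "(qI \<iota> * b)\<^sup>2 + (qJ \<iota> * b)\<^sup>2 + (qK \<iota> * b)\<^sup>2 = ((qI \<iota>)\<^sup>2 + (qJ \<iota>)\<^sup>2 + (qK \<iota>)\<^sup>2) * b\<^sup>2"
    by (simp add: power_mult_distrib distrib_right)
  then show ?thesis
    by (simp add: norm_quat_def cmod_def i)
qed

lemma norm_imag_unit: "\<iota> \<in> imag_units \<Longrightarrow> norm \<iota> = 1"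
  using norm_slice_form [of \<iota> 0 1] by (simp add: cmod_def)

lemma qcnj_imag_unit: "\<iota> \<in> imag_units \<Longrightarrow> qcnj \<iota> = - \<iota>"
  by (simp add: imag_units_iff quat_eq_iff)

lemma bounded_linear_qcnj: "bounded_linear qcnj"
  by (rule bounded_linear_intro [where K = 1]) (simp_all add: quat_eq_iff norm_quat_def)

lemma bounded_linear_qRe: "bounded_linear qRe"
  by (rule bounded_linear_intro [where K = 1]) (simp_all add: norm_quat_def real_le_rsqrt)

definition to_slice :: "quat \<Rightarrow> complex \<Rightarrow> quat" where
  "to_slice j z = of_real (Re z) + j * of_real (Im z)"

text \<open>For an imaginary unit \<open>j\<close>, \<open>- qRe (j * q)\<close> is the inner
  product of \<open>j\<close> and \<open>q\<close>. This is thus the orthogonal projection onto the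
  plane of \<open>j\<close> in complex coordinates: continuous on all quaternions and inverse to
  \<open>to_slice j\<close> on the plane.\<close>

definition of_slice :: "quat \<Rightarrow> quat \<Rightarrow> complex" where
  "of_slice j q = Complex (qRe q) (- qRe (j * q))"

lemma to_slice_Complex: "to_slice j (Complex a b) = of_real a + j * of_real b"
  by (simp add: to_slice_def)

lemma to_slice_of_real [simp]: "to_slice j (of_real r) = of_real r"
  by (simp add: to_slice_def)

lemma to_slice_0 [simp]: "to_slice j 0 = 0" and to_slice_1 [simp]: "to_slice j 1 = 1"
  and to_slice_ii [simp]: "to_slice j \<i> = j"
  by (simp_all add: to_slice_def)

lemma to_slice_add: "to_slice j (z + w) = to_slice j z + to_slice j w"
  by (simp add: to_slice_def algebra_simps)

lemma to_slice_minus: "to_slice j (- z) = - to_slice j z"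
  by (simp add: to_slice_def)

lemma slice_plane_eq: "slice_plane j = range (to_slice j)"
  unfolding slice_plane_def to_slice_def
  by (auto simp: image_iff) (metis complex.sel)

lemma to_slice_mem: "to_slice j z \<in> slice_plane j"
  by (simp add: slice_plane_eq)

lemma Reals_subset_slice_plane: "\<real> \<subseteq> slice_plane j"
  unfolding slice_plane_eq by (metis Reals_cases rangeI subsetI to_slice_of_real)

lemma continuous_on_to_slice: "continuous_on S (to_slice j)"
  unfolding to_slice_def by (intro continuous_intros)

lemma continuous_on_of_slice: "continuous_on S (of_slice j)"
proof -
  have "continuous_on S (\<lambda>q. qRe q)" "continuous_on S (\<lambda>q. qRe (j * q))"
    by (intro bounded_linear.continuous_on [OF bounded_linear_qRe] continuous_intros)+
  then show ?thesis
    unfolding of_slice_def by (intro continuous_on_Complex continuous_intros)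
qed

lemma of_slice_add: "of_slice j (p + q) = of_slice j p + of_slice j q"
  by (simp add: of_slice_def distrib_left complex_eq_iff)

context
  fixes j assumes j: "j \<in> imag_units"
begin

lemma to_slice_mult: "to_slice j (z * w) = to_slice j z * to_slice j w"
proof -
  have "(a + j * b) * (c + j * d) = a * c + (j * j) * (b * d) + j * (a * d + b * c)"
    if "a = of_real x" "b = of_real y" "c = of_real u" "d = of_real v" for a b c d :: quat and x y u v
    unfolding that by (simp add: quat_eq_iff algebra_simps)
  then show ?thesis
    unfolding to_slice_def imag_unit_square [OF j] by simp
qed

lemma to_slice_cnj: "to_slice j (cnj z) = qcnj (to_slice j z)"
  by (simp add: to_slice_def qcnj_imag_unit [OF j] quat_of_real_commute)

lemma norm_to_slice: "norm (to_slice j z) = cmod z"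
  using norm_slice_form [OF j, of "Re z" "Im z"] by (simp add: to_slice_def)

lemma of_slice_to_slice [simp]: "of_slice j (to_slice j z) = z"
proof -
  have "j * to_slice j z = to_slice j (\<i> * z)"
    by (simp add: to_slice_mult)
  moreover have "qRe (to_slice j w) = Re w" for w
    using j by (simp add: to_slice_def imag_units_iff)
  ultimately show ?thesis
    by (simp add: of_slice_def complex_eq_iff)
qed

lemma to_slice_of_slice: "q \<in> slice_plane j \<Longrightarrow> to_slice j (of_slice j q) = q"
  by (auto simp: slice_plane_eq)

lemma to_slice_eq_iff [simp]: "to_slice j z = to_slice j w \<longleftrightarrow> z = w"
  by (metis of_slice_to_slice)

end

section \<open>Operations on slice functions\<close>

text \<open>Closure properties common to the reals and the plane of \<open>j\<close>, so that the
  operations on slice functions are treated once for both.\<close>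

definition scalar_ring :: "quat set \<Rightarrow> bool" where
  "scalar_ring V \<longleftrightarrow> \<real> \<subseteq> V \<and> (\<forall>x\<in>V. - x \<in> V \<and> qcnj x \<in> V) \<and> (\<forall>x\<in>V. \<forall>y\<in>V. x + y \<in> V \<and> x * y \<in> V)"

lemma scalar_ring_Reals: "scalar_ring \<real>"
  unfolding scalar_ring_def by (auto simp: Reals_def simp flip: of_real_add of_real_mult of_real_minus)

lemma scalar_ring_slice_plane:
  assumes "j \<in> imag_units"
  shows "scalar_ring (slice_plane j)"
  unfolding scalar_ring_def using Reals_subset_slice_plane
  by (auto simp: slice_plane_eq simp flip: to_slice_add to_slice_mult [OF assms] to_slice_minus
      to_slice_cnj [OF assms])

lemma stem_function_mono: "stem_function K V F1 F2 \<Longrightarrow> V \<subseteq> W \<Longrightarrow> stem_function K W F1 F2"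
  by (auto simp: stem_function_def)

lemma stem_function_UNIV: "stem_function K V F1 F2 \<Longrightarrow> stem_function K UNIV F1 F2"
  by (erule stem_function_mono) simp

lemma slice_functions_mono: "V \<subseteq> W \<Longrightarrow> slice_functions K V \<subseteq> slice_functions K W"
  by (auto simp: slice_functions_def intro: stem_function_mono)

lemma slice_functionsE:
  assumes "f \<in> slice_functions K V"
  obtains F1 F2 where "stem_function K V F1 F2" "f = slice_induced K F1 F2"
  using assms by (auto simp: slice_functions_def)

lemma slice_functionsI: "stem_function K V F1 F2 \<Longrightarrow> slice_induced K F1 F2 \<in> slice_functions K V"
  by (auto simp: slice_functions_def)

lemma slice_induced_extensional: "slice_induced K F1 F2 \<in> extensional (circ K)"
  by (simp add: slice_induced_def)

lemma circI: "\<iota> \<in> imag_units \<Longrightarrow> Complex \<alpha> \<beta> \<in> K \<Longrightarrow> of_real \<alpha> + \<iota> * of_real \<beta> \<in> circ K"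
  by (auto simp: circ_def)

lemma circE:
  assumes "q \<in> circ K"
  obtains \<alpha> \<beta> \<iota> where "q = of_real \<alpha> + \<iota> * of_real \<beta>" "\<iota> \<in> imag_units" "Complex \<alpha> \<beta> \<in> K"
  using assms by (auto simp: circ_def)

lemma slice_eqI:
  assumes "f \<in> extensional (circ K)" "g \<in> extensional (circ K)"
    and "\<And>\<alpha> \<beta> \<iota>. \<iota> \<in> imag_units \<Longrightarrow> Complex \<alpha> \<beta> \<in> K \<Longrightarrow>
      f (of_real \<alpha> + \<iota> * of_real \<beta>) = g (of_real \<alpha> + \<iota> * of_real \<beta>)"
  shows "f = g"
  using assms by (intro extensionalityI [of f "circ K" g]) (auto elim!: circE)

context
  fixes V assumes V: "scalar_ring V"
begin

lemma scalar_closed: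
  "of_real r \<in> V" "0 \<in> V" "1 \<in> V" "x \<in> V \<Longrightarrow> - x \<in> V" "x \<in> V \<Longrightarrow> qcnj x \<in> V"
  "x \<in> V \<Longrightarrow> y \<in> V \<Longrightarrow> x + y \<in> V" "x \<in> V \<Longrightarrow> y \<in> V \<Longrightarrow> x * y \<in> V"
  using V unfolding scalar_ring_def by (auto simp: subset_eq)

lemma scalar_diff: "x \<in> V \<Longrightarrow> y \<in> V \<Longrightarrow> x - y \<in> V"
  using scalar_closed(6) [of x "- y"] scalar_closed(4) [of y] by simp

lemma stem_function_add:
  "stem_function K V F1 F2 \<Longrightarrow> stem_function K V G1 G2 \<Longrightarrow>
    stem_function K V (\<lambda>z. F1 z + G1 z) (\<lambda>z. F2 z + G2 z)"
  by (auto simp: stem_function_def Pi_iff scalar_closed intro!: continuous_intros)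

lemma stem_function_mult:
  "stem_function K V F1 F2 \<Longrightarrow> stem_function K V G1 G2 \<Longrightarrow>
    stem_function K V (\<lambda>z. F1 z * G1 z - F2 z * G2 z) (\<lambda>z. F1 z * G2 z + F2 z * G1 z)"
  by (auto simp: stem_function_def Pi_iff scalar_closed scalar_diff intro!: continuous_intros)

lemma stem_function_star:
  "stem_function K V F1 F2 \<Longrightarrow> stem_function K V (\<lambda>z. qcnj (F1 z)) (\<lambda>z. - qcnj (F2 z))"
  by (auto simp: stem_function_def Pi_iff scalar_closed
      intro!: continuous_intros bounded_linear.continuous_on [OF bounded_linear_qcnj])

lemma stem_function_scale:
  "stem_function K V F1 F2 \<Longrightarrow> p \<in> V \<Longrightarrow> stem_function K V (\<lambda>z. F1 z * p) (\<lambda>z. F2 z * p)"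
  by (auto simp: stem_function_def Pi_iff scalar_closed intro!: continuous_intros)

lemma stem_function_const: "p \<in> V \<Longrightarrow> stem_function K V (\<lambda>_. p) (\<lambda>_. 0)"
  by (auto simp: stem_function_def scalar_closed)

lemma stem_function_id: "stem_function K V (\<lambda>z. of_real (Re z)) (\<lambda>z. of_real (Im z))"
  by (auto simp: stem_function_def scalar_closed intro!: continuous_intros)

lemma slice_induced_add:
  assumes "stem_function K V F1 F2" "stem_function K V G1 G2"
  shows "(\<lambda>q\<in>circ K. slice_induced K F1 F2 q + slice_induced K G1 G2 q) =
    slice_induced K (\<lambda>z. F1 z + G1 z) (\<lambda>z. F2 z + G2 z)"
  using slice_induced_eq [OF assms(1)] slice_induced_eq [OF assms(2)]
    slice_induced_eq [OF stem_function_add [OF assms]]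
  by (intro slice_eqI [where K = K]) (simp_all add: slice_induced_extensional circI algebra_simps)

lemma slice_induced_scale:
  assumes "stem_function K V F1 F2" "p \<in> V"
  shows "(\<lambda>q\<in>circ K. slice_induced K F1 F2 q * p) = slice_induced K (\<lambda>z. F1 z * p) (\<lambda>z. F2 z * p)"
  using slice_induced_eq [OF assms(1)] slice_induced_eq [OF stem_function_scale [OF assms]]
  by (intro slice_eqI [where K = K]) (simp_all add: slice_induced_extensional circI algebra_simps)

lemma slice_induced_const: "p \<in> V \<Longrightarrow> (\<lambda>q\<in>circ K. p) = slice_induced K (\<lambda>_. p) (\<lambda>_. 0)"
  using slice_induced_eq [OF stem_function_const]
  by (intro slice_eqI [where K = K]) (simp_all add: slice_induced_extensional circI)

lemma slice_induced_id: "(\<lambda>q\<in>circ K. q) = slice_induced K (\<lambda>z. of_real (Re z)) (\<lambda>z. of_real (Im z))"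
  using slice_induced_eq [OF stem_function_id]
  by (intro slice_eqI [where K = K]) (simp_all add: slice_induced_extensional circI)

lemma slice_functions_add:
  assumes "f \<in> slice_functions K V" "g \<in> slice_functions K V"
  shows "(\<lambda>q\<in>circ K. f q + g q) \<in> slice_functions K V"
proof -
  obtain F1 F2 G1 G2 where "stem_function K V F1 F2" "f = slice_induced K F1 F2"
    "stem_function K V G1 G2" "g = slice_induced K G1 G2"
    using assms by (metis slice_functionsE)
  then show ?thesis
    by (auto simp only: slice_induced_add intro!: slice_functionsI stem_function_add)
qed

lemma slice_functions_mult:
  assumes "f \<in> slice_functions K V" "g \<in> slice_functions K V"
  shows "slice_mult K f g \<in> slice_functions K V"
proof -
  obtain F1 F2 G1 G2 where F: "stem_function K V F1 F2" "f = slice_induced K F1 F2"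
    and G: "stem_function K V G1 G2" "g = slice_induced K G1 G2"
    using assms by (metis slice_functionsE)
  show ?thesis
    unfolding F(2) G(2) slice_mult_induced [OF stem_function_UNIV [OF F(1)] stem_function_UNIV [OF G(1)]]
    by (intro slice_functionsI stem_function_mult F G)
qed

lemma slice_functions_star:
  assumes "f \<in> slice_functions K V"
  shows "slice_star K f \<in> slice_functions K V"
proof -
  obtain F1 F2 where F: "stem_function K V F1 F2" "f = slice_induced K F1 F2"
    using assms by (metis slice_functionsE)
  show ?thesis
    unfolding F(2) slice_star_induced [OF stem_function_UNIV [OF F(1)]]
    by (intro slice_functionsI stem_function_star F)
qed

lemma slice_functions_scale:
  assumes "f \<in> slice_functions K V" "p \<in> V"
  shows "(\<lambda>q\<in>circ K. f q * p) \<in> slice_functions K V"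
proof -
  obtain F1 F2 where "stem_function K V F1 F2" "f = slice_induced K F1 F2"
    using assms by (metis slice_functionsE)
  then show ?thesis
    using assms(2) by (auto simp only: slice_induced_scale intro!: slice_functionsI stem_function_scale)
qed

lemma slice_functions_const: "p \<in> V \<Longrightarrow> (\<lambda>q\<in>circ K. p) \<in> slice_functions K V"
  unfolding slice_induced_const by (intro slice_functionsI stem_function_const)

lemma slice_functions_id: "(\<lambda>q\<in>circ K. q) \<in> slice_functions K V"
  unfolding slice_induced_id by (intro slice_functionsI stem_function_id)

end

text \<open>Needed before the \<open>SUP\<close> in \<open>sup_norm_on\<close> may be used as an
  upper bound.\<close>

lemma slice_function_bdd_above:
  assumes "compact K" "f \<in> slice_functions K V"
  shows "bdd_above ((\<lambda>q. norm (f q)) ` circ K)"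
proof -
  obtain F1 F2 where F: "stem_function K V F1 F2" "f = slice_induced K F1 F2"
    using assms(2) by (rule slice_functionsE)
  then have "compact (F1 ` K)" "compact (F2 ` K)"
    using assms(1) by (auto simp: stem_function_def intro: compact_continuous_image)
  then have "bounded (F1 ` K)" "bounded (F2 ` K)"
    by (simp_all add: compact_imp_bounded)
  then obtain B1 B2 where B: "\<And>z. z \<in> K \<Longrightarrow> norm (F1 z) \<le> B1" "\<And>z. z \<in> K \<Longrightarrow> norm (F2 z) \<le> B2"
    unfolding bounded_iff by auto
  show ?thesis
  proof (rule bdd_aboveI2)
    fix q assume "q \<in> circ K"
    then obtain \<alpha> \<beta> \<iota> where q: "q = of_real \<alpha> + \<iota> * of_real \<beta>" "\<iota> \<in> imag_units" "Complex \<alpha> \<beta> \<in> K"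
      using circE by blast
    have "norm (f q) \<le> norm (F1 (Complex \<alpha> \<beta>)) + norm (\<iota> * F2 (Complex \<alpha> \<beta>))"
      unfolding F(2) q(1) slice_induced_eq [OF F(1) q(2,3)] by (rule norm_triangle_ineq)
    also have "\<dots> \<le> B1 + B2"
      using B [OF q(3)] by (simp add: norm_mult norm_imag_unit [OF q(2)])
    finally show "norm (f q) \<le> B1 + B2" .
  qed
qed

section \<open>The symbol of a slice function on a half plane\<close>

text \<open>Value of \<open>f\<close> on the plane of \<open>j\<close> as a complex number. For stem
  components in that plane it is \<open>F1 + i F2\<close>, the unit of the stem being identified
  with \<open>j\<close>.\<close>

definition symbol :: "quat \<Rightarrow> (quat \<Rightarrow> quat) \<Rightarrow> complex \<Rightarrow> complex" where
  "symbol j f z = of_slice j (f (to_slice j z))"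

context
  fixes j assumes j: "j \<in> imag_units"
begin

lemma to_slice_circ: "z \<in> K \<Longrightarrow> to_slice j z \<in> circ K"
  using circI [OF j, of "Re z" "Im z" K] by (simp add: to_slice_def)

lemma slice_induced_to_slice:
  "stem_function K V F1 F2 \<Longrightarrow> z \<in> K \<Longrightarrow> slice_induced K F1 F2 (to_slice j z) = F1 z + j * F2 z"
  using slice_induced_eq [OF _ j, of K V F1 F2 "Re z" "Im z"] by (simp add: to_slice_def)

lemma slice_function_value:
  assumes f: "f \<in> slice_functions K (slice_plane j)" and z: "z \<in> K"
  shows "f (to_slice j z) = to_slice j (symbol j f z)"
proof -
  obtain F1 F2 where F: "stem_function K (slice_plane j) F1 F2" "f = slice_induced K F1 F2"
    using f by (rule slice_functionsE)
  have "F1 z \<in> slice_plane j" "F2 z \<in> slice_plane j" "j \<in> slice_plane j"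
    using F(1) z to_slice_mem [of j \<i>] by (auto simp: stem_function_def)
  then have "f (to_slice j z) \<in> slice_plane j"
    unfolding F(2) slice_induced_to_slice [OF F(1) z]
    by (intro scalar_closed [OF scalar_ring_slice_plane [OF j]])
  then show ?thesis
    by (simp add: symbol_def to_slice_of_slice [OF j])
qed

lemma continuous_on_symbol:
  assumes "f \<in> slice_functions K V"
  shows "continuous_on K (symbol j f)"
proof -
  obtain F1 F2 where F: "stem_function K V F1 F2" "f = slice_induced K F1 F2"
    using assms by (rule slice_functionsE)
  have "continuous_on K (\<lambda>z. F1 z + j * F2 z)"
    using F(1) by (auto simp: stem_function_def intro!: continuous_intros)
  then have "continuous_on K (\<lambda>z. f (to_slice j z))"
    by (rule continuous_on_eq) (simp add: F(2) slice_induced_to_slice [OF F(1)])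
  then show ?thesis
    unfolding symbol_def by (rule continuous_on_compose2 [OF continuous_on_of_slice [of UNIV]]) simp
qed

lemma symbol_add: "z \<in> K \<Longrightarrow> symbol j (\<lambda>q\<in>circ K. f q + g q) z = symbol j f z + symbol j g z"
  by (simp add: symbol_def to_slice_circ of_slice_add)

lemma symbol_const: "z \<in> K \<Longrightarrow> symbol j (\<lambda>q\<in>circ K. to_slice j c) z = c"
  by (simp add: symbol_def to_slice_circ j)

lemma symbol_id: "z \<in> K \<Longrightarrow> symbol j (\<lambda>q\<in>circ K. q) z = z"
  by (simp add: symbol_def to_slice_circ j)

lemma symbol_scale:
  assumes "f \<in> slice_functions K (slice_plane j)" "z \<in> K"
  shows "symbol j (\<lambda>q\<in>circ K. f q * to_slice j c) z = symbol j f z * c"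
  unfolding symbol_def [of j "\<lambda>q\<in>circ K. f q * to_slice j c"]
  by (simp add: to_slice_circ assms(2) slice_function_value [OF assms] j flip: to_slice_mult [OF j])

text \<open>On the plane of \<open>j\<close> the unit of the point is \<open>j\<close> itself, which
  commutes with the stem values, so the slice product becomes the complex product.\<close>

lemma symbol_mult:
  assumes "f \<in> slice_functions K (slice_plane j)" "g \<in> slice_functions K (slice_plane j)" "z \<in> K"
  shows "symbol j (slice_mult K f g) z = symbol j f z * symbol j g z"
proof -
  obtain F1 F2 where F: "stem_function K (slice_plane j) F1 F2" "f = slice_induced K F1 F2"
    using assms(1) by (rule slice_functionsE)
  obtain G1 G2 where G: "stem_function K (slice_plane j) G1 G2" "g = slice_induced K G1 G2"
    using assms(2) by (rule slice_functionsE)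
  note S = scalar_ring_slice_plane [OF j]
  obtain a b c d where ab: "F1 z = to_slice j a" "F2 z = to_slice j b"
    and cd: "G1 z = to_slice j c" "G2 z = to_slice j d"
    using F(1) G(1) assms(3) unfolding stem_function_def slice_plane_eq by (fastforce simp: Pi_iff)
  have f: "symbol j f z = a + \<i> * b" and g: "symbol j g z = c + \<i> * d"
    unfolding symbol_def F(2) G(2) slice_induced_to_slice [OF F(1) assms(3)]
      slice_induced_to_slice [OF G(1) assms(3)] ab cd
    using of_slice_to_slice [OF j, of "a + \<i> * b"] of_slice_to_slice [OF j, of "c + \<i> * d"]
    by (simp_all add: to_slice_add to_slice_mult [OF j])
  have "slice_mult K f g (to_slice j z) = to_slice j ((a * c - b * d) + \<i> * (a * d + b * c))"
    unfolding F(2) G(2) slice_mult_induced [OF stem_function_UNIV [OF F(1)] stem_function_UNIV [OF G(1)]]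
      slice_induced_to_slice [OF stem_function_mult [OF S F(1) G(1)] assms(3)] ab cd
    by (simp add: to_slice_add to_slice_mult [OF j] diff_conv_add_uminus to_slice_minus
        del: add_uminus_conv_diff)
  then show ?thesis
    unfolding symbol_def [of j "slice_mult K f g"] f g by (simp add: j algebra_simps)
qed

lemma symbol_star:
  assumes "f \<in> slice_functions K (slice_plane j)" "z \<in> K"
  shows "symbol j (slice_star K f) z = cnj (symbol j f z)"
proof -
  obtain F1 F2 where F: "stem_function K (slice_plane j) F1 F2" "f = slice_induced K F1 F2"
    using assms(1) by (rule slice_functionsE)
  note S = scalar_ring_slice_plane [OF j]
  obtain a b where ab: "F1 z = to_slice j a" "F2 z = to_slice j b"
    using F(1) assms(2) unfolding stem_function_def slice_plane_eq by (fastforce simp: Pi_iff)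
  have f: "symbol j f z = a + \<i> * b"
    unfolding symbol_def F(2) slice_induced_to_slice [OF F(1) assms(2)] ab
    using of_slice_to_slice [OF j, of "a + \<i> * b"]
    by (simp add: to_slice_add to_slice_mult [OF j])
  have "slice_star K f (to_slice j z) = to_slice j (cnj a + \<i> * (- cnj b))"
    unfolding F(2) slice_star_induced [OF stem_function_UNIV [OF F(1)]]
      slice_induced_to_slice [OF stem_function_star [OF S F(1)] assms(2)] ab
    by (simp only: to_slice_add to_slice_mult [OF j] to_slice_minus to_slice_cnj [OF j] to_slice_ii)
  then show ?thesis
    unfolding symbol_def [of j "slice_star K f"] f by (simp add: j)
qed

end

section \<open>Real slice functions\<close>

text \<open>Encodes a real stem function as one complex function whose real and imaginary part are
  its components; the parity conditions become \<open>d (cnj z) = cnj (d z)\<close>.\<close>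

definition slice_of :: "complex set \<Rightarrow> (complex \<Rightarrow> complex) \<Rightarrow> quat \<Rightarrow> quat" where
  "slice_of K d = slice_induced K (\<lambda>z. of_real (Re (d z))) (\<lambda>z. of_real (Im (d z)))"

definition conj_symmetric :: "complex set \<Rightarrow> (complex \<Rightarrow> complex) \<Rightarrow> bool" where
  "conj_symmetric K d \<longleftrightarrow> continuous_on K d \<and> (\<forall>z\<in>K. d (cnj z) = cnj (d z))"

lemma stem_function_of:
  "conj_symmetric K d \<Longrightarrow> stem_function K \<real> (\<lambda>z. of_real (Re (d z))) (\<lambda>z. of_real (Im (d z)))"
  by (auto simp: stem_function_def conj_symmetric_def intro!: continuous_intros)

lemma slice_of_mem: "conj_symmetric K d \<Longrightarrow> slice_of K d \<in> slice_functions K \<real>"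
  unfolding slice_of_def by (intro slice_functionsI stem_function_of)

lemma slice_of_value:
  assumes "conj_symmetric K d" "\<iota> \<in> imag_units" "Complex \<alpha> \<beta> \<in> K"
  shows "slice_of K d (of_real \<alpha> + \<iota> * of_real \<beta>) =
    of_real (Re (d (Complex \<alpha> \<beta>))) + \<iota> * of_real (Im (d (Complex \<alpha> \<beta>)))"
  unfolding slice_of_def by (rule slice_induced_eq [OF stem_function_of [OF assms(1)] assms(2,3)])

lemma real_slice_functionE:
  assumes "f \<in> slice_functions K \<real>"
  obtains d where "conj_symmetric K d" "f = slice_of K d"
proof -
  obtain F1 F2 where F: "stem_function K \<real> F1 F2" "f = slice_induced K F1 F2"
    using assms by (rule slice_functionsE)
  define d where "d z = Complex (qRe (F1 z)) (qRe (F2 z))" for z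
  have "continuous_on K d"
    using F(1) unfolding d_def stem_function_def
    by (intro continuous_on_Complex bounded_linear.continuous_on [OF bounded_linear_qRe]) auto
  then have "conj_symmetric K d"
    using F(1) by (auto simp: conj_symmetric_def d_def stem_function_def complex_eq_iff)
  moreover have real: "of_real (qRe q) = q" if "q \<in> \<real>" for q :: quat
    using that by (auto elim: Reals_cases)
  have "f = slice_of K d"
    unfolding F(2) slice_of_def using F(1)
    by (intro slice_induced_cong) (auto simp: d_def stem_function_def Pi_iff real)
  ultimately show thesis
    using that by blast
qed

section \<open>Density of real polynomials in \<open>z\<close> and \<open>cnj z\<close>\<close>

text \<open>These are the functions on which a real star homomorphism is determined by its value at
  the identity.\<close>

inductive conj_poly :: "(complex \<Rightarrow> complex) \<Rightarrow> bool" where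
  const: "conj_poly (\<lambda>_. of_real c)"
| ident: "conj_poly (\<lambda>z. z)"
| conj: "conj_poly cnj"
| add: "conj_poly d \<Longrightarrow> conj_poly e \<Longrightarrow> conj_poly (\<lambda>z. d z + e z)"
| mult: "conj_poly d \<Longrightarrow> conj_poly e \<Longrightarrow> conj_poly (\<lambda>z. d z * e z)"

lemma conj_poly_cnj: "conj_poly d \<Longrightarrow> d (cnj z) = cnj (d z)"
  by (induction rule: conj_poly.induct) auto

lemma conj_poly_symmetric: "conj_poly d \<Longrightarrow> conj_symmetric K d"
proof -
  assume d: "conj_poly d"
  then have "continuous_on K d"
    by (induction rule: conj_poly.induct) (auto intro!: continuous_intros)
  with d show ?thesis
    by (simp add: conj_symmetric_def conj_poly_cnj)
qed

text \<open>Even and odd with respect to \<open>cnj\<close>. The factor \<i> makes the odd part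
  conjugation symmetric, and a product of two odd parts is even because \<i> squares to the real
  number -1.\<close>

lemma real_polynomial_even_odd:
  assumes "real_polynomial_function (p :: complex \<Rightarrow> real)"
  shows "\<exists>e o'. conj_poly (\<lambda>z. of_real (e z)) \<and> conj_poly (\<lambda>z. \<i> * of_real (o' z)) \<and>
    (\<forall>z. p z = e z + o' z)"
  using assms
proof induction
  case (linear f)
  interpret bounded_linear f by fact
  have lin: "f z = f 1 * Re z + f \<i> * Im z" for z
  proof -
    have "z = Re z *\<^sub>R 1 + Im z *\<^sub>R \<i>"
      by (simp add: complex_eq_iff)
    then have "f z = f (Re z *\<^sub>R 1 + Im z *\<^sub>R \<i>)"
      by (rule arg_cong)
    then show ?thesis
      by (simp add: add scaleR)
  qed
  have even: "conj_poly (\<lambda>z. of_real (f 1 * Re z))"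
  proof -
    have "(\<lambda>z. complex_of_real (f 1 * Re z)) = (\<lambda>z. of_real (f 1 / 2) * (z + cnj z))"
      by (simp add: fun_eq_iff complex_eq_iff)
    then show ?thesis
      by (simp only:) (intro conj_poly.intros)
  qed
  have odd: "conj_poly (\<lambda>z. \<i> * of_real (f \<i> * Im z))"
  proof -
    have "(\<lambda>z. \<i> * complex_of_real (f \<i> * Im z)) = (\<lambda>z. of_real (f \<i> / 2) * (z + of_real (- 1) * cnj z))"
      by (simp add: fun_eq_iff complex_eq_iff)
    then show ?thesis
      by (simp only:) (intro conj_poly.intros)
  qed
  show ?case
    by (intro exI [of _ "\<lambda>z. f 1 * Re z"] exI [of _ "\<lambda>z. f \<i> * Im z"] conjI allI even odd lin)
next
  case (const c)
  have "conj_poly (\<lambda>_. of_real c)" "conj_poly (\<lambda>_. of_real 0)"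
    by (rule conj_poly.const)+
  then show ?case
    by (intro exI [of _ "\<lambda>_. c"] exI [of _ "\<lambda>_. 0"]) simp
next
  case (add f g)
  then obtain e o' e2 o2 where
    *: "conj_poly (\<lambda>z. of_real (e z))" "conj_poly (\<lambda>z. \<i> * of_real (o' z))" "\<And>z. f z = e z + o' z"
    "conj_poly (\<lambda>z. of_real (e2 z))" "conj_poly (\<lambda>z. \<i> * of_real (o2 z))" "\<And>z. g z = e2 z + o2 z"
    by auto
  from conj_poly.add [OF *(1,4)] conj_poly.add [OF *(2,5)] show ?case
    by (intro exI [of _ "\<lambda>z. e z + e2 z"] exI [of _ "\<lambda>z. o' z + o2 z"])
      (simp add: *(3,6) distrib_left)
next
  case (mult f g)
  then obtain e o' e2 o2 where
    *: "conj_poly (\<lambda>z. of_real (e z))" "conj_poly (\<lambda>z. \<i> * of_real (o' z))" "\<And>z. f z = e z + o' z"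
    "conj_poly (\<lambda>z. of_real (e2 z))" "conj_poly (\<lambda>z. \<i> * of_real (o2 z))" "\<And>z. g z = e2 z + o2 z"
    by auto
  have "conj_poly (\<lambda>z. of_real (e z) * of_real (e2 z) +
      of_real (- 1) * ((\<i> * of_real (o' z)) * (\<i> * of_real (o2 z))))"
    by (intro conj_poly.add conj_poly.mult conj_poly.const *)
  moreover have "conj_poly (\<lambda>z. of_real (e z) * (\<i> * of_real (o2 z)) + (\<i> * of_real (o' z)) * of_real (e2 z))"
    by (intro conj_poly.add conj_poly.mult conj_poly.const *)
  ultimately show ?case
    by (intro exI [of _ "\<lambda>z. e z * e2 z + o' z * o2 z"] exI [of _ "\<lambda>z. e z * o2 z + o' z * e2 z"])
      (simp add: *(3,6) algebra_simps)
qed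

text \<open>Re d is even and Im d is odd. Averaging the estimates at \<open>z\<close> and
  \<open>cnj z\<close>, with the sign change for Im d, removes the part of the wrong parity from
  each approximant without enlarging the error.\<close>

lemma conj_poly_dense:
  assumes K: "compact K" and cnj: "\<And>z. z \<in> K \<Longrightarrow> cnj z \<in> K" and d: "conj_symmetric K d" and "0 < \<epsilon>"
  shows "\<exists>e. conj_poly e \<and> (\<forall>z\<in>K. cmod (d z - e z) \<le> \<epsilon>)"
proof -
  have \<epsilon>: "0 < \<epsilon> / 2"
    using assms by simp
  have cont: "continuous_on K d" and dc: "\<And>z. z \<in> K \<Longrightarrow> d (cnj z) = cnj (d z)"
    using d by (auto simp: conj_symmetric_def)
  obtain p where p: "real_polynomial_function p" "\<And>z. z \<in> K \<Longrightarrow> \<bar>Re (d z) - p z\<bar> < \<epsilon> / 2"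
    using Stone_Weierstrass_real_polynomial_function [OF K continuous_on_Re [OF cont] \<epsilon>] by metis
  obtain q where q: "real_polynomial_function q" "\<And>z. z \<in> K \<Longrightarrow> \<bar>Im (d z) - q z\<bar> < \<epsilon> / 2"
    using Stone_Weierstrass_real_polynomial_function [OF K continuous_on_Im [OF cont] \<epsilon>] by metis
  obtain pe po where pe: "conj_poly (\<lambda>z. of_real (pe z))" and po: "conj_poly (\<lambda>z. \<i> * of_real (po z))"
    and p_eq: "\<And>z. p z = pe z + po z"
    using real_polynomial_even_odd [OF p(1)] by blast
  obtain qe qo where qe: "conj_poly (\<lambda>z. of_real (qe z))" and qo: "conj_poly (\<lambda>z. \<i> * of_real (qo z))"
    and q_eq: "\<And>z. q z = qe z + qo z"
    using real_polynomial_even_odd [OF q(1)] by blast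
  have sym: "pe (cnj z) = pe z" "po (cnj z) = - po z" "qe (cnj z) = qe z" "qo (cnj z) = - qo z" for z
    using conj_poly_cnj [OF pe, of z] conj_poly_cnj [OF po, of z] conj_poly_cnj [OF qe, of z]
      conj_poly_cnj [OF qo, of z] by (simp_all add: complex_eq_iff)
  have "cmod (d z - (of_real (pe z) + \<i> * of_real (qo z))) \<le> \<epsilon>" if z: "z \<in> K" for z
  proof -
    have "\<bar>Re (d z) - (pe z + po z)\<bar> < \<epsilon> / 2" "\<bar>Re (d z) - (pe z + - po z)\<bar> < \<epsilon> / 2"
      using p(2) [OF z] p(2) [OF cnj [OF z]] by (simp_all add: dc z p_eq sym)
    then have "\<bar>Re (d z) - pe z\<bar> < \<epsilon> / 2"
      unfolding abs_less_iff by linarith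
    moreover have "\<bar>Im (d z) - (qe z + qo z)\<bar> < \<epsilon> / 2" "\<bar>- Im (d z) - (qe z + - qo z)\<bar> < \<epsilon> / 2"
      using q(2) [OF z] q(2) [OF cnj [OF z]] by (simp_all add: dc z q_eq sym)
    then have "\<bar>Im (d z) - qo z\<bar> < \<epsilon> / 2"
      unfolding abs_less_iff by linarith
    ultimately show ?thesis
      using cmod_le [of "d z - (of_real (pe z) + \<i> * of_real (qo z))"] by simp
  qed
  with conj_poly.add [OF pe qo] show ?thesis
    by blast
qed

text \<open>Written as the unity times a scalar, the form in which the axioms of a homomorphism
  evaluate it.\<close>

lemma slice_of_const: "slice_of K (\<lambda>_. of_real c) = (\<lambda>q\<in>circ K. (\<lambda>q\<in>circ K. 1) q * of_real c)"
  using slice_of_value [OF conj_poly_symmetric [OF conj_poly.const]]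
  by (intro slice_eqI [where K = K]) (simp_all add: slice_of_def slice_induced_extensional circI)

lemma slice_of_ident: "slice_of K (\<lambda>z. z) = (\<lambda>q\<in>circ K. q)"
  unfolding slice_of_def slice_induced_id [OF scalar_ring_Reals] ..

lemma slice_of_cnj: "slice_of K cnj = slice_star K (\<lambda>q\<in>circ K. q)"
  unfolding slice_induced_id [OF scalar_ring_Reals] slice_of_def
    slice_star_induced [OF stem_function_UNIV [OF stem_function_id [OF scalar_ring_Reals]]]
  by simp

lemma slice_of_add:
  assumes "conj_symmetric K d" "conj_symmetric K e"
  shows "slice_of K (\<lambda>z. d z + e z) = (\<lambda>q\<in>circ K. slice_of K d q + slice_of K e q)"
  unfolding slice_of_def
    slice_induced_add [OF scalar_ring_Reals stem_function_of [OF assms(1)] stem_function_of [OF assms(2)]]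
  by simp

lemma slice_of_mult:
  assumes "conj_symmetric K d" "conj_symmetric K e"
  shows "slice_of K (\<lambda>z. d z * e z) = slice_mult K (slice_of K d) (slice_of K e)"
  unfolding slice_of_def
    slice_mult_induced [OF stem_function_UNIV [OF stem_function_of [OF assms(1)]]
      stem_function_UNIV [OF stem_function_of [OF assms(2)]]]
  by simp

lemma sup_norm_on_slice_of_le:
  assumes "circ K \<noteq> {}" "conj_symmetric K d" "conj_symmetric K e"
    and "\<And>z. z \<in> K \<Longrightarrow> cmod (d z - e z) \<le> c"
  shows "sup_norm_on (circ K) (\<lambda>q. slice_of K d q - slice_of K e q) \<le> c"
  unfolding sup_norm_on_def
proof (rule cSUP_least [OF assms(1)])
  fix q assume "q \<in> circ K"
  then obtain \<alpha> \<beta> \<iota> where q: "q = of_real \<alpha> + \<iota> * of_real \<beta>" "\<iota> \<in> imag_units" "Complex \<alpha> \<beta> \<in> K"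
    using circE by blast
  define z where "z = Complex \<alpha> \<beta>"
  have "slice_of K d q - slice_of K e q = of_real (Re (d z - e z)) + \<iota> * of_real (Im (d z - e z))"
    unfolding q(1) slice_of_value [OF assms(2) q(2,3)] slice_of_value [OF assms(3) q(2,3)] z_def
    by (simp add: algebra_simps)
  then have "norm (slice_of K d q - slice_of K e q) = cmod (d z - e z)"
    by (simp only: norm_slice_form [OF q(2)] complex_surj)
  then show "norm (slice_of K d q - slice_of K e q) \<le> c"
    using assms(4) q(3) by (simp add: z_def)
qed

section \<open>Star homomorphisms on real slice functions\<close>

lemma slice_star_homD:
  assumes "slice_star_hom K V act \<Psi>"
  shows "\<Psi> \<in> slice_functions K V \<rightarrow>\<^sub>E bounded_ops"
    and "f \<in> slice_functions K V \<Longrightarrow> g \<in> slice_functions K V \<Longrightarrow> \<Psi> (\<lambda>q\<in>circ K. f q + g q) = \<Psi> f + \<Psi> g"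
    and "f \<in> slice_functions K V \<Longrightarrow> g \<in> slice_functions K V \<Longrightarrow> \<Psi> (slice_mult K f g) = \<Psi> f o\<^sub>L \<Psi> g"
    and "f \<in> slice_functions K V \<Longrightarrow> p \<in> V \<Longrightarrow> \<Psi> (\<lambda>q\<in>circ K. f q * p) = act (\<Psi> f) p"
    and "f \<in> slice_functions K V \<Longrightarrow> \<Psi> (slice_star K f) = adj (\<Psi> f)"
    and "\<Psi> (\<lambda>q\<in>circ K. 1) = id_blinfun"
  using assms unfolding slice_star_hom_def by blast+

lemma slice_star_homI:
  assumes "\<Psi> \<in> slice_functions K V \<rightarrow>\<^sub>E bounded_ops"
    and "\<And>f g. f \<in> slice_functions K V \<Longrightarrow> g \<in> slice_functions K V \<Longrightarrow> \<Psi> (\<lambda>q\<in>circ K. f q + g q) = \<Psi> f + \<Psi> g"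
    and "\<And>f g. f \<in> slice_functions K V \<Longrightarrow> g \<in> slice_functions K V \<Longrightarrow> \<Psi> (slice_mult K f g) = \<Psi> f o\<^sub>L \<Psi> g"
    and "\<And>f p. f \<in> slice_functions K V \<Longrightarrow> p \<in> V \<Longrightarrow> \<Psi> (\<lambda>q\<in>circ K. f q * p) = act (\<Psi> f) p"
    and "\<And>f. f \<in> slice_functions K V \<Longrightarrow> \<Psi> (slice_star K f) = adj (\<Psi> f)"
    and "\<Psi> (\<lambda>q\<in>circ K. 1) = id_blinfun"
  shows "slice_star_hom K V act \<Psi>"
  using assms unfolding slice_star_hom_def by blast

text \<open>\<open>cnj\<close> corresponds to the star of the identity, so two homomorphisms
  agreeing at the identity agree on every \<open>conj_poly\<close>; continuity and density extend
  this to all real slice functions.\<close>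

lemma real_slice_hom_unique:
  assumes K: "compact K" "\<And>z. z \<in> K \<Longrightarrow> cnj z \<in> K" "circ K \<noteq> {}"
    and \<Psi>: "slice_star_hom K \<real> real_act \<Psi>" "sup_norm_continuous K \<real> \<Psi>"
    and \<Phi>: "slice_star_hom K \<real> real_act \<Phi>" "sup_norm_continuous K \<real> \<Phi>"
    and id: "\<Psi> (\<lambda>q\<in>circ K. q) = \<Phi> (\<lambda>q\<in>circ K. q)"
  shows "\<Psi> = \<Phi>"
proof (rule extensionalityI [of _ "slice_functions K \<real>"])
  show "\<Psi> \<in> extensional (slice_functions K \<real>)" "\<Phi> \<in> extensional (slice_functions K \<real>)"
    using slice_star_homD(1) [OF \<Psi>(1)] slice_star_homD(1) [OF \<Phi>(1)] by (auto simp: PiE_def)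
  note idm = slice_functions_id [OF scalar_ring_Reals, of K]
    and onem = slice_functions_const [OF scalar_ring_Reals, of 1 K]
  have poly: "\<Psi> (slice_of K e) = \<Phi> (slice_of K e)" if "conj_poly e" for e
    using that
  proof induction
    case (const c)
    have "\<Theta> (slice_of K (\<lambda>_. of_real c)) = real_act id_blinfun (of_real c)"
      if "slice_star_hom K \<real> real_act \<Theta>" for \<Theta> :: "(quat \<Rightarrow> quat) \<Rightarrow> 'a \<Rightarrow>\<^sub>L 'a"
      unfolding slice_of_const using slice_star_homD(4) [OF that onem] slice_star_homD(6) [OF that] by simp
    from this [OF \<Psi>(1)] this [OF \<Phi>(1)] show ?case
      by simp
  next
    case ident
    show ?case
      unfolding slice_of_ident by (rule id)
  next
    case conj
    then show ?case
      unfolding slice_of_cnj slice_star_homD(5) [OF \<Psi>(1) idm] slice_star_homD(5) [OF \<Phi>(1) idm] id ..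
  next
    case (add d e)
    note sym = conj_poly_symmetric [OF add(1)] conj_poly_symmetric [OF add(2)]
    note m = slice_of_mem [OF sym(1)] slice_of_mem [OF sym(2)]
    show ?case
      unfolding slice_of_add [OF sym] slice_star_homD(2) [OF \<Psi>(1) m] slice_star_homD(2) [OF \<Phi>(1) m]
      by (simp only: add.IH)
  next
    case (mult d e)
    note sym = conj_poly_symmetric [OF mult(1)] conj_poly_symmetric [OF mult(2)]
    note m = slice_of_mem [OF sym(1)] slice_of_mem [OF sym(2)]
    show ?case
      unfolding slice_of_mult [OF sym] slice_star_homD(3) [OF \<Psi>(1) m] slice_star_homD(3) [OF \<Phi>(1) m]
      by (simp only: mult.IH)
  qed
  fix f assume f: "f \<in> slice_functions K \<real>"
  then obtain d where d: "conj_symmetric K d" "f = slice_of K d"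
    by (rule real_slice_functionE)
  have "norm (\<Psi> f - \<Phi> f) \<le> 0"
  proof (rule field_le_epsilon)
    fix \<epsilon> :: real assume "0 < \<epsilon>"
    then have \<epsilon>: "0 < \<epsilon> / 2"
      by simp
    obtain \<delta>1 where \<delta>1: "0 < \<delta>1" "\<And>g. g \<in> slice_functions K \<real> \<Longrightarrow>
        sup_norm_on (circ K) (\<lambda>q. g q - f q) < \<delta>1 \<Longrightarrow> norm (\<Psi> g - \<Psi> f) < \<epsilon> / 2"
      using \<Psi>(2) f \<epsilon> unfolding sup_norm_continuous_def by blast
    obtain \<delta>2 where \<delta>2: "0 < \<delta>2" "\<And>g. g \<in> slice_functions K \<real> \<Longrightarrow>
        sup_norm_on (circ K) (\<lambda>q. g q - f q) < \<delta>2 \<Longrightarrow> norm (\<Phi> g - \<Phi> f) < \<epsilon> / 2"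
      using \<Phi>(2) f \<epsilon> unfolding sup_norm_continuous_def by blast
    \<comment> \<open>Halved because the approximation gives only \<le> \<delta>, whereas continuity
      asks for a strict inequality.\<close>
    define \<delta> where "\<delta> = min \<delta>1 \<delta>2 / 2"
    have \<delta>: "0 < \<delta>" "\<delta> < \<delta>1" "\<delta> < \<delta>2"
      using \<delta>1(1) \<delta>2(1) by (auto simp: \<delta>_def)
    obtain e where e: "conj_poly e" "\<And>z. z \<in> K \<Longrightarrow> cmod (d z - e z) \<le> \<delta>"
      using conj_poly_dense [OF K(1,2) d(1) \<delta>(1)] by blast
    note sym = conj_poly_symmetric [OF e(1), of K]
    have "sup_norm_on (circ K) (\<lambda>q. slice_of K e q - f q) \<le> \<delta>"
      unfolding d(2) using e(2)
      by (intro sup_norm_on_slice_of_le K sym d) (simp add: norm_minus_commute)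
    then have "norm (\<Psi> (slice_of K e) - \<Psi> f) < \<epsilon> / 2" "norm (\<Phi> (slice_of K e) - \<Phi> f) < \<epsilon> / 2"
      using \<delta> \<delta>1(2) [OF slice_of_mem [OF sym]] \<delta>2(2) [OF slice_of_mem [OF sym]] by linarith+
    then show "norm (\<Psi> f - \<Phi> f) \<le> 0 + \<epsilon>"
      using norm_triangle_ineq4 [of "\<Phi> (slice_of K e) - \<Phi> f" "\<Psi> (slice_of K e) - \<Psi> f"] poly [OF e(1)]
      by simp
  qed
  then show "\<Psi> f = \<Phi> f"
    by simp
qed

text \<open>Real scalars are those with second coordinate 0, where \<open>slice_act\<close> is plain
  real scaling. This links the calculus over the plane of \<open>j\<close> to
  \<open>Psi_R\<close>.\<close>

lemma slice_hom_restrict_Reals: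
  assumes j: "j \<in> imag_units" and \<Psi>: "slice_star_hom K (slice_plane j) (slice_act j J) \<Psi>"
  shows "slice_star_hom K \<real> real_act (restrict \<Psi> (slice_functions K \<real>))"
proof -
  have sub: "f \<in> slice_functions K (slice_plane j)" if "f \<in> slice_functions K \<real>" for f
    using that slice_functions_mono [OF Reals_subset_slice_plane] by blast
  note R = scalar_ring_Reals
  show ?thesis
  proof (rule slice_star_homI)
    show "restrict \<Psi> (slice_functions K \<real>) \<in> slice_functions K \<real> \<rightarrow>\<^sub>E bounded_ops"
      using slice_star_homD(1) [OF \<Psi>] sub by (auto simp: PiE_iff)
    show "restrict \<Psi> (slice_functions K \<real>) (\<lambda>q\<in>circ K. f q * p) = real_act (restrict \<Psi> (slice_functions K \<real>) f) p"
      if f: "f \<in> slice_functions K \<real>" and p: "p \<in> \<real>" for f p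
    proof -
      obtain a where a: "p = of_real a"
        using p by (rule Reals_cases)
      have "p \<in> slice_plane j"
        using p Reals_subset_slice_plane by blast
      then have "\<Psi> (\<lambda>q\<in>circ K. f q * p) = slice_act j J (\<Psi> f) (of_real a + j * of_real 0)"
        using slice_star_homD(4) [OF \<Psi> sub [OF f]] by (simp add: a)
      then show ?thesis
        unfolding slice_act_eq [OF j] using f p
        by (simp add: a real_act_of_real slice_functions_scale [OF R])
    qed
  qed (simp_all add: sub slice_functions_add [OF R] slice_functions_mult [OF R]
      slice_functions_star [OF R] slice_functions_const [OF R] slice_star_homD [OF \<Psi>])
qed

lemma sup_norm_continuous_restrict_Reals:
  assumes "sup_norm_continuous K (slice_plane j) \<Psi>"
  shows "sup_norm_continuous K \<real> (restrict \<Psi> (slice_functions K \<real>))"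
  using assms slice_functions_mono [OF Reals_subset_slice_plane, of K j]
  unfolding sup_norm_continuous_def by (simp add: subset_eq) meson

section \<open>Splitting slice functions into real ones\<close>

lemma slice_function_decomposition:
  assumes j: "j \<in> imag_units" and f: "f \<in> slice_functions K (slice_plane j)"
  obtains f0 f1 where "f0 \<in> slice_functions K \<real>" "f1 \<in> slice_functions K \<real>"
    "f = (\<lambda>q\<in>circ K. f0 q + f1 q * j)"
proof -
  obtain F1 F2 where F: "stem_function K (slice_plane j) F1 F2" "f = slice_induced K F1 F2"
    using f by (rule slice_functionsE)
  \<comment> \<open>\<open>d0\<close> collects the real parts of both stem components and
    \<open>d1\<close> their coefficients of \<open>j\<close>.\<close>
  define d0 where "d0 z = Complex (Re (of_slice j (F1 z))) (Re (of_slice j (F2 z)))" for z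
  define d1 where "d1 z = Complex (Im (of_slice j (F1 z))) (Im (of_slice j (F2 z)))" for z
  have cont: "continuous_on K (\<lambda>z. of_slice j (F1 z))" "continuous_on K (\<lambda>z. of_slice j (F2 z))"
    using F(1) by (auto simp: stem_function_def intro: continuous_on_compose2 [OF continuous_on_of_slice])
  have minus: "of_slice j (- q) = - of_slice j q" for q
    by (simp add: of_slice_def complex_eq_iff)
  have d0: "conj_symmetric K d0"
    using F(1) cont unfolding conj_symmetric_def d0_def
    by (auto simp: stem_function_def complex_eq_iff minus intro!: continuous_on_Complex continuous_intros)
  have d1: "conj_symmetric K d1"
    using F(1) cont unfolding conj_symmetric_def d1_def
    by (auto simp: stem_function_def complex_eq_iff minus intro!: continuous_on_Complex continuous_intros)
  have "f = (\<lambda>q\<in>circ K. slice_of K d0 q + slice_of K d1 q * j)"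
  proof (rule slice_eqI)
    fix \<alpha> \<beta> \<iota> assume i: "\<iota> \<in> imag_units" and z: "Complex \<alpha> \<beta> \<in> K"
    obtain a b where ab: "F1 (Complex \<alpha> \<beta>) = to_slice j a" "F2 (Complex \<alpha> \<beta>) = to_slice j b"
      using F(1) z unfolding stem_function_def slice_plane_eq by (fastforce simp: Pi_iff)
    show "f (of_real \<alpha> + \<iota> * of_real \<beta>) =
        (\<lambda>q\<in>circ K. slice_of K d0 q + slice_of K d1 q * j) (of_real \<alpha> + \<iota> * of_real \<beta>)"
      using circI [OF i z]
      by (simp add: F(2) slice_induced_eq [OF F(1) i z] slice_of_value [OF d0 i z] slice_of_value [OF d1 i z])
        (simp add: d0_def d1_def ab j, simp add: to_slice_def algebra_simps quat_of_real_commute)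
  qed (simp_all add: F(2) slice_induced_extensional)
  with slice_of_mem [OF d0] slice_of_mem [OF d1] show thesis
    by (rule that)
qed

text \<open>Evaluation on the planes parametrised by \<open>j\<close> and by \<open>- j\<close>
  yields \<open>a + b i\<close> and \<open>a - b i\<close>, which together determine
  \<open>a\<close> and \<open>b\<close>.\<close>

lemma slice_function_decomposition_unique:
  assumes j: "j \<in> imag_units"
    and f: "f0 \<in> slice_functions K \<real>" "f1 \<in> slice_functions K \<real>"
    and g: "g0 \<in> slice_functions K \<real>" "g1 \<in> slice_functions K \<real>"
    and eq: "(\<lambda>q\<in>circ K. f0 q + f1 q * j) = (\<lambda>q\<in>circ K. g0 q + g1 q * j)"
  shows "f0 = g0" "f1 = g1"
proof -
  obtain a where a: "conj_symmetric K a" "f0 = slice_of K a"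
    using f(1) by (rule real_slice_functionE)
  obtain b where b: "conj_symmetric K b" "f1 = slice_of K b"
    using f(2) by (rule real_slice_functionE)
  obtain c where c: "conj_symmetric K c" "g0 = slice_of K c"
    using g(1) by (rule real_slice_functionE)
  obtain d where d: "conj_symmetric K d" "g1 = slice_of K d"
    using g(2) by (rule real_slice_functionE)
  have "a z = c z \<and> b z = d z" if z: "z \<in> K" for z
  proof -
    have val: "slice_of K h (of_real (Re z) + \<iota> * of_real (Im z)) = of_real (Re (h z)) + \<iota> * of_real (Im (h z))"
      if "conj_symmetric K h" "\<iota> \<in> imag_units" for h \<iota>
      using slice_of_value [OF that, of "Re z" "Im z"] z by simp
    have "to_slice j (a z) + to_slice j (b z) * j = to_slice j (c z) + to_slice j (d z) * j"
      using fun_cong [OF eq, of "of_real (Re z) + j * of_real (Im z)"] circI [OF j, of "Re z" "Im z" K] z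
      by (simp add: a(2) b(2) c(2) d(2) val a(1) b(1) c(1) d(1) j to_slice_def)
    then have "to_slice j (a z + b z * \<i>) = to_slice j (c z + d z * \<i>)"
      by (simp add: to_slice_add to_slice_mult [OF j])
    then have 1: "a z + b z * \<i> = c z + d z * \<i>"
      by (simp add: j)
    \<comment> \<open>In the plane parametrised by \<open>- j\<close> the quaternion
      \<open>j\<close> is the image of \<open>- \<i>\<close>, whence the change of sign
      below.\<close>
    note j' = imag_unit_uminus [OF j]
    have "to_slice (- j) (a z) + to_slice (- j) (b z) * j = to_slice (- j) (c z) + to_slice (- j) (d z) * j"
      using fun_cong [OF eq, of "of_real (Re z) + (- j) * of_real (Im z)"]
        circI [OF j', of "Re z" "Im z" K] val [OF _ j'] z
      by (simp add: a(2) b(2) c(2) d(2) a(1) b(1) c(1) d(1) to_slice_def)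
    then have "to_slice (- j) (a z + b z * (- \<i>)) = to_slice (- j) (c z + d z * (- \<i>))"
      by (simp only: to_slice_add to_slice_mult [OF j'] to_slice_minus to_slice_ii minus_minus)
    then have 2: "a z + b z * (- \<i>) = c z + d z * (- \<i>)"
      by (simp only: to_slice_eq_iff [OF j'])
    show ?thesis
      using 1 2 by (auto simp: complex_eq_iff)
  qed
  then show "f0 = g0" "f1 = g1"
    unfolding a(2) b(2) c(2) d(2) slice_of_def by (auto intro!: slice_induced_cong)
qed

section \<open>The slice functional calculus\<close>

text \<open>
  The imaginary part of \<open>T\<close> is half of \<open>|T - T\<^sup>*|\<close>, hence positive, so \<^const>\<open>complex_normal.apsp\<close> is the
  intersection of the spectrum with the closed upper half plane.
\<close>

locale slice_calculus = complex_normal T J for T J :: "'a::quat_hilbert \<Rightarrow>\<^sub>L 'a" +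
  fixes j :: quat
  assumes j: "j \<in> imag_units" and Im_apsp: "z \<in> apsp \<Longrightarrow> 0 \<le> Im z"
begin

abbreviation K :: "complex set" where
  "K \<equiv> spectrum_base T"

abbreviation SC :: "(quat \<Rightarrow> quat) set" where
  "SC \<equiv> slice_functions K (slice_plane j)"

lemma spherical_spectrum_T_iff:
  assumes "\<iota> \<in> imag_units"
  shows "of_real \<alpha> + \<iota> * of_real \<beta> \<in> spherical_spectrum T \<longleftrightarrow>
    Complex \<alpha> \<beta> \<in> apsp \<or> Complex \<alpha> (- \<beta>) \<in> apsp"
  unfolding apsp_def mem_Collect_eq by (rule spherical_spectrum_iff [OF commutant_T normal_T assms])

lemma K_iff: "z \<in> K \<longleftrightarrow> z \<in> apsp \<or> cnj z \<in> apsp"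
proof -
  have "Complex (Re z) (Im z) = z" "Complex (Re z) (- Im z) = cnj z"
    by (simp_all add: complex_eq_iff)
  then show ?thesis
    using imag_units_nonempty by (auto simp: spectrum_base_def spherical_spectrum_T_iff)
qed

lemma apsp_subset_K: "apsp \<subseteq> K"
  by (auto simp: K_iff)

lemma compact_K: "compact K"
proof -
  have "K = apsp \<union> cnj ` apsp"
    by (auto simp: K_iff image_iff) (metis complex_cnj_cnj)
  then show ?thesis
    by (simp add: compact_Un compact_apsp compact_continuous_image continuous_on_cnj)
qed

lemma circ_K_nonempty: "circ K \<noteq> {}"
proof -
  obtain z where "z \<in> apsp"
    using apsp_nonempty by blast
  then have "to_slice j z \<in> circ K"
    using apsp_subset_K by (intro to_slice_circ [OF j]) blast
  then show ?thesis
    by blast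
qed

lemma spherical_spectrum_upper: "spherical_spectrum T \<inter> upper_half_slice j = to_slice j ` apsp"
proof (intro equalityI subsetI)
  fix q assume "q \<in> spherical_spectrum T \<inter> upper_half_slice j"
  then obtain \<alpha> \<beta> where q: "q = of_real \<alpha> + j * of_real \<beta>" "0 \<le> \<beta>" "q \<in> spherical_spectrum T"
    by (auto simp: upper_half_slice_def)
  then have "Complex \<alpha> \<beta> \<in> apsp \<or> Complex \<alpha> (- \<beta>) \<in> apsp"
    using spherical_spectrum_T_iff [OF j] by blast
  \<comment> \<open>If the conjugate point is the one in \<open>apsp\<close>, then \<beta> = 0 and
    the two points coincide.\<close>
  then have "Complex \<alpha> \<beta> \<in> apsp"
    using Im_apsp [of "Complex \<alpha> (- \<beta>)"] q(2) by auto
  then show "q \<in> to_slice j ` apsp"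
    by (auto simp: q(1) simp flip: to_slice_Complex)
next
  fix q assume "q \<in> to_slice j ` apsp"
  then obtain z where z: "q = to_slice j z" "z \<in> apsp"
    by blast
  then show "q \<in> spherical_spectrum T \<inter> upper_half_slice j"
    using spherical_spectrum_T_iff [OF j, of "Re z" "Im z"] Im_apsp [OF z(2)]
    by (auto simp: upper_half_slice_def to_slice_def)
qed

text \<open>\<open>calculus\<close> reads the symbol on \<open>apsp\<close> only, that is
  \<open>f\<close> on the upper half plane; this is where the kernel arises. The restriction to
  \<open>SC\<close> supplies the extensionality required of a homomorphism.\<close>

definition Psi :: "(quat \<Rightarrow> quat) \<Rightarrow> 'a \<Rightarrow>\<^sub>L 'a" where
  "Psi = (\<lambda>f\<in>SC. THE P. calculus (symbol j f) P)"

lemma Psi_calculus: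
  assumes "f \<in> SC"
  shows "calculus (symbol j f) (Psi f)"
proof -
  have "continuous_on apsp (symbol j f)"
    using continuous_on_symbol [OF j assms] apsp_subset_K by (rule continuous_on_subset)
  then obtain P where P: "calculus (symbol j f) P"
    using calculus_exists by blast
  then have "(THE P. calculus (symbol j f) P) = P"
    using calculus_unique by blast
  with P assms show ?thesis
    by (simp add: Psi_def)
qed

lemma Psi_eqI:
  assumes "f \<in> SC" "calculus \<phi> P" "\<And>z. z \<in> K \<Longrightarrow> \<phi> z = symbol j f z"
  shows "Psi f = P"
proof (rule calculus_unique [OF Psi_calculus [OF assms(1)]])
  show "calculus (symbol j f) P"
    using assms(2) by (rule calculus_cong) (use assms(3) apsp_subset_K in blast)
qed

lemma Psi_hom: "slice_star_hom K (slice_plane j) (slice_act j J) Psi"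
proof -
  note S = scalar_ring_slice_plane [OF j]
  show ?thesis
  proof (rule slice_star_homI)
    show "Psi \<in> SC \<rightarrow>\<^sub>E bounded_ops"
      using calculus_bounded_ops [OF Psi_calculus] by (auto simp: PiE_iff Psi_def)
    show "Psi (\<lambda>q\<in>circ K. f q + g q) = Psi f + Psi g" if "f \<in> SC" "g \<in> SC" for f g
      by (rule Psi_eqI [OF slice_functions_add [OF S that] calculus_add [OF Psi_calculus Psi_calculus]])
        (use that symbol_add [OF j] in auto)
    show "Psi (slice_mult K f g) = Psi f o\<^sub>L Psi g" if "f \<in> SC" "g \<in> SC" for f g
      by (rule Psi_eqI [OF slice_functions_mult [OF S that] calculus_compose [OF Psi_calculus Psi_calculus]])
        (use that symbol_mult [OF j] in auto)
    show "Psi (slice_star K f) = adj (Psi f)" if "f \<in> SC" for f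
      by (rule Psi_eqI [OF slice_functions_star [OF S that] calculus_adj [OF Psi_calculus]])
        (use that symbol_star [OF j] in auto)
    show "Psi (\<lambda>q\<in>circ K. 1) = id_blinfun"
    proof (rule Psi_eqI [OF slice_functions_const [OF S]])
      show "calculus (\<lambda>_. 1) id_blinfun"
        using calculus_const [of 1] by (simp add: cop_1)
      show "1 = symbol j (\<lambda>q\<in>circ K. 1) z" if "z \<in> K" for z
        using symbol_const [OF j that, of 1] by simp
    qed (rule scalar_closed [OF S])
    show "Psi (\<lambda>q\<in>circ K. f q * p) = slice_act j J (Psi f) p" if f: "f \<in> SC" and p: "p \<in> slice_plane j" for f p
    proof -
      obtain c where c: "p = to_slice j c"
        using p by (auto simp: slice_plane_eq)
      have "Psi (\<lambda>q\<in>circ K. f q * p) = cop c o\<^sub>L Psi f"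
        by (rule Psi_eqI [OF slice_functions_scale [OF S f p] calculus_mult_const [OF Psi_calculus [OF f]]])
          (simp add: c symbol_scale [OF j f] mult.commute)
      also have "\<dots> = Re c *\<^sub>R Psi f + ((Im c *\<^sub>R Psi f) o\<^sub>L J)"
        by (rule blinfun_eqI)
          (simp add: cop_apply blinfun.bilinear_simps commutantD [OF calculus_commutant [OF Psi_calculus [OF f]]])
      also have "\<dots> = slice_act j J (Psi f) p"
        unfolding c to_slice_def by (rule slice_act_eq [OF j, symmetric])
      finally show ?thesis .
    qed
  qed
qed

lemma Psi_id: "Psi (\<lambda>q\<in>circ K. q) = T"
  by (rule Psi_eqI [OF slice_functions_id [OF scalar_ring_slice_plane [OF j]] calculus_id])
    (simp add: symbol_id [OF j])

lemma norm_Psi_diff_attained: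
  assumes f: "f \<in> SC" and g: "g \<in> SC"
  obtains q where "q \<in> circ K" "norm (Psi g - Psi f) = norm (g q - f q)"
proof -
  obtain z where z: "z \<in> apsp" "norm (Psi g - Psi f) = cmod (symbol j g z - symbol j f z)"
    using calculus_norm_attained [OF calculus_diff [OF Psi_calculus [OF g] Psi_calculus [OF f]]] by blast
  have zK: "z \<in> K"
    using z(1) apsp_subset_K by blast
  have "g (to_slice j z) - f (to_slice j z) = to_slice j (symbol j g z - symbol j f z)"
    unfolding slice_function_value [OF j f zK] slice_function_value [OF j g zK]
    using to_slice_add [of j "symbol j g z - symbol j f z" "symbol j f z"] by simp
  then have "norm (Psi g - Psi f) = norm (g (to_slice j z) - f (to_slice j z))"
    by (simp add: z(2) norm_to_slice [OF j])
  then show thesis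
    by (rule that [OF to_slice_circ [OF j zK]])
qed

text \<open>\<delta> = \<epsilon> works, since the norm of the difference of two operators is a
  value of the pointwise distance of the two functions.\<close>

lemma Psi_continuous: "sup_norm_continuous K (slice_plane j) Psi"
  unfolding sup_norm_continuous_def
proof (intro ballI allI impI)
  fix f and \<epsilon> :: real assume f: "f \<in> SC" and \<epsilon>: "0 < \<epsilon>"
  have "norm (Psi g - Psi f) < \<epsilon>" if g: "g \<in> SC" and sn: "sup_norm_on (circ K) (\<lambda>q. g q - f q) < \<epsilon>" for g
  proof -
    obtain q where q: "q \<in> circ K" "norm (Psi g - Psi f) = norm (g q - f q)"
      using norm_Psi_diff_attained [OF f g] .
    obtain B C where "\<And>q. q \<in> circ K \<Longrightarrow> norm (g q) \<le> B" "\<And>q. q \<in> circ K \<Longrightarrow> norm (f q) \<le> C"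
      using slice_function_bdd_above [OF compact_K g] slice_function_bdd_above [OF compact_K f]
      by (auto simp: bdd_above_def)
    then have "norm (g q - f q) \<le> B + C" if "q \<in> circ K" for q
      using that by (intro order_trans [OF norm_triangle_ineq4] add_mono) auto
    then have "bdd_above ((\<lambda>q. norm (g q - f q)) ` circ K)"
      by (rule bdd_aboveI2)
    from cSUP_upper [OF q(1) this] show ?thesis
      using sn q(2) by (simp add: sup_norm_on_def)
  qed
  with \<epsilon> show "\<exists>\<delta>>0. \<forall>g\<in>SC. sup_norm_on (circ K) (\<lambda>q. g q - f q) < \<delta> \<longrightarrow> norm (Psi g - Psi f) < \<epsilon>"
    by blast
qed

definition calculus_hom :: "((quat \<Rightarrow> quat) \<Rightarrow> 'a \<Rightarrow>\<^sub>L 'a) \<Rightarrow> bool" where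
  "calculus_hom \<Phi> \<longleftrightarrow> slice_star_hom K (slice_plane j) (slice_act j J) \<Phi> \<and>
     sup_norm_continuous K (slice_plane j) \<Phi> \<and> \<Phi> (\<lambda>q\<in>circ K. q) = T"

lemma calculus_hom_Psi: "calculus_hom Psi"
  by (simp add: calculus_hom_def Psi_hom Psi_continuous Psi_id)

section \<open>Relation to the real calculus and uniqueness\<close>

text \<open>The restriction of \<Phi> satisfies the defining conditions and is the only such map, so
  the definite description denotes it. Existence of the real calculus is thus obtained from the
  larger one.\<close>

lemma Psi_R_eq:
  assumes "calculus_hom \<Phi>"
  shows "Psi_R T = restrict \<Phi> (slice_functions K \<real>)"
  unfolding Psi_R_def
proof (rule the_equality)
  let ?R = "restrict \<Phi> (slice_functions K \<real>)"
  have hom: "slice_star_hom K \<real> real_act ?R" and cont: "sup_norm_continuous K \<real> ?R"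
    using assms by (auto simp: calculus_hom_def intro: slice_hom_restrict_Reals [OF j]
        sup_norm_continuous_restrict_Reals)
  have id: "?R (\<lambda>q\<in>circ K. q) = T"
    using assms slice_functions_id [OF scalar_ring_Reals, of K] by (simp add: calculus_hom_def)
  show "slice_star_hom K \<real> real_act ?R \<and> sup_norm_continuous K \<real> ?R \<and>
      ?R (\<lambda>q\<in>spherical_spectrum T. 1) = id_blinfun \<and> ?R (\<lambda>q\<in>spherical_spectrum T. q) = T"
    unfolding circ_spectrum_base [symmetric] using hom cont id slice_star_homD(6) [OF hom] by blast
  fix \<Theta> assume "slice_star_hom K \<real> real_act \<Theta> \<and> sup_norm_continuous K \<real> \<Theta> \<and>
      \<Theta> (\<lambda>q\<in>spherical_spectrum T. 1) = id_blinfun \<and> \<Theta> (\<lambda>q\<in>spherical_spectrum T. q) = T"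
  then have \<Theta>: "slice_star_hom K \<real> real_act \<Theta>" "sup_norm_continuous K \<real> \<Theta>" "\<Theta> (\<lambda>q\<in>circ K. q) = T"
    by (simp_all only: circ_spectrum_base)
  show "\<Theta> = ?R"
    by (rule real_slice_hom_unique [OF compact_K cnj_spectrum_base circ_K_nonempty \<Theta>(1,2) hom cont])
      (simp_all only: \<Theta>(3) id)
qed

text \<open>Proved for every admissible \<Phi>, not just \<open>Psi\<close>: the right-hand side
  does not depend on \<Phi>, so the same formula also gives uniqueness.\<close>

lemma calculus_hom_decomposition:
  assumes \<Phi>: "calculus_hom \<Phi>" and f: "f0 \<in> slice_functions K \<real>" "f1 \<in> slice_functions K \<real>"
  shows "\<Phi> (\<lambda>q\<in>circ K. f0 q + f1 q * j) = Psi_R T f0 + (Psi_R T f1 o\<^sub>L J)"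
proof -
  have hom: "slice_star_hom K (slice_plane j) (slice_act j J) \<Phi>"
    using \<Phi> by (simp add: calculus_hom_def)
  have SC: "f0 \<in> SC" "f1 \<in> SC"
    using f slice_functions_mono [OF Reals_subset_slice_plane] by blast+
  have jp: "j \<in> slice_plane j"
    using to_slice_mem [of j \<i>] by simp
  have "\<Phi> (\<lambda>q\<in>circ K. f0 q + f1 q * j) = \<Phi> (\<lambda>q\<in>circ K. f0 q + (\<lambda>q\<in>circ K. f1 q * j) q)"
    by (intro arg_cong [of _ _ \<Phi>] restrict_ext) simp
  also have "\<dots> = \<Phi> f0 + slice_act j J (\<Phi> f1) j"
    unfolding slice_star_homD(2) [OF hom SC(1) slice_functions_scale [OF scalar_ring_slice_plane [OF j] SC(2) jp]]
      slice_star_homD(4) [OF hom SC(2) jp] ..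
  also have "slice_act j J (\<Phi> f1) j = \<Phi> f1 o\<^sub>L J"
    using slice_act_eq [OF j, of J "\<Phi> f1" 0 1] by simp
  finally show ?thesis
    unfolding Psi_R_eq [OF \<Phi>] restrict_apply' [OF f(1)] restrict_apply' [OF f(2)] .
qed

lemma calculus_hom_unique:
  assumes \<Phi>: "calculus_hom \<Phi>"
  shows "\<Phi> = Psi"
proof (rule extensionalityI [of _ SC])
  show "\<Phi> \<in> extensional SC" "Psi \<in> extensional SC"
    using slice_star_homD(1) [of K "slice_plane j" "slice_act j J"] \<Phi> Psi_hom
    by (auto simp: calculus_hom_def PiE_def)
  fix f assume "f \<in> SC"
  then obtain f0 f1 where f: "f0 \<in> slice_functions K \<real>" "f1 \<in> slice_functions K \<real>"
    "f = (\<lambda>q\<in>circ K. f0 q + f1 q * j)"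
    using slice_function_decomposition [OF j] by blast
  show "\<Phi> f = Psi f"
    unfolding f(3) calculus_hom_decomposition [OF \<Phi> f(1,2)]
      calculus_hom_decomposition [OF calculus_hom_Psi f(1,2)] ..
qed

lemma real_decomposition_ex1:
  assumes "f \<in> SC"
  shows "\<exists>!(f0, f1). f0 \<in> slice_functions K \<real> \<and> f1 \<in> slice_functions K \<real> \<and>
    f = (\<lambda>q\<in>circ K. f0 q + f1 q * j)"
proof -
  obtain f0 f1 where f: "f0 \<in> slice_functions K \<real>" "f1 \<in> slice_functions K \<real>"
    "f = (\<lambda>q\<in>circ K. f0 q + f1 q * j)"
    using slice_function_decomposition [OF j assms] by blast
  show ?thesis
  proof (rule ex1I [of _ "(f0, f1)"])
    fix p assume p: "case p of (g0, g1) \<Rightarrow> g0 \<in> slice_functions K \<real> \<and> g1 \<in> slice_functions K \<real> \<and>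
      f = (\<lambda>q\<in>circ K. g0 q + g1 q * j)"
    obtain g0 g1 where "p = (g0, g1)"
      by (cases p)
    with p f slice_function_decomposition_unique [OF j, of g0 K g1 f0 f1] show "p = (f0, f1)"
      by auto
  qed (use f in auto)
qed

section \<open>Normality, spectrum, norm and kernel\<close>

lemma Psi_commutes:
  assumes "f \<in> SC"
  shows "normal_op (Psi f)" "Psi f o\<^sub>L J = J o\<^sub>L Psi f"
  using calculus_normal [OF Psi_calculus [OF assms]] calculus_commutant [OF Psi_calculus [OF assms]]
  by (auto simp: commutant_def)

lemma image_upper:
  assumes "f \<in> SC"
  shows "f ` (spherical_spectrum T \<inter> upper_half_slice j) = to_slice j ` symbol j f ` apsp"
  unfolding spherical_spectrum_upper image_image
  using slice_function_value [OF j assms] apsp_subset_K by (intro image_cong) auto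

text \<open>By spectral mapping the approximate eigenvalues of \<open>Psi f\<close> are the values
  of its symbol on \<open>apsp\<close>. Both signs of \<beta> occur because a quaternion may be
  written with \<iota> or with its negative.\<close>

lemma spherical_spectrum_Psi:
  assumes f: "f \<in> SC"
  shows "spherical_spectrum (Psi f) = circ_slice j (f ` (spherical_spectrum T \<inter> upper_half_slice j))"
proof -
  define E where "E = symbol j f ` apsp"
  note c = Psi_calculus [OF f]
  have iff: "of_real \<alpha> + \<iota> * of_real \<beta> \<in> spherical_spectrum (Psi f) \<longleftrightarrow>
      Complex \<alpha> \<beta> \<in> E \<or> Complex \<alpha> (- \<beta>) \<in> E" if "\<iota> \<in> imag_units" for \<iota> \<alpha> \<beta>
    unfolding E_def calculus_spectrum [OF c, symmetric]
    by (rule spherical_spectrum_iff [OF calculus_commutant [OF c] calculus_normal [OF c] that])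
  have mem: "of_real \<alpha> + j * of_real \<beta> \<in> to_slice j ` E \<longleftrightarrow> Complex \<alpha> \<beta> \<in> E" for \<alpha> \<beta>
    unfolding to_slice_Complex [symmetric] by (auto simp: j)
  show ?thesis
    unfolding image_upper [OF f] E_def [symmetric]
  proof (intro equalityI subsetI)
    fix q assume q: "q \<in> spherical_spectrum (Psi f)"
    obtain \<alpha> \<beta> \<iota> where i: "\<iota> \<in> imag_units" and q_eq: "q = of_real \<alpha> + \<iota> * of_real \<beta>"
      using quat_slice_form by blast
    have q_eq': "q = of_real \<alpha> + (- \<iota>) * of_real (- \<beta>)"
      by (simp add: q_eq)
    from q iff [OF i] consider "Complex \<alpha> \<beta> \<in> E" | "Complex \<alpha> (- \<beta>) \<in> E"
      unfolding q_eq by blast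
    then show "q \<in> circ_slice j (to_slice j ` E)"
    proof cases
      case 1
      then show ?thesis
        unfolding circ_slice_def mem using i q_eq by blast
    next
      case 2
      then show ?thesis
        unfolding circ_slice_def mem using imag_unit_uminus [OF i] q_eq' by blast
    qed
  next
    fix q assume "q \<in> circ_slice j (to_slice j ` E)"
    then show "q \<in> spherical_spectrum (Psi f)"
      unfolding circ_slice_def mem using iff by blast
  qed
qed

lemma norm_Psi_le:
  assumes f: "f \<in> SC"
  shows "norm (Psi f) \<le> sup_norm_on (spherical_spectrum T) f"
proof -
  obtain z where z: "z \<in> apsp" "norm (Psi f) = cmod (symbol j f z)"
    using calculus_norm_attained [OF Psi_calculus [OF f]] by blast
  have zK: "z \<in> K"
    using z(1) apsp_subset_K by blast
  have "norm (Psi f) = norm (f (to_slice j z))"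
    by (simp add: slice_function_value [OF j f zK] norm_to_slice [OF j] z(2))
  also have "\<dots> \<le> sup_norm_on (circ K) f"
    unfolding sup_norm_on_def
    by (rule cSUP_upper [OF to_slice_circ [OF j zK] slice_function_bdd_above [OF compact_K f]])
  finally show ?thesis
    by (simp only: circ_spectrum_base)
qed

lemma norm_Psi:
  assumes f: "f \<in> SC"
  shows "norm (Psi f) = sup_norm_on (spherical_spectrum T \<inter> upper_half_slice j) f"
proof -
  note c = Psi_calculus [OF f]
  have val: "norm (f (to_slice j z)) = cmod (symbol j f z)" if "z \<in> apsp" for z
    using slice_function_value [OF j f, of z] apsp_subset_K that by (auto simp: norm_to_slice [OF j])
  have "sup_norm_on (spherical_spectrum T \<inter> upper_half_slice j) f = (SUP z\<in>apsp. cmod (symbol j f z))"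
    unfolding sup_norm_on_def spherical_spectrum_upper image_image using val by (intro SUP_cong) auto
  also have "\<dots> = norm (Psi f)"
  proof (rule antisym)
    show "(SUP z\<in>apsp. cmod (symbol j f z)) \<le> norm (Psi f)"
      by (intro cSUP_least apsp_nonempty calculus_norm_ge [OF c])
    obtain z where z: "z \<in> apsp" "norm (Psi f) = cmod (symbol j f z)"
      using calculus_norm_attained [OF c] by blast
    show "norm (Psi f) \<le> (SUP z\<in>apsp. cmod (symbol j f z))"
      unfolding z(2) using calculus_norm_ge [OF c]
      by (intro cSUP_upper z(1) bdd_aboveI2 [of _ _ "norm (Psi f)"])
  qed
  finally show ?thesis ..
qed

lemma Psi_eq_0_iff:
  assumes f: "f \<in> SC"
  shows "Psi f = 0 \<longleftrightarrow> (\<forall>q\<in>spherical_spectrum T \<inter> upper_half_slice j. f q = 0)"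
proof -
  have "f (to_slice j z) = 0 \<longleftrightarrow> symbol j f z = 0" if "z \<in> apsp" for z
    using slice_function_value [OF j f, of z] apsp_subset_K that to_slice_eq_iff [OF j, of _ 0] by auto
  then show ?thesis
    unfolding calculus_eq_0_iff [OF Psi_calculus [OF f]] spherical_spectrum_upper by auto
qed

lemma spherical_spectrum_slice: "q \<in> spherical_spectrum T \<Longrightarrow> q \<in> slice_plane j \<Longrightarrow> of_slice j q \<in> K"
proof -
  assume q: "q \<in> spherical_spectrum T" "q \<in> slice_plane j"
  then obtain z where z: "q = to_slice j z"
    by (auto simp: slice_plane_eq)
  have "of_real (Re z) + j * of_real (Im z) \<in> spherical_spectrum T"
    using q(1) by (simp add: z to_slice_def)
  then have "Complex (Re z) (Im z) \<in> K"
    unfolding spherical_spectrum_T_iff [OF j] K_iff complex_cnj .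
  then show "of_slice j q \<in> K"
    by (simp add: z j)
qed

text \<open>On a function in the kernel the stem components satisfy \<open>F\<^sub>1 = - j F\<^sub>2\<close> in the upper half plane.\<close>

lemma Psi_kernel:
  assumes f: "f \<in> SC"
  shows "Psi f = 0 \<longleftrightarrow>
    (\<exists>g. continuous_on (spherical_spectrum T \<inter> lower_half_slice j) g \<and>
      g \<in> spherical_spectrum T \<inter> lower_half_slice j \<rightarrow> slice_plane j \<and>
      (\<forall>q\<in>spherical_spectrum T \<inter> \<real>. g q = 0) \<and>
      (\<forall>\<alpha> \<beta> \<iota>. 0 \<le> \<beta> \<and> \<iota> \<in> imag_units \<and> of_real \<alpha> + \<iota> * of_real \<beta> \<in> spherical_spectrum T \<longrightarrow>
         f (of_real \<alpha> + \<iota> * of_real \<beta>) = (1/2) * (1 + \<iota> * j) * g (of_real \<alpha> - j * of_real \<beta>)))"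
  (is "_ \<longleftrightarrow> (\<exists>g. ?P g)")
proof
  assume "\<exists>g. ?P g"
  then obtain g where g: "?P g" ..
  show "Psi f = 0"
    unfolding Psi_eq_0_iff [OF f]
  proof
    fix q assume "q \<in> spherical_spectrum T \<inter> upper_half_slice j"
    then obtain \<alpha> \<beta> where q: "q = of_real \<alpha> + j * of_real \<beta>" "0 \<le> \<beta>" "q \<in> spherical_spectrum T"
      by (auto simp: upper_half_slice_def)
    \<comment> \<open>At \<iota> = j the factor \<open>1 + j * j\<close> vanishes.\<close>
    then have "f q = (1/2) * (1 + j * j) * g (of_real \<alpha> - j * of_real \<beta>)"
      using g j by blast
    then show "f q = 0"
      by (simp add: imag_unit_square [OF j])
  qed
next
  assume "Psi f = 0"
  then have zero: "\<And>q. q \<in> spherical_spectrum T \<Longrightarrow> q \<in> upper_half_slice j \<Longrightarrow> f q = 0"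
    unfolding Psi_eq_0_iff [OF f] by blast
  obtain F1 F2 where F: "stem_function K (slice_plane j) F1 F2" "f = slice_induced K F1 F2"
    using f by (rule slice_functionsE)
  have lower: "q \<in> slice_plane j" if "q \<in> lower_half_slice j" for q
    using that by (auto simp: lower_half_slice_def slice_plane_def)
  have vals: "f q = to_slice j (symbol j f (of_slice j q))" "of_slice j q \<in> K"
    if q: "q \<in> spherical_spectrum T \<inter> lower_half_slice j" for q
  proof -
    show "of_slice j q \<in> K"
      using q lower by (intro spherical_spectrum_slice) auto
    from slice_function_value [OF j f this] show "f q = to_slice j (symbol j f (of_slice j q))"
      using to_slice_of_slice [OF j] lower q by auto
  qed
  \<comment> \<open>The witness for \<open>g\<close> is \<open>f\<close> itself, read on the lower
    half plane.\<close>
  have "?P f"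
  proof (intro conjI ballI allI impI)
    have "continuous_on (spherical_spectrum T \<inter> lower_half_slice j) (\<lambda>q. to_slice j (symbol j f (of_slice j q)))"
      using vals(2)
      by (intro continuous_on_compose2 [OF continuous_on_to_slice [of UNIV]]
          continuous_on_compose2 [OF continuous_on_symbol [OF j f]] continuous_on_of_slice) auto
    then show "continuous_on (spherical_spectrum T \<inter> lower_half_slice j) f"
      by (rule continuous_on_eq) (simp add: vals(1))
    show "f \<in> spherical_spectrum T \<inter> lower_half_slice j \<rightarrow> slice_plane j"
      using vals(1) to_slice_mem by auto
    show "f q = 0" if q: "q \<in> spherical_spectrum T \<inter> \<real>" for q
    proof -
      obtain r where "q = of_real r"
        using q by (auto simp: Reals_def)
      then have "q = of_real r + j * of_real 0"
        by simp
      then have "q \<in> upper_half_slice j"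
        unfolding upper_half_slice_def by blast
      with zero q show ?thesis
        by blast
    qed
    fix \<alpha> \<beta> \<iota> assume "0 \<le> \<beta> \<and> \<iota> \<in> imag_units \<and> of_real \<alpha> + \<iota> * of_real \<beta> \<in> spherical_spectrum T"
    then have b: "0 \<le> \<beta>" and i: "\<iota> \<in> imag_units" and sp: "of_real \<alpha> + \<iota> * of_real \<beta> \<in> spherical_spectrum T"
      by auto
    have z: "Complex \<alpha> \<beta> \<in> K"
      using sp unfolding spherical_spectrum_T_iff [OF i] K_iff complex_cnj .
    have "of_real \<alpha> + j * of_real \<beta> \<in> spherical_spectrum T"
      using sp unfolding spherical_spectrum_T_iff [OF i] spherical_spectrum_T_iff [OF j] .
    moreover have "of_real \<alpha> + j * of_real \<beta> \<in> upper_half_slice j"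
      using b by (auto simp: upper_half_slice_def)
    ultimately have "f (of_real \<alpha> + j * of_real \<beta>) = 0"
      by (rule zero)
    then have F1: "F1 (Complex \<alpha> \<beta>) = - (j * F2 (Complex \<alpha> \<beta>))"
      unfolding F(2) slice_induced_eq [OF F(1) j z] by (simp add: eq_neg_iff_add_eq_0)
    have fi: "f (of_real \<alpha> + \<iota> * of_real \<beta>) = F1 (Complex \<alpha> \<beta>) + \<iota> * F2 (Complex \<alpha> \<beta>)"
      unfolding F(2) by (rule slice_induced_eq [OF F(1) i z])
    have "f (of_real \<alpha> + (- j) * of_real \<beta>) = F1 (Complex \<alpha> \<beta>) + (- j) * F2 (Complex \<alpha> \<beta>)"
      unfolding F(2) by (rule slice_induced_eq [OF F(1) imag_unit_uminus [OF j] z])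
    then have fj: "f (of_real \<alpha> - j * of_real \<beta>) = - (2 *\<^sub>R (j * F2 (Complex \<alpha> \<beta>)))"
      by (simp add: F1 scaleR_2)
    \<comment> \<open>Multiplied out with \<open>j * j = - 1\<close>, this returns \<open>F1\<close>
      plus \<iota> times \<open>F2\<close>, as \<open>F1 = - (j * F2)\<close> here.\<close>
    have half: "(1/2) * (1 + \<iota> * j) * - (2 *\<^sub>R (j * w)) = - (j * w) + \<iota> * w" for w
    proof -
      have h: "(1/2 :: quat) = (1/2) *\<^sub>R 1"
        by (metis of_real_def of_real_divide of_real_1 of_real_numeral)
      have "(1/2) * (1 + \<iota> * j) * - (2 *\<^sub>R (j * w)) = - (j * w + \<iota> * (j * j) * w)"
        unfolding h by (simp add: distrib_right mult.assoc)
      then show ?thesis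
        by (simp add: imag_unit_square [OF j])
    qed
    show "f (of_real \<alpha> + \<iota> * of_real \<beta>) = (1/2) * (1 + \<iota> * j) * f (of_real \<alpha> - j * of_real \<beta>)"
      unfolding fi fj half by (simp add: F1)
  qed
  then show "\<exists>g. ?P g"
    by blast
qed

end

section \<open>From the polar form of the imaginary part to the half plane condition\<close>

text \<open>The decomposition of \<open>T\<close> says that \<open>J\<close> times the positive
  operator \<open>abs_op (T - adj T)\<close> is \<open>T - adj T\<close>. On approximate
  eigenvectors of \<open>T\<close> at \<open>z\<close> that positive operator is nearly
  \<open>2 * Im z\<close>, so \<open>Im z\<close> cannot be negative.\<close>

lemma slice_calculus_intro:
  fixes T J :: "'a::quat_hilbert \<Rightarrow>\<^sub>L 'a" and j :: quat
  assumes T: "T \<in> bounded_ops" "normal_op T"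
    and j: "j \<in> imag_units"
    and J: "J \<in> bounded_ops" "anti_self_adjoint J" "unitary_op J"
    and comm: "T o\<^sub>L J = J o\<^sub>L T" "adj T o\<^sub>L J = J o\<^sub>L adj T"
    and T_eq: "T = (1/2) *\<^sub>R (T + adj T) + (1/2) *\<^sub>R (J o\<^sub>L abs_op (T - adj T))"
  shows "slice_calculus T J j"
proof -
  have adjJ: "adj J = - J"
    using J(2) by (simp add: anti_self_adjoint_def)
  have "adj J o\<^sub>L J = id_blinfun"
    using J(3) by (simp add: unitary_op_def)
  then have "- (J o\<^sub>L J) = id_blinfun"
    by (simp add: adjJ bounded_bilinear.minus_left [OF bounded_bilinear_blinfun_compose])
  then have JJ: "J o\<^sub>L J = - id_blinfun"
    by (metis minus_minus)
  interpret complex_normal T J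
    by standard (use T J adjJ JJ comm in auto)
  define B where "B = abs_op (T - adj T)"
  have CB: "T - adj T \<in> bounded_ops"
    by (intro bounded_ops_diff T adj_bounded_ops)
  have B: "positive_op B"
    unfolding B_def by (rule positive_abs_op [OF CB])
  have JB: "J (B u) = T u - adj T u" for u
  proof -
    have "T u = (1/2) *\<^sub>R (T u + adj T u) + (1/2) *\<^sub>R J (B u)"
      using arg_cong [OF T_eq, of "\<lambda>P. P u"] by (simp add: B_def blinfun.bilinear_simps)
    then have "2 *\<^sub>R T u = 2 *\<^sub>R ((1/2) *\<^sub>R (T u + adj T u) + (1/2) *\<^sub>R J (B u))"
      by (rule arg_cong)
    then show ?thesis
      by (simp add: scaleR_add_right scaleR_2 algebra_simps)
  qed
  have "0 \<le> Im z" if z: "z \<in> apsp" for z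
  proof -
    have "- Im z \<le> 0"
    proof (rule field_le_epsilon)
      fix e :: real assume "0 < e"
      then obtain u where u: "norm u = 1" "norm (T u - cop z u) < e"
        using apspD [OF z] by blast
      \<comment> \<open>Difference of the approximate eigenvalue equations of \<open>T\<close> at
        \<open>z\<close> and of \<open>adj T\<close> at \<open>cnj z\<close>; by normality both
        errors have the same norm, and \<open>J\<close> is isometric.\<close>
      have "J (B u - (2 * Im z) *\<^sub>R u) = (T u - cop z u) - (adj T u - cop (cnj z) u)"
        by (simp add: blinfun.bilinear_simps JB cop_apply)
          (simp add: algebra_simps flip: scaleR_add_left)
      then have "norm (B u - (2 * Im z) *\<^sub>R u) \<le> norm (T u - cop z u) + norm (adj T u - cop (cnj z) u)"
        using norm_triangle_ineq4 [of "T u - cop z u" "adj T u - cop (cnj z) u"] norm_J by metis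
      then have "norm (B u - (2 * Im z) *\<^sub>R u) \<le> 2 * e"
        using u(2) by (simp add: norm_adj_shift [OF commutant_T normal_T])
      moreover have "inner u (B u - (2 * Im z) *\<^sub>R u) \<le> norm u * norm (B u - (2 * Im z) *\<^sub>R u)"
        by (rule norm_cauchy_schwarz)
      moreover have "inner u (B u - (2 * Im z) *\<^sub>R u) = inner u (B u) - 2 * Im z"
        using u(1) by (simp add: inner_diff_right dot_square_norm)
      ultimately show "- Im z \<le> 0 + e"
        using positive_op_inner [OF B, of u] u(1) by simp
    qed
    then show ?thesis
      by simp
  qed
  then show ?thesis
    by unfold_locales (use j in auto)
qed

theorem theorem7p8:
  fixes T J :: "'a::quat_hilbert \<Rightarrow>\<^sub>L 'a" and j :: quat
  assumes "T \<in> bounded_ops" and "normal_op T"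
    and "j \<in> imag_units"
    and "J \<in> bounded_ops" and "anti_self_adjoint J" and "unitary_op J"
    and "T o\<^sub>L J = J o\<^sub>L T" and "adj T o\<^sub>L J = J o\<^sub>L adj T"
    and "T = (1/2) *\<^sub>R (T + adj T) + (1/2) *\<^sub>R (J o\<^sub>L abs_op (T - adj T))"
  shows "\<exists>\<Psi>.
    (slice_star_hom (spectrum_base T) (slice_plane j) (slice_act j J) \<Psi> \<and>
     sup_norm_continuous (spectrum_base T) (slice_plane j) \<Psi> \<and>
     \<Psi> (\<lambda>q\<in>spherical_spectrum T. 1) = id_blinfun \<and>
     \<Psi> (\<lambda>q\<in>spherical_spectrum T. q) = T) \<and>
    (\<forall>\<Psi>'.
     slice_star_hom (spectrum_base T) (slice_plane j) (slice_act j J) \<Psi>' \<and>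
     sup_norm_continuous (spectrum_base T) (slice_plane j) \<Psi>' \<and>
     \<Psi>' (\<lambda>q\<in>spherical_spectrum T. 1) = id_blinfun \<and>
     \<Psi>' (\<lambda>q\<in>spherical_spectrum T. q) = T \<longrightarrow> \<Psi>' = \<Psi>) \<and>
    (\<forall>f\<in>slice_functions (spectrum_base T) (slice_plane j).
      (\<exists>!(f0, f1). f0 \<in> slice_functions (spectrum_base T) \<real> \<and>
         f1 \<in> slice_functions (spectrum_base T) \<real> \<and>
         f = (\<lambda>q\<in>spherical_spectrum T. f0 q + f1 q * j)) \<and>
      (\<forall>f0\<in>slice_functions (spectrum_base T) \<real>. \<forall>f1\<in>slice_functions (spectrum_base T) \<real>.
         f = (\<lambda>q\<in>spherical_spectrum T. f0 q + f1 q * j) \<longrightarrow>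
         \<Psi> f = Psi_R T f0 + (Psi_R T f1 o\<^sub>L J))) \<and>
    (\<forall>f\<in>slice_functions (spectrum_base T) (slice_plane j).
       normal_op (\<Psi> f) \<and> \<Psi> f o\<^sub>L J = J o\<^sub>L \<Psi> f) \<and>
    (\<forall>f\<in>slice_functions (spectrum_base T) (slice_plane j).
       spherical_spectrum (\<Psi> f) = circ_slice j (f ` (spherical_spectrum T \<inter> upper_half_slice j))) \<and>
    (\<forall>f\<in>slice_functions (spectrum_base T) (slice_plane j).
       norm (\<Psi> f) \<le> sup_norm_on (spherical_spectrum T) f \<and>
       norm (\<Psi> f) = sup_norm_on (spherical_spectrum T \<inter> upper_half_slice j) f) \<and>
    (\<forall>f\<in>slice_functions (spectrum_base T) (slice_plane j).
       (\<Psi> f = 0 \<longleftrightarrow> (\<forall>q\<in>spherical_spectrum T \<inter> upper_half_slice j. f q = 0)) \<and>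
       (\<Psi> f = 0 \<longleftrightarrow>
         (\<exists>g. continuous_on (spherical_spectrum T \<inter> lower_half_slice j) g \<and>
              g \<in> spherical_spectrum T \<inter> lower_half_slice j \<rightarrow> slice_plane j \<and>
              (\<forall>q\<in>spherical_spectrum T \<inter> \<real>. g q = 0) \<and>
              (\<forall>\<alpha> \<beta> \<iota>. 0 \<le> \<beta> \<and> \<iota> \<in> imag_units \<and> of_real \<alpha> + \<iota> * of_real \<beta> \<in> spherical_spectrum T \<longrightarrow>
                 f (of_real \<alpha> + \<iota> * of_real \<beta>) =
                   (1/2) * (1 + \<iota> * j) * g (of_real \<alpha> - j * of_real \<beta>)))))"
proof -
  interpret slice_calculus T J j
    by (rule slice_calculus_intro) (fact assms)+
  note cs = circ_spectrum_base [of T]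
  show ?thesis
  proof (intro exI [of _ Psi] conjI ballI)
    show "slice_star_hom K (slice_plane j) (slice_act j J) Psi"
      by (rule Psi_hom)
    show "sup_norm_continuous K (slice_plane j) Psi"
      by (rule Psi_continuous)
    show "Psi (\<lambda>q\<in>spherical_spectrum T. 1) = id_blinfun"
      using slice_star_homD(6) [OF Psi_hom] unfolding cs .
    show "Psi (\<lambda>q\<in>spherical_spectrum T. q) = T"
      using Psi_id unfolding cs .
    show "\<forall>\<Psi>'. slice_star_hom K (slice_plane j) (slice_act j J) \<Psi>' \<and>
        sup_norm_continuous K (slice_plane j) \<Psi>' \<and>
        \<Psi>' (\<lambda>q\<in>spherical_spectrum T. 1) = id_blinfun \<and>
        \<Psi>' (\<lambda>q\<in>spherical_spectrum T. q) = T \<longrightarrow> \<Psi>' = Psi"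
      using calculus_hom_unique unfolding calculus_hom_def cs by blast
    fix f assume f: "f \<in> SC"
    show "\<exists>!(f0, f1). f0 \<in> slice_functions K \<real> \<and> f1 \<in> slice_functions K \<real> \<and>
        f = (\<lambda>q\<in>spherical_spectrum T. f0 q + f1 q * j)"
      using real_decomposition_ex1 [OF f] unfolding cs .
    show "normal_op (Psi f)" "Psi f o\<^sub>L J = J o\<^sub>L Psi f"
      by (rule Psi_commutes [OF f])+
    show "spherical_spectrum (Psi f) = circ_slice j (f ` (spherical_spectrum T \<inter> upper_half_slice j))"
      by (rule spherical_spectrum_Psi [OF f])
    show "norm (Psi f) \<le> sup_norm_on (spherical_spectrum T) f"
      by (rule norm_Psi_le [OF f])
    show "norm (Psi f) = sup_norm_on (spherical_spectrum T \<inter> upper_half_slice j) f"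
      by (rule norm_Psi [OF f])
    show "Psi f = 0 \<longleftrightarrow> (\<forall>q\<in>spherical_spectrum T \<inter> upper_half_slice j. f q = 0)"
      by (rule Psi_eq_0_iff [OF f])
    note Psi_kernel [OF f]
    then show "Psi f = 0 \<longleftrightarrow>
      (\<exists>g. continuous_on (spherical_spectrum T \<inter> lower_half_slice j) g \<and>
        g \<in> spherical_spectrum T \<inter> lower_half_slice j \<rightarrow> slice_plane j \<and>
        (\<forall>q\<in>spherical_spectrum T \<inter> \<real>. g q = 0) \<and>
        (\<forall>\<alpha> \<beta> \<iota>. 0 \<le> \<beta> \<and> \<iota> \<in> imag_units \<and> of_real \<alpha> + \<iota> * of_real \<beta> \<in> spherical_spectrum T \<longrightarrow>
          f (of_real \<alpha> + \<iota> * of_real \<beta>) =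
            (1/2) * (1 + \<iota> * j) * g (of_real \<alpha> - j * of_real \<beta>)))" .
    fix f0 f1 assume "f0 \<in> slice_functions K \<real>" "f1 \<in> slice_functions K \<real>"
    from calculus_hom_decomposition [OF calculus_hom_Psi this]
    show "f = (\<lambda>q\<in>spherical_spectrum T. f0 q + f1 q * j) \<longrightarrow> Psi f = Psi_R T f0 + (Psi_R T f1 o\<^sub>L J)"
      unfolding cs by blast
  qed
qed

end
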